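(* Let $(\mathcal{B},\mathcal{L},\theta,\mathcal{I}_\alpha;\mathcal{J})$ be a relative generalized Boolean dynamical system and let $(\tilde{\mathcal{B}},\mathcal{L},\tilde{\theta},\tilde{\mathcal{I}}_\alpha;\tilde{\mathcal{J}})$, $\iota:\mathcal{B}\to\tilde{\mathcal{B}}$ and $\iota_\gamma:\mathcal{R}_\gamma\to\tilde{\mathcal{B}}$ ($\gamma\in\mathcal{L}^*$) be the extended system and the maps constructed in the context. Then $\iota$ is injective, and there is a $*$-isomorphism $\phi:C^*(\mathcal{B},\mathcal{L},\theta,\mathcal{I}_\alpha;\mathcal{J})\to C^*(\tilde{\mathcal{B}},\mathcal{L},\tilde{\theta},\tilde{\mathcal{I}}_\alpha;\tilde{\mathcal{J}})$ such that $$\phi(p_A)=p_{\iota(A)}\ \text{ for }A\in\mathcal{B},$$ $$\phi(s_{\alpha,B})=s_{\alpha,\iota(B)}\ \text{ for }\alpha\in\mathcal{L}\text{ and }B\in\mathcal{I}_\alpha,$$ $$\phi(s_{\gamma,C}s_{\gamma,C}^* )=p_{\iota_\gamma(C)}\ \text{ for }\gamma\in\mathcal{L}^*\text{ and }C\in\mathcal{R}_\gamma.$$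
   Context: A Boolean algebra is a distributive, relatively complemented lattice $\mathcal{B}$ with a least element $\emptyset$ (a top element is not required); meet, join and relative complement are written $\cap,\cup,\setminus$ and the order $\subseteq$. An ideal of $\mathcal{B}$ is a nonempty subset closed under finite unions and downward closed; for an ideal $\mathcal{I}$, $\mathcal{B}/\mathcal{I}$ is the quotient Boolean algebra by the relation $A\sim B$ iff $A\cup A'=B\cup B'$ for some $A',B'\in\mathcal{I}$. A Boolean homomorphism preserves $\cap,\cup,\setminus$; an action on $\mathcal{B}$ is a Boolean homomorphism $\mathcal{B}\to\mathcal{B}$ sending $\emptyset$ to $\emptyset$. A Boolean dynamical system $(\mathcal{B},\mathcal{L},\theta)$ consists of a Boolean algebra $\mathcal{B}$, a set $\mathcal{L}$ and a family $\theta=(\theta_\alpha)_{\alpha\in\mathcal{L}}$ of actions on $\mathcal{B}$. $\mathcal{L}^*$ is the set of finite words over $\mathcal{L}$, including the empty word $\emptyset$; $\theta_{\beta_1\cdots\beta_n}:=\theta_{\beta_n}\circ\cdots\circ\theta_{\beta_1}$ and $\theta_\emptyset:=\mathrm{Id}$. For $B\in\mathcal{B}$ put $\Delta_B:=\{\alpha\in\mathcal{L}:\theta_\alpha(B)\neq\emptyset\}$. An element $A\in\mathcal{B}$ is regular if $0<|\Delta_B|<\infty$ for every nonempty $B\subseteq A$; $\mathcal{B}_{\mathrm{reg}}$ is the ideal of regular elements. For $\beta\in\mathcal{L}^*$ let $\mathcal{R}_\beta:=\{A\in\mathcal{B}:A\subseteq\theta_\beta(B)\text{ for some }B\in\mathcal{B}\}$,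 so $\mathcal{R}_\emptyset=\mathcal{B}$. A generalized Boolean dynamical system $(\mathcal{B},\mathcal{L},\theta,\mathcal{I}_\alpha)$ is a Boolean dynamical system with a family $\{\mathcal{I}_\alpha\}_{\alpha\in\mathcal{L}}$ of ideals of $\mathcal{B}$ such that $\mathcal{R}_\alpha\subseteq\mathcal{I}_\alpha$ for all $\alpha\in\mathcal{L}$. A relative generalized Boolean dynamical system $(\mathcal{B},\mathcal{L},\theta,\mathcal{I}_\alpha;\mathcal{J})$ has in addition an ideal $\mathcal{J}$ of $\mathcal{B}_{\mathrm{reg}}$. $C^*(\mathcal{B},\mathcal{L},\theta,\mathcal{I}_\alpha;\mathcal{J})$ is the universal $C^*$-algebra generated by projections $\{p_A:A\in\mathcal{B}\}$ and partial isometries $\{s_{\alpha,B}:\alpha\in\mathcal{L},B\in\mathcal{I}_\alpha\}$ such that for $A,A'\in\mathcal{B}$, $\alpha,\alpha'\in\mathcal{L}$, $B\in\mathcal{I}_\alpha$, $B'\in\mathcal{I}_{\alpha'}$: (i) $p_\emptyset=0$, $p_{A\cap A'}=p_Ap_{A'}$, $p_{A\cup A'}=p_A+p_{A'}-p_{A\cap A'}$; (ii) $p_As_{\alpha,B}=s_{\alpha,B}p_{\theta_\alpha(A)}$; (iii) $s_{\alpha,B}^*s_{\alpha',B'}=\delta_{\alpha,\alpha'}p_{B\cap B'}$; (iv) $p_A=\sum_{\alpha\in\Delta_A}s_{\alpha,\theta_\alpha(A)}s_{\alpha,\theta_\alpha(A)}^*$ for all $A\in\mathcal{J}$. For words: $\mathcal{I}_\emptyset:=\mathcal{B}$,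 and for $\gamma=\gamma_1\cdots\gamma_n$ with $n\ge1$, $\mathcal{I}_\gamma:=\{A\in\mathcal{B}:A\subseteq\theta_{\gamma_2\cdots\gamma_n}(B)\text{ for some }B\in\mathcal{I}_{\gamma_1}\}$ (so $\mathcal{R}_\gamma\subseteq\mathcal{I}_\gamma$). For $A\in\mathcal{I}_\gamma$: $s_{\emptyset,A}:=p_A$; $s_{\gamma,A}$ is the given generator if $n=1$; and for $n\ge2$, $s_{\gamma,A}:=s_{\gamma_1,B}s_{\gamma_2,\theta_{\gamma_2}(B)}s_{\gamma_3,\theta_{\gamma_2\gamma_3}(B)}\cdots s_{\gamma_{n-1},\theta_{\gamma_2\cdots\gamma_{n-1}}(B)}s_{\gamma_n,A}$, where $B\in\mathcal{I}_{\gamma_1}$ is such that $A\subseteq\theta_{\gamma_2\cdots\gamma_n}(B)$. Extended system. $\prod_{\beta\in\mathcal{L}^*}\mathcal{R}_\beta$ is the Boolean algebra of families $(A_\beta)_{\beta\in\mathcal{L}^*}$, $A_\beta\in\mathcal{R}_\beta$, with componentwise operations. $\overline{\mathcal{B}}$ is the Boolean subalgebra of those $(A_\beta)_\beta$ for which $A_{\beta\alpha}=\theta_\alpha(A_\beta)$ for all but finitely many pairs $(\beta,\alpha)\in\mathcal{L}^*\times\mathcal{L}$. For $\alpha\in\mathcal{L}$, $\overline{\theta}_\alpha((A_\beta)_\beta):=(A_{\alpha\beta})_\beta$, which maps $\overline{\mathcal{B}}$ to itself. $\overline{\mathcal{I}}$ is the ideal of $\overline{\mathcal{B}}$ of those $(A_\beta)_\beta\in\overline{\mathcal{B}}$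 with $A_\beta\in\mathcal{J}$ for all $\beta$ and $A_\beta=\emptyset$ for all but finitely many $\beta$. Let $\tilde{\mathcal{B}}:=\overline{\mathcal{B}}/\overline{\mathcal{I}}$ with quotient map $q$, and let $\tilde{\theta}_\alpha$ be the action on $\tilde{\mathcal{B}}$ induced by $\overline{\theta}_\alpha$. Let $\tilde{\mathcal{I}}_\alpha:=q(\{(A_\beta)_\beta\in\overline{\mathcal{B}}:A_\beta\in\mathcal{I}_{\alpha\beta}\text{ for all }\beta\in\mathcal{L}^*\})$ for $\alpha\in\mathcal{L}$, and $\tilde{\mathcal{J}}:=q(\{(A_\beta)_\beta\in\overline{\mathcal{B}}:A_\emptyset\in\mathcal{J}\})$. Then $(\tilde{\mathcal{B}},\mathcal{L},\tilde{\theta},\tilde{\mathcal{I}}_\alpha;\tilde{\mathcal{J}})$ is a relative generalized Boolean dynamical system. For $\gamma\in\mathcal{L}^*$, $\iota_\gamma:\mathcal{R}_\gamma\to\tilde{\mathcal{B}}$ is the Boolean homomorphism $\iota_\gamma(A):=q((B_\beta)_\beta)$ with $B_\beta=\theta_{\beta'}(A)$ if $\beta=\gamma\beta'$ for some $\beta'\in\mathcal{L}^*$, and $B_\beta=\emptyset$ if $\beta$ does not begin with $\gamma$. Finally $\iota:=\iota_\emptyset:\mathcal{B}\to\tilde{\mathcal{B}}$. *)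

theory Defs
  imports
    Complex_Main
    "HOL-Library.FuncSet"
    "HOL-Library.Poly_Mapping"
    "HOL-Library.Sublist"
begin

section \<open>Boolean algebras, ideals, quotients\<close>

text \<open>
  A top element is not required, and quotients have to be formed; so Boolean algebras are
  rendered with an explicit carrier rather than by the type class \<open>boolean_algebra\<close>.
\<close>

record 'b boolalg =
  car  :: "'b set"
  meet :: "'b \<Rightarrow> 'b \<Rightarrow> 'b"
  join :: "'b \<Rightarrow> 'b \<Rightarrow> 'b"
  diff :: "'b \<Rightarrow> 'b \<Rightarrow> 'b"
  bot  :: 'b

definition ble :: "'b boolalg \<Rightarrow> 'b \<Rightarrow> 'b \<Rightarrow> bool" where
  "ble X A B \<longleftrightarrow> meet X A B = A"

text \<open>
  The last two axioms say that \<open>diff X A B\<close> is the complement of \<open>meet X A B\<close> relative to \<open>A\<close>.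
\<close>

locale bool_alg =
  fixes X :: "'b boolalg"
  assumes bot_closed: "bot X \<in> car X"
    and meet_closed: "A \<in> car X \<Longrightarrow> B \<in> car X \<Longrightarrow> meet X A B \<in> car X"
    and join_closed: "A \<in> car X \<Longrightarrow> B \<in> car X \<Longrightarrow> join X A B \<in> car X"
    and diff_closed: "A \<in> car X \<Longrightarrow> B \<in> car X \<Longrightarrow> diff X A B \<in> car X"
    and meet_comm: "A \<in> car X \<Longrightarrow> B \<in> car X \<Longrightarrow> meet X A B = meet X B A"
    and join_comm: "A \<in> car X \<Longrightarrow> B \<in> car X \<Longrightarrow> join X A B = join X B A"
    and meet_assoc: "A \<in> car X \<Longrightarrow> B \<in> car X \<Longrightarrow> C \<in> car X \<Longrightarrow>
      meet X (meet X A B) C = meet X A (meet X B C)"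
    and join_assoc: "A \<in> car X \<Longrightarrow> B \<in> car X \<Longrightarrow> C \<in> car X \<Longrightarrow>
      join X (join X A B) C = join X A (join X B C)"
    and meet_join_absorb: "A \<in> car X \<Longrightarrow> B \<in> car X \<Longrightarrow> meet X A (join X A B) = A"
    and join_meet_absorb: "A \<in> car X \<Longrightarrow> B \<in> car X \<Longrightarrow> join X A (meet X A B) = A"
    and meet_join_distrib: "A \<in> car X \<Longrightarrow> B \<in> car X \<Longrightarrow> C \<in> car X \<Longrightarrow>
      meet X A (join X B C) = join X (meet X A B) (meet X A C)"
    and bot_least: "A \<in> car X \<Longrightarrow> ble X (bot X) A"
    and diff_disjoint: "A \<in> car X \<Longrightarrow> B \<in> car X \<Longrightarrow> meet X (diff X A B) (meet X A B) = bot X"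
    and diff_cover: "A \<in> car X \<Longrightarrow> B \<in> car X \<Longrightarrow> join X (diff X A B) (meet X A B) = A"

definition bool_ideal :: "'b boolalg \<Rightarrow> 'b set \<Rightarrow> bool" where
  "bool_ideal X I \<longleftrightarrow> I \<subseteq> car X \<and> I \<noteq> {} \<and>
     (\<forall>A\<in>I. \<forall>B\<in>I. join X A B \<in> I) \<and>
     (\<forall>A\<in>I. \<forall>B\<in>car X. ble X B A \<longrightarrow> B \<in> I)"

definition bool_hom :: "'b boolalg \<Rightarrow> 'c boolalg \<Rightarrow> ('b \<Rightarrow> 'c) \<Rightarrow> bool" where
  "bool_hom X Y f \<longleftrightarrow> (\<forall>A\<in>car X. f A \<in> car Y) \<and>
     (\<forall>A\<in>car X. \<forall>B\<in>car X.
        f (meet X A B) = meet Y (f A) (f B) \<and>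
        f (join X A B) = join Y (f A) (f B) \<and>
        f (diff X A B) = diff Y (f A) (f B))"

definition quot_rel :: "'b boolalg \<Rightarrow> 'b set \<Rightarrow> ('b \<times> 'b) set" where
  "quot_rel X I = {(A, B). A \<in> car X \<and> B \<in> car X \<and>
     (\<exists>A'\<in>I. \<exists>B'\<in>I. join X A A' = join X B B')}"

definition quot_map :: "'b boolalg \<Rightarrow> 'b set \<Rightarrow> 'b \<Rightarrow> 'b set" where
  "quot_map X I A = quot_rel X I `` {A}"

definition quot_alg :: "'b boolalg \<Rightarrow> 'b set \<Rightarrow> 'b set boolalg" where
  "quot_alg X I =
    \<lparr> car  = car X // quot_rel X I,
      meet = (\<lambda>P Q. \<Union>A\<in>P. \<Union>B\<in>Q. quot_map X I (meet X A B)),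
      join = (\<lambda>P Q. \<Union>A\<in>P. \<Union>B\<in>Q. quot_map X I (join X A B)),
      diff = (\<lambda>P Q. \<Union>A\<in>P. \<Union>B\<in>Q. quot_map X I (diff X A B)),
      bot  = quot_map X I (bot X) \<rparr>"


section \<open>Relative generalized Boolean dynamical systems\<close>

record ('b, 'l) bds =
  alg    :: "'b boolalg"
  labels :: "'l set"
  act    :: "'l \<Rightarrow> 'b \<Rightarrow> 'b"
  Idl    :: "'l \<Rightarrow> 'b set"
  Jdl    :: "'b set"

text \<open>The first letter of the word acts first.\<close>

definition act_word :: "('b, 'l) bds \<Rightarrow> 'l list \<Rightarrow> 'b \<Rightarrow> 'b" where
  "act_word S w = fold (act S) w"

definition Delta :: "('b, 'l) bds \<Rightarrow> 'b \<Rightarrow> 'l set" where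
  "Delta S B = {a \<in> labels S. act S a B \<noteq> bot (alg S)}"

definition regular :: "('b, 'l) bds \<Rightarrow> 'b set" where
  "regular S = {A \<in> car (alg S). \<forall>B\<in>car (alg S). ble (alg S) B A \<and> B \<noteq> bot (alg S) \<longrightarrow>
     finite (Delta S B) \<and> Delta S B \<noteq> {}}"

definition Rw :: "('b, 'l) bds \<Rightarrow> 'l list \<Rightarrow> 'b set" where
  "Rw S w = {A \<in> car (alg S). \<exists>B\<in>car (alg S). ble (alg S) A (act_word S w B)}"

fun Iw :: "('b, 'l) bds \<Rightarrow> 'l list \<Rightarrow> 'b set" where
  "Iw S [] = car (alg S)"
| "Iw S (a # w) = {A \<in> car (alg S). \<exists>B\<in>Idl S a. ble (alg S) A (act_word S w B)}"

locale relative_gbds = bool_alg "alg S" for S :: "('b, 'l) bds" +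
  assumes act_hom: "a \<in> labels S \<Longrightarrow> bool_hom (alg S) (alg S) (act S a)"
    and act_bot: "a \<in> labels S \<Longrightarrow> act S a (bot (alg S)) = bot (alg S)"
    and Idl_ideal: "a \<in> labels S \<Longrightarrow> bool_ideal (alg S) (Idl S a)"
    and Rw_subset_Idl: "a \<in> labels S \<Longrightarrow> Rw S [a] \<subseteq> Idl S a"
    and Jdl_ideal: "bool_ideal ((alg S)\<lparr>car := regular S\<rparr>) (Jdl S)"


section \<open>Universal C*-algebras given by generators and relations\<close>

text \<open>
  The free *-algebra on a set \<open>G\<close> is the space of finitely supported complex functions on
  nonempty words in the letters \<open>g\<close> and \<open>g*\<close> with \<open>g \<in> G\<close>; the letter \<open>g\<close> is encoded by
  \<open>(g, False)\<close> and \<open>g*\<close> by \<open>(g, True)\<close>. Words form a monoid, so \<open>'g fword \<Rightarrow>\<^sub>0 complex\<close> with its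
  library ring structure is the free unital algebra; since the universal C*-algebra is not unital
  in general, \<open>free_car\<close> below excludes the empty word.
\<close>

datatype 'g fword = FWord (letters: "('g \<times> bool) list")

instantiation fword :: (type) monoid_add
begin

definition zero_fword :: "'a fword" where
  "zero_fword = FWord []"

definition plus_fword :: "'a fword \<Rightarrow> 'a fword \<Rightarrow> 'a fword" where
  "plus_fword u v = FWord (letters u @ letters v)"

instance
  by standard (simp_all add: zero_fword_def plus_fword_def)

end

type_synonym 'g free = "'g fword \<Rightarrow>\<^sub>0 complex"

definition free_car :: "'g set \<Rightarrow> 'g free set" where
  "free_car G = {x. \<forall>w\<in>Poly_Mapping.keys x. letters w \<noteq> [] \<and> fst ` set (letters w) \<subseteq> G}"

definition free_gen :: "'g \<Rightarrow> 'g free" where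
  "free_gen g = Poly_Mapping.single (FWord [(g, False)]) 1"

definition free_scale :: "complex \<Rightarrow> 'g free \<Rightarrow> 'g free" where
  "free_scale c x = Poly_Mapping.single 0 c * x"

definition word_adj :: "'g fword \<Rightarrow> 'g fword" where
  "word_adj w = FWord (rev (map (\<lambda>(g, b). (g, \<not> b)) (letters w)))"

definition free_star :: "'g free \<Rightarrow> 'g free" where
  "free_star x = (\<Sum>w\<in>Poly_Mapping.keys x.
     Poly_Mapping.single (word_adj w) (cnj (Poly_Mapping.lookup x w)))"

text \<open>
  C*-seminorms on the free *-algebra that vanish on a set \<open>R\<close> of relators. Their pointwise
  supremum is finite (hence given by the real supremum) whenever the relations bound the norm of
  every generator; this is the case below, where all generators are partial isometries.
\<close>

definition cstar_seminorm :: "'g set \<Rightarrow> 'g free set \<Rightarrow> ('g free \<Rightarrow> real) \<Rightarrow> bool" where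
  "cstar_seminorm G R N \<longleftrightarrow>
     (\<forall>x\<in>free_car G. 0 \<le> N x) \<and>
     (\<forall>x\<in>free_car G. \<forall>y\<in>free_car G. N (x + y) \<le> N x + N y) \<and>
     (\<forall>x\<in>free_car G. \<forall>c. N (free_scale c x) = cmod c * N x) \<and>
     (\<forall>x\<in>free_car G. \<forall>y\<in>free_car G. N (x * y) \<le> N x * N y) \<and>
     (\<forall>x\<in>free_car G. N (free_star x * x) = (N x)\<^sup>2) \<and>
     (\<forall>r\<in>R. N r = 0)"

definition univ_seminorm :: "'g set \<Rightarrow> 'g free set \<Rightarrow> 'g free \<Rightarrow> real" where
  "univ_seminorm G R x = (SUP N\<in>{N. cstar_seminorm G R N}. N x)"

text \<open>
  The universal C*-algebra on \<open>G\<close> subject to \<open>R\<close> is the Hausdorff completion of the free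
  *-algebra with respect to the largest C*-seminorm vanishing on \<open>R\<close>, realised as Cauchy
  sequences modulo null sequences.
\<close>

definition cauchy_seqs :: "'g set \<Rightarrow> 'g free set \<Rightarrow> (nat \<Rightarrow> 'g free) set" where
  "cauchy_seqs G R = {x. (\<forall>n. x n \<in> free_car G) \<and>
     (\<forall>e>0. \<exists>M. \<forall>m\<ge>M. \<forall>n\<ge>M. univ_seminorm G R (x m - x n) < e)}"

definition null_rel :: "'g set \<Rightarrow> 'g free set \<Rightarrow> ((nat \<Rightarrow> 'g free) \<times> (nat \<Rightarrow> 'g free)) set" where
  "null_rel G R = {(x, y). x \<in> cauchy_seqs G R \<and> y \<in> cauchy_seqs G R \<and>
     (\<lambda>n. univ_seminorm G R (x n - y n)) \<longlonglongrightarrow> 0}"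

record 'c cstar =
  ccar   :: "'c set"
  cadd   :: "'c \<Rightarrow> 'c \<Rightarrow> 'c"
  cmult  :: "'c \<Rightarrow> 'c \<Rightarrow> 'c"
  cscale :: "complex \<Rightarrow> 'c \<Rightarrow> 'c"
  cadj   :: "'c \<Rightarrow> 'c"
  cnorm  :: "'c \<Rightarrow> real"

type_synonym 'g univ = "(nat \<Rightarrow> 'g free) set"

definition univ_cstar :: "'g set \<Rightarrow> 'g free set \<Rightarrow> 'g univ cstar" where
  "univ_cstar G R =
    \<lparr> ccar   = cauchy_seqs G R // null_rel G R,
      cadd   = (\<lambda>X Y. \<Union>x\<in>X. \<Union>y\<in>Y. null_rel G R `` {\<lambda>n. x n + y n}),
      cmult  = (\<lambda>X Y. \<Union>x\<in>X. \<Union>y\<in>Y. null_rel G R `` {\<lambda>n. x n * y n}),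
      cscale = (\<lambda>c X. \<Union>x\<in>X. null_rel G R `` {\<lambda>n. free_scale c (x n)}),
      cadj   = (\<lambda>X. \<Union>x\<in>X. null_rel G R `` {\<lambda>n. free_star (x n)}),
      cnorm  = (\<lambda>X. lim (\<lambda>n. univ_seminorm G R ((SOME x. x \<in> X) n))) \<rparr>"

definition univ_elem :: "'g set \<Rightarrow> 'g free set \<Rightarrow> 'g free \<Rightarrow> 'g univ" where
  "univ_elem G R x = null_rel G R `` {\<lambda>_. x}"

definition star_hom :: "'c cstar \<Rightarrow> 'd cstar \<Rightarrow> ('c \<Rightarrow> 'd) \<Rightarrow> bool" where
  "star_hom C D f \<longleftrightarrow> (\<forall>x\<in>ccar C. f x \<in> ccar D) \<and>
     (\<forall>x\<in>ccar C. \<forall>y\<in>ccar C. f (cadd C x y) = cadd D (f x) (f y)) \<and>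
     (\<forall>x\<in>ccar C. \<forall>y\<in>ccar C. f (cmult C x y) = cmult D (f x) (f y)) \<and>
     (\<forall>c. \<forall>x\<in>ccar C. f (cscale C c x) = cscale D c (f x)) \<and>
     (\<forall>x\<in>ccar C. f (cadj C x) = cadj D (f x))"

definition star_iso :: "'c cstar \<Rightarrow> 'd cstar \<Rightarrow> ('c \<Rightarrow> 'd) \<Rightarrow> bool" where
  "star_iso C D f \<longleftrightarrow> star_hom C D f \<and> bij_betw f (ccar C) (ccar D)"


section \<open>The C*-algebra of a relative generalized Boolean dynamical system\<close>

datatype ('b, 'l) gen = PGen 'b | SGen 'l 'b

abbreviation pf :: "'b \<Rightarrow> ('b, 'l) gen free" where
  "pf A \<equiv> free_gen (PGen A)"

abbreviation sf :: "'l \<Rightarrow> 'b \<Rightarrow> ('b, 'l) gen free" where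
  "sf a B \<equiv> free_gen (SGen a B)"

definition gens :: "('b, 'l) bds \<Rightarrow> ('b, 'l) gen set" where
  "gens S = PGen ` car (alg S) \<union> {SGen a B | a B. a \<in> labels S \<and> B \<in> Idl S a}"

text \<open>
  A relation \<open>x = y\<close> is encoded by the relator \<open>x - y\<close>. The first three rules express that the
  \<open>p\<^sub>A\<close> are projections and the \<open>s\<^bsub>\<alpha>,B\<^esub>\<close> partial isometries.
\<close>

inductive_set relators :: "('b, 'l) bds \<Rightarrow> ('b, 'l) gen free set" for S :: "('b, 'l) bds" where
  proj_adj: "A \<in> car (alg S) \<Longrightarrow> free_star (pf A) - pf A \<in> relators S"
| proj_idem: "A \<in> car (alg S) \<Longrightarrow> pf A * pf A - pf A \<in> relators S"
| part_isom: "\<lbrakk>a \<in> labels S; B \<in> Idl S a\<rbrakk> \<Longrightarrow>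
    sf a B * free_star (sf a B) * sf a B - sf a B \<in> relators S"
| p_bot: "pf (bot (alg S)) \<in> relators S"
| p_meet: "\<lbrakk>A \<in> car (alg S); A' \<in> car (alg S)\<rbrakk> \<Longrightarrow>
    pf (meet (alg S) A A') - pf A * pf A' \<in> relators S"
| p_join: "\<lbrakk>A \<in> car (alg S); A' \<in> car (alg S)\<rbrakk> \<Longrightarrow>
    pf (join (alg S) A A') - (pf A + pf A' - pf (meet (alg S) A A')) \<in> relators S"
| p_s: "\<lbrakk>A \<in> car (alg S); a \<in> labels S; B \<in> Idl S a\<rbrakk> \<Longrightarrow>
    pf A * sf a B - sf a B * pf (act S a A) \<in> relators S"
| s_s: "\<lbrakk>a \<in> labels S; B \<in> Idl S a; a' \<in> labels S; B' \<in> Idl S a'\<rbrakk> \<Longrightarrow>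
    free_star (sf a B) * sf a' B' - (if a = a' then pf (meet (alg S) B B') else 0) \<in> relators S"
| p_sum: "A \<in> Jdl S \<Longrightarrow>
    pf A - (\<Sum>a\<in>Delta S A. sf a (act S a A) * free_star (sf a (act S a A))) \<in> relators S"

definition Cstar :: "('b, 'l) bds \<Rightarrow> ('b, 'l) gen univ cstar" where
  "Cstar S = univ_cstar (gens S) (relators S)"

definition cp :: "('b, 'l) bds \<Rightarrow> 'b \<Rightarrow> ('b, 'l) gen univ" where
  "cp S A = univ_elem (gens S) (relators S) (pf A)"

definition cs :: "('b, 'l) bds \<Rightarrow> 'l \<Rightarrow> 'b \<Rightarrow> ('b, 'l) gen univ" where
  "cs S a B = univ_elem (gens S) (relators S) (sf a B)"

text \<open>
  \<open>cs_chain S \<gamma>\<^sub>1 B [\<gamma>\<^sub>2, \<dots>, \<gamma>\<^sub>n] A\<close> is the product defining \<open>s\<^bsub>\<gamma>,A\<^esub>\<close>; the recursion carries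
  \<open>B\<close> along the word. For \<open>n = 1\<close> it is \<open>s\<^bsub>\<gamma>\<^sub>1,A\<^esub>\<close>, whatever \<open>B\<close> is. The product does not depend on
  the admissible \<open>B\<close> chosen in \<open>cs_word\<close>.
\<close>

fun cs_chain :: "('b, 'l) bds \<Rightarrow> 'l \<Rightarrow> 'b \<Rightarrow> 'l list \<Rightarrow> 'b \<Rightarrow> ('b, 'l) gen univ" where
  "cs_chain S a B [] A = cs S a A"
| "cs_chain S a B (b # w) A = cmult (Cstar S) (cs S a B) (cs_chain S b (act S b B) w A)"

fun cs_word :: "('b, 'l) bds \<Rightarrow> 'l list \<Rightarrow> 'b \<Rightarrow> ('b, 'l) gen univ" where
  "cs_word S [] A = cp S A"
| "cs_word S (a # w) A =
     cs_chain S a (SOME B. B \<in> Idl S a \<and> ble (alg S) A (act_word S w B)) w A"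


section \<open>The extended system\<close>

text \<open>Families indexed by \<open>\<L>*\<close> are extensional functions on \<open>lists (labels S)\<close>.\<close>

definition prod_alg :: "('b, 'l) bds \<Rightarrow> ('l list \<Rightarrow> 'b) boolalg" where
  "prod_alg S =
    \<lparr> car  = (\<Pi>\<^sub>E w\<in>lists (labels S). Rw S w),
      meet = (\<lambda>A B. \<lambda>w\<in>lists (labels S). meet (alg S) (A w) (B w)),
      join = (\<lambda>A B. \<lambda>w\<in>lists (labels S). join (alg S) (A w) (B w)),
      diff = (\<lambda>A B. \<lambda>w\<in>lists (labels S). diff (alg S) (A w) (B w)),
      bot  = (\<lambda>w\<in>lists (labels S). bot (alg S)) \<rparr>"

definition bar_alg :: "('b, 'l) bds \<Rightarrow> ('l list \<Rightarrow> 'b) boolalg" where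
  "bar_alg S = (prod_alg S)\<lparr>car := {A \<in> car (prod_alg S).
     finite {(w, a). w \<in> lists (labels S) \<and> a \<in> labels S \<and> A (w @ [a]) \<noteq> act S a (A w)}}\<rparr>"

definition bar_act :: "('b, 'l) bds \<Rightarrow> 'l \<Rightarrow> ('l list \<Rightarrow> 'b) \<Rightarrow> 'l list \<Rightarrow> 'b" where
  "bar_act S a A = (\<lambda>w\<in>lists (labels S). A (a # w))"

definition bar_ideal :: "('b, 'l) bds \<Rightarrow> ('l list \<Rightarrow> 'b) set" where
  "bar_ideal S = {A \<in> car (bar_alg S). (\<forall>w\<in>lists (labels S). A w \<in> Jdl S) \<and>
     finite {w \<in> lists (labels S). A w \<noteq> bot (alg S)}}"

definition ext_q :: "('b, 'l) bds \<Rightarrow> ('l list \<Rightarrow> 'b) \<Rightarrow> ('l list \<Rightarrow> 'b) set" where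
  "ext_q S = quot_map (bar_alg S) (bar_ideal S)"

definition ext :: "('b, 'l) bds \<Rightarrow> (('l list \<Rightarrow> 'b) set, 'l) bds" where
  "ext S =
    \<lparr> alg = quot_alg (bar_alg S) (bar_ideal S),
      labels = labels S,
      act = (\<lambda>a P. \<Union>A\<in>P. ext_q S (bar_act S a A)),
      Idl = (\<lambda>a. ext_q S ` {A \<in> car (bar_alg S). \<forall>w\<in>lists (labels S). A w \<in> Iw S (a # w)}),
      Jdl = ext_q S ` {A \<in> car (bar_alg S). A [] \<in> Jdl S} \<rparr>"

definition iota_word :: "('b, 'l) bds \<Rightarrow> 'l list \<Rightarrow> 'b \<Rightarrow> ('l list \<Rightarrow> 'b) set" where
  "iota_word S g A = ext_q S (\<lambda>w\<in>lists (labels S).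
     if prefix g w then act_word S (drop (length g) w) A else bot (alg S))"

definition iota :: "('b, 'l) bds \<Rightarrow> 'b \<Rightarrow> ('l list \<Rightarrow> 'b) set" where
  "iota S = iota_word S []"

end

theory Submission
  imports Defs
begin

text \<open>
  The isomorphism is obtained from *-homomorphisms of the free algebras in both directions that
  respect the relations and are mutually inverse modulo them. In one direction \<open>p\<^sub>A\<close> and \<open>s\<^bsub>\<alpha>,B\<^esub>\<close>
  go to \<open>p\<^bsub>\<iota>(A)\<^esub>\<close> and \<open>s\<^bsub>\<alpha>,\<iota>(B)\<^esub>\<close>.

  For the other direction one needs projections \<open>P(A)\<close> for families \<open>A\<close>. In the extended algebra
  the differences of \<open>A\<close> and \<open>\<iota>(A\<^sub>\<emptyset>)\<close> have empty component at the empty word, so relation (iv) applies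
  to them and forces
  \<open>P(A) = p\<^bsub>A\<^sub>\<emptyset>\<^esub> + \<Sum>\<^sub>\<alpha> s\<^bsub>\<alpha>,C\<^esub> (P(\<theta>\<^sub>\<alpha>A) - p\<^bsub>\<theta>\<^sub>\<alpha>(A\<^sub>\<emptyset>)\<^esub>) s\<^bsub>\<alpha>,C\<^esub>\<^sup>*\<close>,
  a finite sum over the branches in which \<open>A\<close> differs from \<open>\<iota>(A\<^sub>\<emptyset>)\<close>. As \<open>A\<close> has finitely many
  exceptional pairs, this recursion terminates, and induction on its depth shows that \<open>P\<close> is a
  Boolean homomorphism with \<open>P(A) s\<^bsub>\<alpha>,C\<^esub> = s\<^bsub>\<alpha>,C\<^esub> P(\<theta>\<^sub>\<alpha>A)\<close> that vanishes on \<open>\<I>\<close>. The same finiteness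
  shows that every family is dominated by some \<open>\<iota>(D)\<close>, with \<open>D \<in> I\<^sub>\<alpha>\<close> if the family represents an
  element \<open>B\<close> of the ideal for \<open>\<alpha>\<close>, and \<open>s\<^bsub>\<alpha>,D\<^esub> P(B)\<close> is the image of \<open>s\<^bsub>\<alpha>,B\<^esub>\<close>.
\<close>

section \<open>Free *-algebras\<close>

text \<open>The obstacle is that \<open>P\<close> must satisfy identities in a C*-algebra which
  exists only as a completion of a free algebra. All computation is therefore done before
  completing. Congruence modulo every C*-seminorm yields a ring with involution in which
  \<open>star x * x = 0\<close> forces \<open>x = 0\<close>, and the generators and all
  \<open>P A\<close> live there as finite expressions. That definiteness is essential: the rule
  \<open>s a B * p A = s a (meet X B A)\<close>, on which every change of a bounding element rests,
  does not follow from the relators by algebra alone. Norms return only at the end: substitutions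
  that are inverse to each other modulo the congruence are contractive both ways, hence isometric,
  and so pass to the completions.

  Injectivity of \<open>iota\<close> rests on regularity. If all images of a nonempty
  \<open>A\<close> lie in \<open>Jdl S\<close>, then some of them are nonempty along words of every
  length, whereas members of \<open>bar_ideal S\<close> have finite support. The isomorphism uses
  injectivity too: relation (iv) for \<open>A\<close> and for \<open>iota S A\<close> must be sums
  over the same letters.\<close>

lemma plus_FWord: "FWord u + FWord v = FWord (u @ v)"
  by (simp add: plus_fword_def)

lemma letters_plus: "letters (u + v) = letters u @ letters v"
  by (simp add: plus_fword_def)

lemma letters_zero [simp]: "letters 0 = []"
  by (simp add: zero_fword_def)

lemma free_decompose:
  fixes x :: "'g free"
  shows "(\<Sum>w\<in>Poly_Mapping.keys x. Poly_Mapping.single w (Poly_Mapping.lookup x w)) = x"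
proof (rule poly_mapping_eqI)
  fix k
  have "(\<Sum>w\<in>Poly_Mapping.keys x. Poly_Mapping.lookup
      (Poly_Mapping.single w (Poly_Mapping.lookup x w)) k)
     = (\<Sum>w\<in>Poly_Mapping.keys x. if w = k then Poly_Mapping.lookup x k else 0)"
    by (rule sum.cong) (auto simp: lookup_single when_def)
  then show "Poly_Mapping.lookup (\<Sum>w\<in>Poly_Mapping.keys x.
      Poly_Mapping.single w (Poly_Mapping.lookup x w)) k = Poly_Mapping.lookup x k"
    by (simp add: lookup_sum in_keys_iff)
qed

lemma free_induct [case_names single add]:
  fixes x :: "'g free"
  assumes single: "\<And>w c. P (Poly_Mapping.single w c)"
    and add: "\<And>x y. P x \<Longrightarrow> P y \<Longrightarrow> P (x + y)"
  shows "P x"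
proof -
  have "P (\<Sum>w\<in>K. Poly_Mapping.single w (Poly_Mapping.lookup x w))" if "finite K" for K
    using that
  proof induct
    case empty
    then show ?case using single[of 0 0] by simp
  qed (simp add: single add)
  from this[of "Poly_Mapping.keys x"] show ?thesis
    by (simp add: free_decompose)
qed

lemma free_scale_central: "x * Poly_Mapping.single 0 c = Poly_Mapping.single 0 c * (x :: 'g free)"
  by (induct x rule: free_induct) (simp_all add: mult_single algebra_simps)

lemma free_scale_simps:
  "free_scale c (x + y) = free_scale c x + free_scale c y"
  "free_scale c (x - y) = free_scale c x - free_scale c y"
  "free_scale c x * y = free_scale c (x * y)"
  "x * free_scale c y = free_scale c (x * y)"
  "free_scale c (free_scale d x) = free_scale (c * d) x"
  "free_scale 1 x = x"
  "free_scale 0 x = 0"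
  "free_scale c 0 = 0"
  "free_scale (-1) x = - x"
proof -
  show "x * free_scale c y = free_scale c (x * y)"
    unfolding free_scale_def mult.assoc[symmetric] by (simp only: free_scale_central)
  show "free_scale c (free_scale d x) = free_scale (c * d) x"
    by (simp add: free_scale_def mult_single flip: mult.assoc)
  have "Poly_Mapping.single 0 (- 1) = (- 1 :: 'a free)"
    by (simp only: single_uminus single_one)
  then show "free_scale (- 1) x = - x" by (simp add: free_scale_def)
qed (simp_all add: free_scale_def algebra_simps)

lemma free_scale_add_left: "free_scale (c + d) x = free_scale c x + free_scale d x"
  by (simp add: free_scale_def single_add algebra_simps)

lemma free_scale_single: "free_scale c (Poly_Mapping.single w d) = Poly_Mapping.single w (c * d)"
  by (simp add: free_scale_def mult_single)

lemma word_adj_plus: "word_adj (u + v) = word_adj v + word_adj u"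
  by (simp add: word_adj_def plus_fword_def)

lemma word_adj_adj [simp]: "word_adj (word_adj w) = w"
  by (cases w) (simp add: word_adj_def rev_map o_def case_prod_unfold)

lemma word_adj_0 [simp]: "word_adj 0 = 0"
  by (simp add: word_adj_def zero_fword_def)

lemma free_star_single: "free_star (Poly_Mapping.single w c) = Poly_Mapping.single (word_adj w) (cnj c)"
  by (simp add: free_star_def)

lemma free_star_add: "free_star (x + y) = free_star x + free_star y"
  unfolding free_star_def
  by (rule setsum_keys_plus_distrib) (simp_all add: single_add)

lemma free_star_0 [simp]: "free_star 0 = 0"
  by (simp add: free_star_def)

lemma free_star_star [simp]: "free_star (free_star x) = x"
  by (induct x rule: free_induct) (simp_all add: free_star_single free_star_add)

lemma free_star_mult: "free_star (x * y) = free_star y * free_star x"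
proof (induct x rule: free_induct)
  case (single w c)
  show ?case
    by (induct y rule: free_induct)
      (simp_all add: free_star_single free_star_add mult_single word_adj_plus algebra_simps)
qed (simp add: free_star_add algebra_simps)

lemma free_star_scale: "free_star (free_scale c x) = free_scale (cnj c) (free_star x)"
  unfolding free_scale_def free_star_mult
  by (simp add: free_star_single free_scale_central)

lemma free_star_uminus: "free_star (- x) = - free_star x"
  using free_star_scale[of "-1" x] by (simp add: free_scale_simps(9))

lemma free_star_diff: "free_star (x - y) = free_star x - free_star y"
  using free_star_add[of x "- y"] by (simp add: free_star_uminus)

lemma free_star_1 [simp]: "free_star 1 = 1"
  using free_star_single[of 0 1] by simp

lemma free_car_single:
  "Poly_Mapping.single w c \<in> free_car G \<longleftrightarrow>
     c = 0 \<or> letters w \<noteq> [] \<and> fst ` set (letters w) \<subseteq> G"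
  by (auto simp: free_car_def)

lemma free_car_0 [simp]: "0 \<in> free_car G"
  by (simp add: free_car_def)

lemma free_car_add [intro, simp]: "x \<in> free_car G \<Longrightarrow> y \<in> free_car G \<Longrightarrow> x + y \<in> free_car G"
  using keys_add[of x y] by (force simp: free_car_def)

lemma free_car_scale [intro, simp]: "x \<in> free_car G \<Longrightarrow> free_scale c x \<in> free_car G"
  unfolding free_car_def free_scale_def using keys_mult[of "Poly_Mapping.single 0 c" x]
  by (force split: if_splits)

lemma free_car_uminus [intro, simp]: "x \<in> free_car G \<Longrightarrow> - x \<in> free_car G"
  using free_car_scale[of x G "-1"] by (simp add: free_scale_simps)

lemma free_car_diff [intro, simp]: "x \<in> free_car G \<Longrightarrow> y \<in> free_car G \<Longrightarrow> x - y \<in> free_car G"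
  using free_car_add[of x G "- y"] by auto

lemma free_car_mult [intro, simp]:
  assumes "x \<in> free_car G" "y \<in> free_car G"
  shows "x * y \<in> free_car G"
  unfolding free_car_def
proof safe
  fix w assume "w \<in> Poly_Mapping.keys (x * y)"
  then obtain u v where uv: "w = u + v" "u \<in> Poly_Mapping.keys x" "v \<in> Poly_Mapping.keys y"
    using keys_mult[of x y] by blast
  with assms have "letters u \<noteq> [] \<and> fst ` set (letters u) \<subseteq> G \<and> fst ` set (letters v) \<subseteq> G"
    by (auto simp: free_car_def)
  then show "letters w = [] \<Longrightarrow> False" "\<And>g b. (g, b) \<in> set (letters w) \<Longrightarrow> fst (g, b) \<in> G"
    using uv(1) by (auto simp: letters_plus)
qed

lemma free_car_sum [intro, simp]: "(\<And>i. i \<in> A \<Longrightarrow> f i \<in> free_car G) \<Longrightarrow> sum f A \<in> free_car G"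
  by (induct A rule: infinite_finite_induct) auto

lemma free_car_star [intro, simp]:
  assumes "x \<in> free_car G"
  shows "free_star x \<in> free_car G"
  unfolding free_star_def
proof (rule free_car_sum)
  fix w assume "w \<in> Poly_Mapping.keys x"
  with assms have "letters w \<noteq> [] \<and> fst ` set (letters w) \<subseteq> G"
    by (auto simp: free_car_def)
  then show "Poly_Mapping.single (word_adj w) (cnj (Poly_Mapping.lookup x w)) \<in> free_car G"
    by (force simp: free_car_single word_adj_def)
qed

lemma free_car_gen [intro, simp]: "g \<in> G \<Longrightarrow> free_gen g \<in> free_car G"
  by (simp add: free_gen_def free_car_single)

lemma free_star_gen: "free_star (free_gen g) = Poly_Mapping.single (FWord [(g, True)]) 1"
  by (simp add: free_gen_def free_star_single word_adj_def)

text \<open>Elements of \<open>free_car G\<close> are combinations of nonempty words, and a nonempty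
  word is a product of letters; so there is no case for \<open>1\<close>, which lies outside
  \<open>free_car G\<close>.\<close>

lemma free_car_induct [consumes 1, case_names zero add scale mult star gen]:
  assumes x: "x \<in> free_car G"
    and zero: "P 0"
    and add: "\<And>x y. x \<in> free_car G \<Longrightarrow> y \<in> free_car G \<Longrightarrow> P x \<Longrightarrow> P y \<Longrightarrow> P (x + y)"
    and scale: "\<And>c x. x \<in> free_car G \<Longrightarrow> P x \<Longrightarrow> P (free_scale c x)"
    and mult: "\<And>x y. x \<in> free_car G \<Longrightarrow> y \<in> free_car G \<Longrightarrow> P x \<Longrightarrow> P y \<Longrightarrow> P (x * y)"
    and star: "\<And>x. x \<in> free_car G \<Longrightarrow> P x \<Longrightarrow> P (free_star x)"
    and gen: "\<And>g. g \<in> G \<Longrightarrow> P (free_gen g)"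
  shows "P x"
proof -
  have letter: "P (Poly_Mapping.single (FWord [(g, b)]) 1)" if "g \<in> G" for g b
    using gen[OF that] star[OF free_car_gen[OF that] gen[OF that]]
    by (cases b) (simp_all add: free_star_gen, simp add: free_gen_def)
  have word: "P (Poly_Mapping.single (FWord l) 1)" if "l \<noteq> []" "fst ` set l \<subseteq> G" for l
    using that
  proof (induct l)
    case (Cons a l)
    obtain g b where a: "a = (g, b)" by fastforce
    show ?case
    proof (cases "l = []")
      case True
      then show ?thesis using letter Cons a by simp
    next
      case False
      have "Poly_Mapping.single (FWord (a # l)) (1::complex) =
          Poly_Mapping.single (FWord [a]) 1 * Poly_Mapping.single (FWord l) 1"
        by (simp add: mult_single plus_FWord)
      then show ?thesis
        using mult[of "Poly_Mapping.single (FWord [a]) 1" "Poly_Mapping.single (FWord l) 1"]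
          letter Cons a False by (simp add: free_car_single)
    qed
  qed simp
  have mono: "P (Poly_Mapping.single w c)" if "w \<in> Poly_Mapping.keys x" for w c
  proof -
    have w: "letters w \<noteq> []" "fst ` set (letters w) \<subseteq> G"
      using x that by (auto simp: free_car_def)
    have "P (Poly_Mapping.single w 1)"
      using word[OF w] by simp
    then show ?thesis
      using scale[of "Poly_Mapping.single w 1" c] w by (simp add: free_car_single free_scale_single)
  qed
  \<comment> \<open>Membership is carried along because \<open>add\<close> asks for it of both
    summands.\<close>
  have "P (\<Sum>w\<in>K. Poly_Mapping.single w (Poly_Mapping.lookup x w)) \<and>
      (\<Sum>w\<in>K. Poly_Mapping.single w (Poly_Mapping.lookup x w)) \<in> free_car G"
    if "finite K" "K \<subseteq> Poly_Mapping.keys x" for K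
    using that
  proof induct
    case empty
    then show ?case by (simp add: zero)
  next
    case (insert w K)
    have "Poly_Mapping.single w (Poly_Mapping.lookup x w) \<in> free_car G"
      using x insert(4) by (auto simp: free_car_def)
    with insert show ?case by (auto intro!: add mono)
  qed
  from this[of "Poly_Mapping.keys x"] show ?thesis by (simp add: free_decompose)
qed

section \<open>Homomorphisms out of a free *-algebra\<close>

fun wprod :: "('g \<Rightarrow> 'h free) \<Rightarrow> ('g \<times> bool) list \<Rightarrow> 'h free" where
  "wprod f [] = 1"
| "wprod f ((g, b) # l) = (if b then free_star (f g) else f g) * wprod f l"

text \<open>The unital *-homomorphism with values \<open>f\<close> on the generators. It is defined
  on the whole unital free algebra, so its algebraic laws hold without carrier hypotheses;
  \<open>wprod f [] = 1\<close> takes care of the empty word.\<close>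

definition subst :: "('g \<Rightarrow> 'h free) \<Rightarrow> 'g free \<Rightarrow> 'h free" where
  "subst f x = (\<Sum>w\<in>Poly_Mapping.keys x. free_scale (Poly_Mapping.lookup x w) (wprod f (letters w)))"

lemma wprod_append: "wprod f (u @ v) = wprod f u * wprod f v"
  by (induct u) (auto simp: mult.assoc)

lemma wprod_adj: "wprod f (letters (word_adj w)) = free_star (wprod f (letters w))"
proof -
  have "wprod f (rev (map (\<lambda>(g, b). (g, \<not> b)) l)) = free_star (wprod f l)" for l
    by (induct l) (auto simp: wprod_append free_star_mult)
  then show ?thesis by (simp add: word_adj_def)
qed

lemma subst_single: "subst f (Poly_Mapping.single w c) = free_scale c (wprod f (letters w))"
  by (simp add: subst_def free_scale_simps)

lemma subst_add: "subst f (x + y) = subst f x + subst f y"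
  unfolding subst_def
  by (rule setsum_keys_plus_distrib) (simp_all add: free_scale_simps free_scale_add_left)

lemma subst_mult: "subst f (x * y) = subst f x * subst f y"
proof (induct x rule: free_induct)
  case (single w c)
  show ?case
  proof (induct y rule: free_induct)
    case (single v d)
    show ?case
      by (simp add: subst_single mult_single letters_plus wprod_append free_scale_simps(3,4,5)
          mult.commute[of c d])
  qed (simp add: subst_add distrib_left)
qed (simp add: subst_add distrib_right)

lemma subst_scale: "subst f (free_scale c x) = free_scale c (subst f x)"
  by (simp add: free_scale_def subst_mult subst_single)

lemma subst_0 [simp]: "subst f 0 = 0"
  by (simp add: subst_def)

lemma subst_uminus: "subst f (- x) = - subst f x"
  using subst_scale[of f "-1" x] by (simp add: free_scale_simps(9))

lemma subst_diff: "subst f (x - y) = subst f x - subst f y"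
  using subst_add[of f x "- y"] by (simp add: subst_uminus)

lemma subst_sum: "subst f (sum g A) = (\<Sum>i\<in>A. subst f (g i))"
  by (induct A rule: infinite_finite_induct) (simp_all add: subst_add)

lemma subst_star: "subst f (free_star x) = free_star (subst f x)"
  by (induct x rule: free_induct)
    (simp_all add: subst_single subst_add free_star_single free_star_add free_star_scale wprod_adj)

lemma subst_gen [simp]: "subst f (free_gen g) = f g"
  by (simp add: free_gen_def subst_single free_scale_simps)

lemma subst_car:
  assumes "x \<in> free_car G" "\<And>g. g \<in> G \<Longrightarrow> f g \<in> free_car H"
  shows "subst f x \<in> free_car H"
  using assms(1)
  by (induct rule: free_car_induct)
    (auto simp: subst_add subst_scale subst_mult subst_star assms(2))

section \<open>C*-seminorms and their pullbacks\<close>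

context
  fixes G :: "'g set" and R :: "'g free set" and N :: "'g free \<Rightarrow> real"
  assumes N: "cstar_seminorm G R N"
begin

lemma cstar_seminorm_nonneg: "x \<in> free_car G \<Longrightarrow> 0 \<le> N x"
  and cstar_seminorm_triangle: "x \<in> free_car G \<Longrightarrow> y \<in> free_car G \<Longrightarrow> N (x + y) \<le> N x + N y"
  and cstar_seminorm_scale: "x \<in> free_car G \<Longrightarrow> N (free_scale c x) = cmod c * N x"
  and cstar_seminorm_mult: "x \<in> free_car G \<Longrightarrow> y \<in> free_car G \<Longrightarrow> N (x * y) \<le> N x * N y"
  and cstar_seminorm_cstar: "x \<in> free_car G \<Longrightarrow> N (free_star x * x) = (N x)\<^sup>2"
  and cstar_seminorm_rel: "r \<in> R \<Longrightarrow> N r = 0"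
  using N by (simp_all add: cstar_seminorm_def)

lemma cstar_seminorm_0: "N 0 = 0"
  using cstar_seminorm_scale[of 0 0] by (simp add: free_scale_simps)

lemma cstar_seminorm_uminus: "x \<in> free_car G \<Longrightarrow> N (- x) = N x"
  using cstar_seminorm_scale[of x "-1"] by (simp add: free_scale_simps)

lemma cstar_seminorm_minus_commute:
  "x \<in> free_car G \<Longrightarrow> y \<in> free_car G \<Longrightarrow> N (x - y) = N (y - x)"
  using cstar_seminorm_uminus[of "x - y"] by auto

lemma cstar_seminorm_triangle_diff:
  "x \<in> free_car G \<Longrightarrow> y \<in> free_car G \<Longrightarrow> z \<in> free_car G \<Longrightarrow> N (x - z) \<le> N (x - y) + N (y - z)"
  using cstar_seminorm_triangle[of "x - y" "y - z"] by auto

text \<open>By the C*-identity the square of \<open>N y\<close> is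
  \<open>N (free_star y * y)\<close>, which is at most \<open>N (free_star y) * N y\<close>.
  Cancelling \<open>N y\<close> gives one inequality, and the same for \<open>free_star x\<close>
  gives the other.\<close>

lemma cstar_seminorm_star:
  assumes x: "x \<in> free_car G"
  shows "N (free_star x) = N x"
proof -
  have le: "N y \<le> N (free_star y)" if y: "y \<in> free_car G" for y
  proof (cases "N y = 0")
    case True
    then show ?thesis using cstar_seminorm_nonneg[of "free_star y"] y by auto
  next
    case False
    then have "0 < N y" using cstar_seminorm_nonneg[OF y] by simp
    moreover have "N y * N y \<le> N (free_star y) * N y"
      using cstar_seminorm_cstar[OF y] cstar_seminorm_mult[of "free_star y" y] y
      by (auto simp: power2_eq_square)
    ultimately show ?thesis by simp
  qed
  show ?thesis
    using le[OF x] le[of "free_star x"] x by fastforce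
qed

end

text \<open>A *-homomorphism carries every law of a C*-seminorm back to its source. This is the
  universal property in terms of seminorms: both compatibility with congruence and contractivity
  come from it.\<close>

lemma cstar_seminorm_subst:
  assumes N: "cstar_seminorm H Q N"
    and f: "\<And>g. g \<in> G \<Longrightarrow> f g \<in> free_car H"
    and R: "\<And>r. r \<in> R \<Longrightarrow> N (subst f r) = 0"
  shows "cstar_seminorm G R (\<lambda>x. N (subst f x))"
proof -
  have car: "subst f x \<in> free_car H" if "x \<in> free_car G" for x
    using subst_car[OF that] f by blast
  show ?thesis
    using cstar_seminorm_nonneg[OF N car] cstar_seminorm_triangle[OF N car car]
      cstar_seminorm_scale[OF N car] cstar_seminorm_mult[OF N car car]
      cstar_seminorm_cstar[OF N car] R
    by (simp add: cstar_seminorm_def subst_add subst_scale subst_mult subst_star)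
qed

section \<open>A ring containing all universal *-algebras\<close>

text \<open>No unit and no scalars, since the relations involve neither.
  \<open>star_definite\<close> is what is left of the C*-identity once norms are forgotten.\<close>

class star_ring = ring +
  fixes star :: "'a \<Rightarrow> 'a"
  assumes star_add: "star (x + y) = star x + star y"
    and star_mult: "star (x * y) = star y * star x"
    and star_star [simp]: "star (star x) = x"
    and star_definite: "star x * x = 0 \<Longrightarrow> x = 0"
begin

lemma star_0 [simp]: "star 0 = 0"
  using star_add[of 0 0] by simp

lemma star_uminus: "star (- x) = - star x"
  using star_add[of x "- x"] by (simp add: eq_neg_iff_add_eq_0 add.commute)

lemma star_diff: "star (x - y) = star x - star y"
  using star_add[of x "- y"] by (simp add: star_uminus)

lemma star_sum: "star (sum f A) = (\<Sum>i\<in>A. star (f i))"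
  by (induct A rule: infinite_finite_induct) (simp_all add: star_add)

end

text \<open>Equality in the universal C*-algebra, expressed by all seminorms instead of by their
  supremum. It thus makes sense before the supremum is known to be finite; boundedness of the
  generators is itself proved by computing modulo \<open>ucong\<close>.\<close>

definition ucong :: "'g set \<Rightarrow> 'g free set \<Rightarrow> 'g free \<Rightarrow> 'g free \<Rightarrow> bool" where
  "ucong G R x y \<longleftrightarrow> x \<in> free_car G \<and> y \<in> free_car G \<and>
     (\<forall>N. cstar_seminorm G R N \<longrightarrow> N (x - y) = 0)"

lemma ucongD: "ucong G R x y \<Longrightarrow> cstar_seminorm G R N \<Longrightarrow> N (x - y) = 0"
  by (simp add: ucong_def)

lemma ucong_car: "ucong G R x y \<Longrightarrow> x \<in> free_car G" "ucong G R x y \<Longrightarrow> y \<in> free_car G"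
  by (simp_all add: ucong_def)

lemma ucongI:
  "x \<in> free_car G \<Longrightarrow> y \<in> free_car G \<Longrightarrow> (\<And>N. cstar_seminorm G R N \<Longrightarrow> N (x - y) = 0) \<Longrightarrow> ucong G R x y"
  by (simp add: ucong_def)

lemma ucong_refl: "x \<in> free_car G \<Longrightarrow> ucong G R x x"
  by (auto intro: ucongI simp: cstar_seminorm_0)

lemma ucong_sym: "ucong G R x y \<Longrightarrow> ucong G R y x"
  by (rule ucongI) (auto simp: ucong_car cstar_seminorm_minus_commute[of G R _ y x] ucongD)

lemma ucong_trans:
  assumes "ucong G R x y" "ucong G R y z"
  shows "ucong G R x z"
proof (rule ucongI)
  fix N assume N: "cstar_seminorm G R N"
  show "N (x - z) = 0"
    using cstar_seminorm_triangle_diff[OF N, of x y z] cstar_seminorm_nonneg[OF N, of "x - z"]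
      assms[THEN ucongD, OF N] assms[THEN ucong_car(1)] assms[THEN ucong_car(2)] by simp
qed (use assms in \<open>auto simp: ucong_def\<close>)

lemma ucong_add:
  assumes "ucong G R x x'" "ucong G R y y'"
  shows "ucong G R (x + y) (x' + y')"
proof (rule ucongI)
  note car [simp] = assms[THEN ucong_car(1)] assms[THEN ucong_car(2)]
  fix N assume N: "cstar_seminorm G R N"
  have "N ((x - x') + (y - y')) = 0"
    using cstar_seminorm_triangle[OF N, of "x - x'" "y - y'"]
      cstar_seminorm_nonneg[OF N, of "(x - x') + (y - y')"] assms[THEN ucongD, OF N] by simp
  then show "N (x + y - (x' + y')) = 0" by (simp add: algebra_simps)
qed (use assms in \<open>auto simp: ucong_def\<close>)

lemma ucong_scale:
  assumes "ucong G R x x'"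
  shows "ucong G R (free_scale c x) (free_scale c x')"
proof (rule ucongI)
  fix N assume N: "cstar_seminorm G R N"
  show "N (free_scale c x - free_scale c x') = 0"
    using cstar_seminorm_scale[OF N, of "x - x'" c] ucongD[OF assms N] assms[THEN ucong_car(1)]
      assms[THEN ucong_car(2)] by (simp add: free_scale_simps)
qed (use assms in \<open>auto simp: ucong_def\<close>)

lemma ucong_uminus: "ucong G R x x' \<Longrightarrow> ucong G R (- x) (- x')"
  using ucong_scale[of G R x x' "-1"] by (simp add: free_scale_simps)

lemma ucong_mult:
  assumes "ucong G R x x'" "ucong G R y y'"
  shows "ucong G R (x * y) (x' * y')"
proof (rule ucongI)
  note car [simp] = assms[THEN ucong_car(1)] assms[THEN ucong_car(2)]
  fix N assume N: "cstar_seminorm G R N"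
  have "N ((x - x') * y + x' * (y - y')) \<le> N ((x - x') * y) + N (x' * (y - y'))"
    by (rule cstar_seminorm_triangle[OF N]) simp_all
  also have "\<dots> \<le> N (x - x') * N y + N x' * N (y - y')"
    by (intro add_mono cstar_seminorm_mult[OF N]) simp_all
  finally have "N ((x - x') * y + x' * (y - y')) = 0"
    using cstar_seminorm_nonneg[OF N, of "(x - x') * y + x' * (y - y')"] assms[THEN ucongD, OF N]
    by simp
  then show "N (x * y - x' * y') = 0" by (simp add: algebra_simps)
qed (use assms in \<open>auto simp: ucong_def\<close>)

lemma ucong_star:
  assumes "ucong G R x x'"
  shows "ucong G R (free_star x) (free_star x')"
proof (rule ucongI)
  fix N assume N: "cstar_seminorm G R N"
  show "N (free_star x - free_star x') = 0"
    using cstar_seminorm_star[OF N, of "x - x'"] ucongD[OF assms N] assms[THEN ucong_car(1)]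
      assms[THEN ucong_car(2)] by (simp add: free_star_diff)
qed (use assms in \<open>auto simp: ucong_def\<close>)

lemma ucong_definite:
  assumes x: "x \<in> free_car G" and 0: "ucong G R (free_star x * x) 0"
  shows "ucong G R x 0"
proof (rule ucongI)
  fix N assume N: "cstar_seminorm G R N"
  show "N (x - 0) = 0"
    using cstar_seminorm_cstar[OF N x] ucongD[OF 0 N] by simp
qed (use x in auto)

definition univ_rel where
  "univ_rel F H \<longleftrightarrow> (\<forall>G R. ucong G R (F (G, R)) (H (G, R)))"

text \<open>
  Quotient types cannot depend on \<open>G\<close> and \<open>R\<close>, so the algebras of all pairs \<open>(G, R)\<close> are
  collected in one direct product, into which each of them embeds.
\<close>

quotient_type 'g univ_ring = "('g set \<times> 'g free set) \<Rightarrow> 'g free" / partial: univ_rel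
proof (rule part_equivpI)
  show "\<exists>F :: ('g set \<times> 'g free set) \<Rightarrow> 'g free. univ_rel F F"
    by (rule exI[of _ "\<lambda>_. 0"]) (simp add: univ_rel_def ucong_refl)
  show "symp (univ_rel :: ('g set \<times> 'g free set \<Rightarrow> 'g free) \<Rightarrow> _)"
    by (rule sympI) (meson univ_rel_def ucong_sym)
  show "transp (univ_rel :: ('g set \<times> 'g free set \<Rightarrow> 'g free) \<Rightarrow> _)"
    by (rule transpI) (meson univ_rel_def ucong_trans)
qed

instantiation univ_ring :: (type) star_ring
begin

lift_definition zero_univ_ring :: "'a univ_ring" is "\<lambda>_. 0"
  by (simp add: univ_rel_def ucong_refl)

lift_definition plus_univ_ring :: "'a univ_ring \<Rightarrow> 'a univ_ring \<Rightarrow> 'a univ_ring"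
  is "\<lambda>F H i. F i + H i"
  by (simp add: univ_rel_def ucong_add)

lift_definition uminus_univ_ring :: "'a univ_ring \<Rightarrow> 'a univ_ring" is "\<lambda>F i. - F i"
  by (simp add: univ_rel_def ucong_uminus)

lift_definition minus_univ_ring :: "'a univ_ring \<Rightarrow> 'a univ_ring \<Rightarrow> 'a univ_ring"
  is "\<lambda>F H i. F i - H i"
  unfolding univ_rel_def by (metis ucong_add ucong_uminus diff_conv_add_uminus)

lift_definition times_univ_ring :: "'a univ_ring \<Rightarrow> 'a univ_ring \<Rightarrow> 'a univ_ring"
  is "\<lambda>F H i. F i * H i"
  by (simp add: univ_rel_def ucong_mult)

lift_definition star_univ_ring :: "'a univ_ring \<Rightarrow> 'a univ_ring" is "\<lambda>F i. free_star (F i)"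
  by (simp add: univ_rel_def ucong_star)

instance
proof
  have car: "univ_rel F F \<Longrightarrow> F (G, R) \<in> free_car G" for F :: "_ \<Rightarrow> 'a free" and G R
    by (meson univ_rel_def ucong_car(1))
  have eqI: "univ_rel F H" if "\<And>i. F i = H i" "\<And>G R. F (G, R) \<in> free_car G"
    for F H :: "_ \<Rightarrow> 'a free"
    using that ucong_refl by (metis univ_rel_def)
  fix a b c :: "'a univ_ring"
  show "a + b + c = a + (b + c)"
    by transfer (rule eqI, simp_all add: car add.assoc)
  show "a + b = b + a"
    by transfer (rule eqI, simp_all add: car add.commute)
  show "0 + a = a"
    by transfer (rule eqI, simp_all add: car)
  show "- a + a = 0"
    by transfer (rule eqI, simp_all add: car)
  show "a - b = a + - b"
    by transfer (rule eqI, simp_all add: car)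
  show "a * b * c = a * (b * c)"
    by transfer (rule eqI, simp_all add: car mult.assoc)
  show "(a + b) * c = a * c + b * c"
    by transfer (rule eqI, simp_all add: car distrib_right)
  show "a * (b + c) = a * b + a * c"
    by transfer (rule eqI, simp_all add: car distrib_left)
  show "star (a + b) = star a + star b"
    by transfer (rule eqI, simp_all add: car free_star_add)
  show "star (a * b) = star b * star a"
    by transfer (rule eqI, simp_all add: car free_star_mult)
  show "star (star a) = a"
    by transfer (rule eqI, simp_all add: car)
  show "star a * a = 0 \<Longrightarrow> a = 0"
    by transfer (meson car ucong_definite univ_rel_def)
qed

end

lifting_forget poly_mapping.lifting

text \<open>The embedding of the factor \<open>(G, R)\<close> into the product: every other
  coordinate is \<open>0\<close>. Elements outside \<open>free_car G\<close> go to \<open>0\<close>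
  as well, so that relators vanish without a carrier hypothesis.\<close>

lift_definition cls :: "'g set \<Rightarrow> 'g free set \<Rightarrow> 'g free \<Rightarrow> 'g univ_ring"
  is "\<lambda>G R x i. if i = (G, R) \<and> x \<in> free_car G then x else 0"
  by (simp add: univ_rel_def ucong_refl)

lemma cls_add: "x \<in> free_car G \<Longrightarrow> y \<in> free_car G \<Longrightarrow> cls G R (x + y) = cls G R x + cls G R y"
  by transfer (auto simp: univ_rel_def intro!: ucong_refl)

lemma cls_diff: "x \<in> free_car G \<Longrightarrow> y \<in> free_car G \<Longrightarrow> cls G R (x - y) = cls G R x - cls G R y"
  by transfer (auto simp: univ_rel_def intro!: ucong_refl)

lemma cls_mult: "x \<in> free_car G \<Longrightarrow> y \<in> free_car G \<Longrightarrow> cls G R (x * y) = cls G R x * cls G R y"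
  by transfer (auto simp: univ_rel_def intro!: ucong_refl)

lemma cls_star: "x \<in> free_car G \<Longrightarrow> cls G R (free_star x) = star (cls G R x)"
  by transfer (auto simp: univ_rel_def intro!: ucong_refl)

lemma cls_0 [simp]: "cls G R 0 = 0"
  by transfer (auto simp: univ_rel_def intro!: ucong_refl)

lemma cls_sum:
  "(\<And>i. i \<in> A \<Longrightarrow> f i \<in> free_car G) \<Longrightarrow> cls G R (sum f A) = (\<Sum>i\<in>A. cls G R (f i))"
  by (induct A rule: infinite_finite_induct) (auto simp: cls_add)

lemma cls_eq_iff:
  "x \<in> free_car G \<Longrightarrow> y \<in> free_car G \<Longrightarrow> cls G R x = cls G R y \<longleftrightarrow> ucong G R x y"
  apply transfer
  apply (simp add: univ_rel_def)
  apply (rule iffI)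
   apply (drule_tac x = G in spec, drule_tac x = R in spec, simp)
  apply (auto intro: ucong_refl)
  done

lemma cls_relator: "r \<in> R \<Longrightarrow> cls G R r = 0"
proof (cases "r \<in> free_car G")
  case True
  assume "r \<in> R"
  then have "ucong G R r 0" using True by (auto simp: ucong_def cstar_seminorm_rel)
  then show ?thesis using cls_eq_iff[of r G 0 R] True by simp
next
  case False
  then show ?thesis by transfer (auto simp: univ_rel_def intro!: ucong_refl)
qed

text \<open>Any C*-seminorm for \<open>(H, Q)\<close>, pulled back along \<open>subst f\<close>, is
  one for \<open>(G, R)\<close> and therefore vanishes on \<open>x - y\<close>.\<close>

lemma cls_subst_cong:
  assumes f: "\<And>g. g \<in> G \<Longrightarrow> f g \<in> free_car H"
    and R: "\<And>r. r \<in> R \<Longrightarrow> r \<in> free_car G" "\<And>r. r \<in> R \<Longrightarrow> cls H Q (subst f r) = 0"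
    and x: "x \<in> free_car G" "y \<in> free_car G" "cls G R x = cls G R y"
  shows "cls H Q (subst f x) = cls H Q (subst f y)"
proof -
  have car: "subst f x \<in> free_car H" if "x \<in> free_car G" for x
    using subst_car[OF that] f by blast
  have 0: "ucong H Q (subst f r) 0" if "r \<in> R" for r
    using R(2)[OF that] cls_eq_iff[OF car[OF R(1)[OF that]], of 0 Q] by simp
  have "N (subst f x - subst f y) = 0" if N: "cstar_seminorm H Q N" for N
  proof -
    have "cstar_seminorm G R (\<lambda>x. N (subst f x))"
      by (rule cstar_seminorm_subst[OF N]) (use f 0 N in \<open>auto simp: ucong_def\<close>)
    from ucongD[OF _ this, of x y] show ?thesis
      using x by (simp add: cls_eq_iff subst_diff)
  qed
  then show ?thesis
    using x car by (auto simp: cls_eq_iff ucong_def)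
qed

section \<open>Completion\<close>

definition gen_bounded :: "'g set \<Rightarrow> 'g free set \<Rightarrow> bool" where
  "gen_bounded G R \<longleftrightarrow> (\<forall>g\<in>G. \<exists>b. \<forall>N. cstar_seminorm G R N \<longrightarrow> N (free_gen g) \<le> b)"

lemma cstar_seminorm_zero: "cstar_seminorm G R (\<lambda>_. 0)"
  by (simp add: cstar_seminorm_def)

text \<open>Bounds that are uniform over all seminorms propagate from the generators through sums,
  multiples, products and adjoints. They make the real supremum in \<open>univ_seminorm\<close>
  meaningful.\<close>

lemma cstar_seminorms_bounded:
  assumes "gen_bounded G R" "x \<in> free_car G"
  shows "\<exists>b. \<forall>N. cstar_seminorm G R N \<longrightarrow> N x \<le> b"
  using assms(2)
proof (induct rule: free_car_induct)
  case zero
  show ?case by (rule exI[of _ 0]) (simp add: cstar_seminorm_0)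
next
  case (add x y)
  then obtain b c where "\<And>N. cstar_seminorm G R N \<Longrightarrow> N x \<le> b" "\<And>N. cstar_seminorm G R N \<Longrightarrow> N y \<le> c"
    by blast
  then have "N (x + y) \<le> b + c" if "cstar_seminorm G R N" for N
    using cstar_seminorm_triangle[OF that add(1,2)] that by fastforce
  then show ?case by blast
next
  case (scale c x)
  then obtain b where "\<And>N. cstar_seminorm G R N \<Longrightarrow> N x \<le> b" by blast
  then have "N (free_scale c x) \<le> cmod c * b" if "cstar_seminorm G R N" for N
    using cstar_seminorm_scale[OF that scale(1)] that by (simp add: mult_left_mono)
  then show ?case by blast
next
  case (mult x y)
  then obtain b c where bc: "\<And>N. cstar_seminorm G R N \<Longrightarrow> N x \<le> b" "\<And>N. cstar_seminorm G R N \<Longrightarrow> N y \<le> c"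
    by blast
  have "N (x * y) \<le> b * c" if N: "cstar_seminorm G R N" for N
  proof -
    have "N (x * y) \<le> N x * N y"
      by (rule cstar_seminorm_mult[OF N mult(1,2)])
    also have "\<dots> \<le> b * c"
      using bc[OF N] cstar_seminorm_nonneg[OF N mult(1)] cstar_seminorm_nonneg[OF N mult(2)]
      by (intro mult_mono) auto
    finally show ?thesis .
  qed
  then show ?case by blast
next
  case (star x)
  then show ?case by (auto simp: cstar_seminorm_star)
next
  case (gen g)
  then show ?case using assms(1) by (simp add: gen_bounded_def)
qed

text \<open>Operations on classes are defined as unions over representatives; such a union collapses
  to one value when the result does not depend on the representative.\<close>

lemma UN_eq_const: "a \<in> A \<Longrightarrow> (\<And>x. x \<in> A \<Longrightarrow> F x = v) \<Longrightarrow> (\<Union>x\<in>A. F x) = v"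
  by blast

context
  fixes G :: "'g set" and R :: "'g free set"
  assumes bounded: "gen_bounded G R"
begin

abbreviation "unorm \<equiv> univ_seminorm G R"

lemma univ_seminorm_upper: "cstar_seminorm G R N \<Longrightarrow> x \<in> free_car G \<Longrightarrow> N x \<le> unorm x"
  unfolding univ_seminorm_def
  using cstar_seminorms_bounded[OF bounded, of x]
  by (intro cSUP_upper) (auto simp: bdd_above_def)

lemma univ_seminorm_least: "(\<And>N. cstar_seminorm G R N \<Longrightarrow> N x \<le> b) \<Longrightarrow> unorm x \<le> b"
  unfolding univ_seminorm_def
  \<comment> \<open>The zero seminorm makes the supremum range over a nonempty set.\<close>
  using cstar_seminorm_zero[of G R] by (intro cSUP_least) auto

text \<open>Inequalities pass to the supremum directly; the two equations need a reverse estimate.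
  For scalars it is the direct one applied to \<open>inverse c\<close>, for the C*-identity it
  results from taking square roots before the supremum.\<close>

lemma cstar_seminorm_univ: "cstar_seminorm G R unorm"
proof -
  have nonneg: "0 \<le> unorm x" if "x \<in> free_car G" for x
    using univ_seminorm_upper[OF cstar_seminorm_zero that] .
  have le: "unorm (free_scale c x) \<le> cmod c * unorm x" if x: "x \<in> free_car G" for c x
    using x by (intro univ_seminorm_least)
      (simp add: cstar_seminorm_scale univ_seminorm_upper mult_left_mono)
  have ge: "cmod c * unorm x \<le> unorm (free_scale c x)" if x: "x \<in> free_car G" for c x
  proof (cases "c = 0")
    case False
    then have "unorm x \<le> inverse (cmod c) * unorm (free_scale c x)"
      using le[of "free_scale c x" "inverse c"] x by (simp add: free_scale_simps norm_inverse)
    then show ?thesis using False by (simp add: field_simps)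
  qed (use nonneg[of 0] in \<open>simp add: free_scale_simps\<close>)
  show ?thesis
    unfolding cstar_seminorm_def
  proof (intro conjI ballI allI)
    fix x y assume [simp]: "x \<in> free_car G" "y \<in> free_car G"
    show "unorm (x + y) \<le> unorm x + unorm y"
    proof (rule univ_seminorm_least)
      fix N assume N: "cstar_seminorm G R N"
      show "N (x + y) \<le> unorm x + unorm y"
        using cstar_seminorm_triangle[OF N, of x y] univ_seminorm_upper[OF N, of x]
          univ_seminorm_upper[OF N, of y] by simp
    qed
    show "unorm (x * y) \<le> unorm x * unorm y"
    proof (rule univ_seminorm_least)
      fix N assume N: "cstar_seminorm G R N"
      have "N (x * y) \<le> N x * N y"
        by (rule cstar_seminorm_mult[OF N]) simp_all
      also have "\<dots> \<le> unorm x * unorm y"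
        using univ_seminorm_upper[OF N, of x] univ_seminorm_upper[OF N, of y]
          cstar_seminorm_nonneg[OF N, of x] cstar_seminorm_nonneg[OF N, of y]
        by (intro mult_mono) (auto simp: nonneg)
      finally show "N (x * y) \<le> unorm x * unorm y" .
    qed
  next
    fix x assume [simp]: "x \<in> free_car G"
    have "unorm x \<le> sqrt (unorm (free_star x * x))"
    proof (rule univ_seminorm_least)
      fix N assume N: "cstar_seminorm G R N"
      have "(N x)\<^sup>2 \<le> unorm (free_star x * x)"
        using univ_seminorm_upper[OF N, of "free_star x * x"] cstar_seminorm_cstar[OF N, of x] by simp
      then show "N x \<le> sqrt (unorm (free_star x * x))"
        by (rule real_le_rsqrt)
    qed
    then have "(unorm x)\<^sup>2 \<le> unorm (free_star x * x)"
      using power_mono[of "unorm x" "sqrt (unorm (free_star x * x))" 2] nonneg[of x]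
        nonneg[of "free_star x * x"] by simp
    moreover have "unorm (free_star x * x) \<le> (unorm x)\<^sup>2"
    proof (rule univ_seminorm_least)
      fix N assume N: "cstar_seminorm G R N"
      show "N (free_star x * x) \<le> (unorm x)\<^sup>2"
        using univ_seminorm_upper[OF N, of x] cstar_seminorm_cstar[OF N, of x]
          cstar_seminorm_nonneg[OF N, of x] by (simp add: power_mono)
    qed
    ultimately show "unorm (free_star x * x) = (unorm x)\<^sup>2" by simp
  next
    fix r assume "r \<in> R"
    have "(\<lambda>N. N r) ` {N. cstar_seminorm G R N} = {0}"
      using cstar_seminorm_rel[OF _ \<open>r \<in> R\<close>] cstar_seminorm_zero[of G R] by force
    then show "unorm r = 0"
      by (simp add: univ_seminorm_def)
  next
    fix x and c assume x: "x \<in> free_car G"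
    show "unorm (free_scale c x) = cmod c * unorm x"
      using le[OF x] ge[OF x] by (rule antisym)
  qed (rule nonneg)
qed

lemma ucong_iff:
  assumes "x \<in> free_car G" "y \<in> free_car G"
  shows "ucong G R x y \<longleftrightarrow> unorm (x - y) = 0"
proof
  show "unorm (x - y) = 0" if "ucong G R x y"
    using ucongD[OF that cstar_seminorm_univ] .
  show "ucong G R x y" if "unorm (x - y) = 0"
  proof (rule ucongI)
    fix N assume N: "cstar_seminorm G R N"
    show "N (x - y) = 0"
      using assms that univ_seminorm_upper[OF N, of "x - y"] cstar_seminorm_nonneg[OF N, of "x - y"]
      by simp
  qed (use assms in auto)
qed


lemmas univ_nonneg = cstar_seminorm_nonneg[OF cstar_seminorm_univ]
  and univ_triangle = cstar_seminorm_triangle[OF cstar_seminorm_univ]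
  and univ_scale = cstar_seminorm_scale[OF cstar_seminorm_univ]
  and univ_mult = cstar_seminorm_mult[OF cstar_seminorm_univ]
  and univ_0 = cstar_seminorm_0[OF cstar_seminorm_univ]
  and univ_minus_commute = cstar_seminorm_minus_commute[OF cstar_seminorm_univ]
  and univ_triangle_diff = cstar_seminorm_triangle_diff[OF cstar_seminorm_univ]
  and univ_star = cstar_seminorm_star[OF cstar_seminorm_univ]

section \<open>Arithmetic of Cauchy sequences and their classes\<close>

lemma univ_add_diff:
  assumes [simp]: "x \<in> free_car G" "x' \<in> free_car G" "y \<in> free_car G" "y' \<in> free_car G"
  shows "unorm (x + y - (x' + y')) \<le> unorm (x - x') + unorm (y - y')"
  using univ_triangle[of "x - x'" "y - y'"] by (simp add: algebra_simps)

text \<open>The splitting \<open>(x - x') * y + x' * (y - y')\<close>. One bound \<open>b\<close>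
  for both factors gives the estimate the shape that \<open>cauchy_seqs_dominated\<close> and
  \<open>null_rel_dominated\<close> expect.\<close>

lemma univ_mult_diff:
  assumes [simp]: "x \<in> free_car G" "x' \<in> free_car G" "y \<in> free_car G" "y' \<in> free_car G"
    and b: "unorm y \<le> b" "unorm x' \<le> b"
  shows "unorm (x * y - x' * y') \<le> b * (unorm (x - x') + unorm (y - y'))"
proof -
  have "unorm (x * y - x' * y') = unorm ((x - x') * y + x' * (y - y'))"
    by (simp add: algebra_simps)
  also have "\<dots> \<le> unorm ((x - x') * y) + unorm (x' * (y - y'))"
    by (rule univ_triangle) simp_all
  also have "\<dots> \<le> unorm (x - x') * unorm y + unorm x' * unorm (y - y')"
    by (intro add_mono univ_mult) simp_all
  also have "\<dots> \<le> unorm (x - x') * b + b * unorm (y - y')"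
    using b by (intro add_mono mult_left_mono mult_right_mono) (simp_all add: univ_nonneg)
  finally show ?thesis by (simp add: algebra_simps)
qed

lemma cauchy_seqs_car: "x \<in> cauchy_seqs G R \<Longrightarrow> x n \<in> free_car G"
  by (simp add: cauchy_seqs_def)

text \<open>A common criterion for sums, products and multiples; a unary operation supplies the same
  sequence twice.\<close>

lemma cauchy_seqs_dominated:
  assumes x: "x \<in> cauchy_seqs G R" and y: "y \<in> cauchy_seqs G R"
    and z: "\<And>n. z n \<in> free_car G"
    and le: "\<And>m n. unorm (z m - z n) \<le> K * (unorm (x m - x n) + unorm (y m - y n))" and K: "0 < K"
  shows "z \<in> cauchy_seqs G R"
  unfolding cauchy_seqs_def
proof (intro CollectI conjI allI impI z)
  fix e :: real assume "0 < e"
  then have e: "0 < e / (2 * K)" using K by simp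
  obtain M1 M2 where M: "\<And>m n. m \<ge> M1 \<Longrightarrow> n \<ge> M1 \<Longrightarrow> unorm (x m - x n) < e / (2 * K)"
    "\<And>m n. m \<ge> M2 \<Longrightarrow> n \<ge> M2 \<Longrightarrow> unorm (y m - y n) < e / (2 * K)"
    using x y e unfolding cauchy_seqs_def mem_Collect_eq by meson
  have "unorm (z m - z n) < e" if "m \<ge> max M1 M2" "n \<ge> max M1 M2" for m n
  proof -
    have "unorm (x m - x n) + unorm (y m - y n) < e / (2 * K) + e / (2 * K)"
      using that by (intro add_strict_mono M) auto
    then have "K * (unorm (x m - x n) + unorm (y m - y n)) < e"
      using K by (simp add: field_simps)
    with le[of m n] show ?thesis by simp
  qed
  then show "\<exists>M. \<forall>m\<ge>M. \<forall>n\<ge>M. unorm (z m - z n) < e" by blast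
qed

lemma cauchy_seqs_bounded:
  assumes x: "x \<in> cauchy_seqs G R"
  shows "\<exists>b. \<forall>n. unorm (x n) \<le> b"
proof -
  have "(1::real) > 0" by simp
  then obtain M where M: "\<And>m n. m \<ge> M \<Longrightarrow> n \<ge> M \<Longrightarrow> unorm (x m - x n) < 1"
    using x unfolding cauchy_seqs_def mem_Collect_eq by meson
  have "unorm (x n) \<le> Max ((\<lambda>n. unorm (x n)) ` {..M}) + 1" for n
  proof (cases "n \<le> M")
    case True
    then have "unorm (x n) \<le> Max ((\<lambda>n. unorm (x n)) ` {..M})" by (intro Max_ge) auto
    then show ?thesis by simp
  next
    case False
    have "unorm (x M) \<le> Max ((\<lambda>n. unorm (x n)) ` {..M})" by (intro Max_ge) auto
    moreover have "unorm (x n) \<le> unorm (x n - x M) + unorm (x M)"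
      using univ_triangle[of "x n - x M" "x M"] cauchy_seqs_car[OF x] by simp
    moreover have "unorm (x n - x M) < 1" using M False by simp
    ultimately show ?thesis by linarith
  qed
  then show ?thesis by blast
qed

lemma cauchy_seqs_bounded2:
  assumes "x \<in> cauchy_seqs G R" "y \<in> cauchy_seqs G R"
  obtains b where "0 < b" "\<And>n. unorm (x n) \<le> b" "\<And>n. unorm (y n) \<le> b"
proof -
  obtain b c where "\<And>n. unorm (x n) \<le> b" "\<And>n. unorm (y n) \<le> c"
    using assms cauchy_seqs_bounded by meson
  then have "0 < max 1 (max b c)" "\<And>n. unorm (x n) \<le> max 1 (max b c)" "\<And>n. unorm (y n) \<le> max 1 (max b c)"
    by (auto simp: le_max_iff_disj)
  then show thesis by (rule that)
qed

lemma cauchy_seqs_const: "x \<in> free_car G \<Longrightarrow> (\<lambda>_. x) \<in> cauchy_seqs G R"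
  by (simp add: cauchy_seqs_def univ_0)

lemma cauchy_seqs_add:
  assumes "x \<in> cauchy_seqs G R" "y \<in> cauchy_seqs G R"
  shows "(\<lambda>n. x n + y n) \<in> cauchy_seqs G R"
  by (rule cauchy_seqs_dominated[OF assms, where K = 1]) (simp_all add: assms[THEN cauchy_seqs_car] univ_add_diff)

lemma cauchy_seqs_mult:
  assumes "x \<in> cauchy_seqs G R" "y \<in> cauchy_seqs G R"
  shows "(\<lambda>n. x n * y n) \<in> cauchy_seqs G R"
proof -
  obtain b where "0 < b" "\<And>n. unorm (x n) \<le> b" "\<And>n. unorm (y n) \<le> b"
    using cauchy_seqs_bounded2[OF assms] by metis
  then show ?thesis
    by (intro cauchy_seqs_dominated[OF assms, where K = b]) (simp_all add: assms[THEN cauchy_seqs_car] univ_mult_diff)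
qed

lemma univ_scale_diff:
  "x \<in> free_car G \<Longrightarrow> y \<in> free_car G \<Longrightarrow> unorm (free_scale c x - free_scale c y) = cmod c * unorm (x - y)"
  using univ_scale[of "x - y" c] by (simp add: free_scale_simps)

lemma univ_star_diff:
  "x \<in> free_car G \<Longrightarrow> y \<in> free_car G \<Longrightarrow> unorm (free_star x - free_star y) = unorm (x - y)"
  using univ_star[of "x - y"] by (simp add: free_star_diff)

lemma cauchy_seqs_scale:
  assumes x: "x \<in> cauchy_seqs G R"
  shows "(\<lambda>n. free_scale c (x n)) \<in> cauchy_seqs G R"
\<comment> \<open>The added 1 keeps the constant positive when \<open>c = 0\<close>.\<close>
proof (rule cauchy_seqs_dominated[OF x x, where K = "cmod c + 1"])
  fix m n
  have "cmod c * unorm (x m - x n) \<le> (cmod c + 1) * (unorm (x m - x n) + unorm (x m - x n))"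
    using univ_nonneg[of "x m - x n"] x by (intro mult_mono) (simp_all add: cauchy_seqs_car[OF x])
  then show "unorm (free_scale c (x m) - free_scale c (x n)) \<le> (cmod c + 1) * (unorm (x m - x n) + unorm (x m - x n))"
    using x by (simp add: univ_scale_diff cauchy_seqs_car[OF x])
next
  show "0 < cmod c + 1" by (simp add: add_nonneg_pos)
qed (use x in \<open>simp add: cauchy_seqs_car[OF x]\<close>)

lemma cauchy_seqs_star: "x \<in> cauchy_seqs G R \<Longrightarrow> (\<lambda>n. free_star (x n)) \<in> cauchy_seqs G R"
  by (simp add: cauchy_seqs_def univ_star_diff)

lemma null_rel_dominated:
  assumes "(x, x') \<in> null_rel G R" "(y, y') \<in> null_rel G R"
    and z: "z \<in> cauchy_seqs G R" "z' \<in> cauchy_seqs G R"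
    and le: "\<And>n. unorm (z n - z' n) \<le> K * (unorm (x n - x' n) + unorm (y n - y' n))"
  shows "(z, z') \<in> null_rel G R"
proof -
  have "(\<lambda>n. K * (unorm (x n - x' n) + unorm (y n - y' n))) \<longlonglongrightarrow> K * (0 + 0)"
    using assms(1,2) by (intro tendsto_intros) (auto simp: null_rel_def)
  then have "(\<lambda>n. K * (unorm (x n - x' n) + unorm (y n - y' n))) \<longlonglongrightarrow> 0" by simp
  moreover have "0 \<le> unorm (z n - z' n)" for n
    using z[THEN cauchy_seqs_car] by (intro univ_nonneg) simp
  ultimately have "(\<lambda>n. unorm (z n - z' n)) \<longlonglongrightarrow> 0"
    using real_tendsto_sandwich[of "\<lambda>_. 0" "\<lambda>n. unorm (z n - z' n)" sequentially
        "\<lambda>n. K * (unorm (x n - x' n) + unorm (y n - y' n))" 0] le by simp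
  with z show ?thesis by (simp add: null_rel_def)
qed

lemma null_rel_refl: "x \<in> cauchy_seqs G R \<Longrightarrow> (x, x) \<in> null_rel G R"
  by (simp add: null_rel_def univ_0)

lemma null_rel_equiv: "equiv (cauchy_seqs G R) (null_rel G R)"
proof (rule equivI)
  show "sym (null_rel G R)"
  proof (rule symI)
    fix x y assume xy: "(x, y) \<in> null_rel G R"
    then have "x n \<in> free_car G" "y n \<in> free_car G" for n
      by (simp_all add: null_rel_def cauchy_seqs_def)
    then have "unorm (y n - x n) = unorm (x n - y n)" for n
      by (rule univ_minus_commute[rotated])
    with xy show "(y, x) \<in> null_rel G R" by (simp add: null_rel_def)
  qed
  show "trans (null_rel G R)"
  proof (rule transI)
    fix x y z assume xyz: "(x, y) \<in> null_rel G R" "(y, z) \<in> null_rel G R"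
    then have "x \<in> cauchy_seqs G R" "y \<in> cauchy_seqs G R" "z \<in> cauchy_seqs G R"
      by (simp_all add: null_rel_def)
    moreover from this have "x n \<in> free_car G" "y n \<in> free_car G" "z n \<in> free_car G" for n
      by (simp_all add: cauchy_seqs_def)
    ultimately show "(x, z) \<in> null_rel G R"
      by (intro null_rel_dominated[OF xyz, of _ _ 1]) (simp_all add: univ_triangle_diff)
  qed
qed (auto simp: null_rel_def refl_on_def univ_0)

lemma null_class_eq:
  "x \<in> cauchy_seqs G R \<Longrightarrow> y \<in> cauchy_seqs G R \<Longrightarrow>
   null_rel G R `` {x} = null_rel G R `` {y} \<longleftrightarrow> (x, y) \<in> null_rel G R"
  using eq_equiv_class_iff[OF null_rel_equiv] .

lemma null_class_self: "x \<in> cauchy_seqs G R \<Longrightarrow> x \<in> null_rel G R `` {x}"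
  by (simp add: null_rel_refl)

lemma null_rel_cauchy:
  "(x, y) \<in> null_rel G R \<Longrightarrow> x \<in> cauchy_seqs G R" "(x, y) \<in> null_rel G R \<Longrightarrow> y \<in> cauchy_seqs G R"
  by (auto simp: null_rel_def)

lemma univ_cstar_add:
  assumes x: "x \<in> cauchy_seqs G R" and y: "y \<in> cauchy_seqs G R"
  shows "cadd (univ_cstar G R) (null_rel G R `` {x}) (null_rel G R `` {y}) =
    null_rel G R `` {\<lambda>n. x n + y n}"
proof -
  have "null_rel G R `` {\<lambda>n. x' n + y' n} = null_rel G R `` {\<lambda>n. x n + y n}"
    if xy: "(x, x') \<in> null_rel G R" "(y, y') \<in> null_rel G R" for x' y'
  proof -
    note c = null_rel_cauchy[OF xy(1)] null_rel_cauchy[OF xy(2)]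
    have "(\<lambda>n. x n + y n, \<lambda>n. x' n + y' n) \<in> null_rel G R"
      by (rule null_rel_dominated[OF xy, of _ _ 1])
        (use c in \<open>simp_all add: cauchy_seqs_add univ_add_diff c[THEN cauchy_seqs_car]\<close>)
    then show ?thesis by (rule equiv_class_eq[OF null_rel_equiv, symmetric])
  qed
  then show ?thesis
    unfolding univ_cstar_def cstar.simps
    by (intro UN_eq_const[OF null_class_self[OF x]] UN_eq_const[OF null_class_self[OF y]]) blast
qed

lemma univ_cstar_mult:
  assumes x: "x \<in> cauchy_seqs G R" and y: "y \<in> cauchy_seqs G R"
  shows "cmult (univ_cstar G R) (null_rel G R `` {x}) (null_rel G R `` {y}) =
    null_rel G R `` {\<lambda>n. x n * y n}"
proof -
  have "null_rel G R `` {\<lambda>n. x' n * y' n} = null_rel G R `` {\<lambda>n. x n * y n}"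
    if xy: "(x, x') \<in> null_rel G R" "(y, y') \<in> null_rel G R" for x' y'
  proof -
    note c = null_rel_cauchy[OF xy(1)] null_rel_cauchy[OF xy(2)]
    obtain b where "0 < b" "\<And>n. unorm (x' n) \<le> b" "\<And>n. unorm (y n) \<le> b"
      using cauchy_seqs_bounded2[OF c(2,3)] by metis
    then have "(\<lambda>n. x n * y n, \<lambda>n. x' n * y' n) \<in> null_rel G R"
      using c by (intro null_rel_dominated[OF xy, of _ _ b])
        (simp_all add: cauchy_seqs_mult univ_mult_diff c[THEN cauchy_seqs_car])
    then show ?thesis by (rule equiv_class_eq[OF null_rel_equiv, symmetric])
  qed
  then show ?thesis
    unfolding univ_cstar_def cstar.simps
    by (intro UN_eq_const[OF null_class_self[OF x]] UN_eq_const[OF null_class_self[OF y]]) blast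
qed

lemma univ_cstar_scale:
  assumes x: "x \<in> cauchy_seqs G R"
  shows "cscale (univ_cstar G R) c (null_rel G R `` {x}) = null_rel G R `` {\<lambda>n. free_scale c (x n)}"
proof -
  have "null_rel G R `` {\<lambda>n. free_scale c (x' n)} = null_rel G R `` {\<lambda>n. free_scale c (x n)}"
    if x': "(x, x') \<in> null_rel G R" for x'
  proof -
    note c = null_rel_cauchy[OF x']
    have "(\<lambda>n. free_scale c (x n), \<lambda>n. free_scale c (x' n)) \<in> null_rel G R"
      using c by (intro null_rel_dominated[OF x' x', of _ _ "cmod c"])
        (simp_all add: cauchy_seqs_scale univ_scale_diff c[THEN cauchy_seqs_car] univ_nonneg distrib_left)
    then show ?thesis by (rule equiv_class_eq[OF null_rel_equiv, symmetric])
  qed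
  then show ?thesis
    unfolding univ_cstar_def cstar.simps
    by (intro UN_eq_const[OF null_class_self[OF x]]) blast
qed

lemma univ_cstar_adj:
  assumes x: "x \<in> cauchy_seqs G R"
  shows "cadj (univ_cstar G R) (null_rel G R `` {x}) = null_rel G R `` {\<lambda>n. free_star (x n)}"
proof -
  have "null_rel G R `` {\<lambda>n. free_star (x' n)} = null_rel G R `` {\<lambda>n. free_star (x n)}"
    if x': "(x, x') \<in> null_rel G R" for x'
  proof -
    note c = null_rel_cauchy[OF x']
    have "(\<lambda>n. free_star (x n), \<lambda>n. free_star (x' n)) \<in> null_rel G R"
      using c by (intro null_rel_dominated[OF x' x', of _ _ 1])
        (simp_all add: cauchy_seqs_star univ_star_diff c[THEN cauchy_seqs_car] univ_nonneg)
    then show ?thesis by (rule equiv_class_eq[OF null_rel_equiv, symmetric])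
  qed
  then show ?thesis
    unfolding univ_cstar_def cstar.simps
    by (intro UN_eq_const[OF null_class_self[OF x]]) blast
qed

lemma univ_elem_mult:
  "x \<in> free_car G \<Longrightarrow> y \<in> free_car G \<Longrightarrow>
   cmult (univ_cstar G R) (univ_elem G R x) (univ_elem G R y) = univ_elem G R (x * y)"
  by (simp add: univ_elem_def univ_cstar_mult cauchy_seqs_const)

lemma univ_elem_adj:
  "x \<in> free_car G \<Longrightarrow> cadj (univ_cstar G R) (univ_elem G R x) = univ_elem G R (free_star x)"
  by (simp add: univ_elem_def univ_cstar_adj cauchy_seqs_const)

text \<open>Constant sequences differ by a null sequence only if their difference has seminorm zero.
  So equations between algebraic elements of the completion can be checked in
  \<open>univ_ring\<close>.\<close>

lemma univ_elem_eq_iff: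
  assumes "x \<in> free_car G" "y \<in> free_car G"
  shows "univ_elem G R x = univ_elem G R y \<longleftrightarrow> cls G R x = cls G R y"
  unfolding univ_elem_def null_class_eq[OF assms[THEN cauchy_seqs_const]]
  using assms by (simp add: cauchy_seqs_const null_rel_def cls_eq_iff ucong_iff tendsto_const_iff)

end

section \<open>Isomorphisms of universal C*-algebras\<close>

lemma univ_seminorm_subst_le:
  assumes b: "gen_bounded G R" "gen_bounded G' R'"
    and f: "\<And>g. g \<in> G \<Longrightarrow> f g \<in> free_car G'"
    and R: "R \<subseteq> free_car G" "\<And>r. r \<in> R \<Longrightarrow> cls G' R' (subst f r) = 0"
    and x: "x \<in> free_car G"
  shows "univ_seminorm G' R' (subst f x) \<le> univ_seminorm G R x"
proof -
  have "univ_seminorm G' R' (subst f r) = 0" if "r \<in> R" for r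
  proof -
    have "subst f r \<in> free_car G'" using R(1) that f by (blast intro: subst_car)
    then show ?thesis
      using R(2)[OF that] cls_eq_iff[of "subst f r" G' 0 R'] ucong_iff[OF b(2), of "subst f r" 0] by simp
  qed
  then have "cstar_seminorm G R (\<lambda>x. univ_seminorm G' R' (subst f x))"
    using cstar_seminorm_subst[OF cstar_seminorm_univ[OF b(2)]] f by blast
  from univ_seminorm_upper[OF b(1) this x] show ?thesis .
qed

text \<open>Both sides are *-homomorphic in \<open>x\<close>, so agreement on the generators is
  enough.\<close>

lemma ucong_subst_inverse:
  assumes f: "\<And>g. g \<in> G \<Longrightarrow> f g \<in> free_car G'" and f': "\<And>g. g \<in> G' \<Longrightarrow> f' g \<in> free_car G"
    and inv: "\<And>g. g \<in> G \<Longrightarrow> cls G R (subst f' (f g)) = cls G R (free_gen g)"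
    and x: "x \<in> free_car G"
  shows "ucong G R (subst f' (subst f x)) x"
  using x
proof (induct rule: free_car_induct)
  case (gen g)
  have "subst f' (f g) \<in> free_car G" using f gen f' by (blast intro: subst_car)
  then show ?case using inv[OF gen] gen by (simp add: cls_eq_iff)
qed (simp_all add: subst_add subst_scale subst_mult subst_star ucong_add ucong_scale ucong_mult
    ucong_star ucong_refl)

text \<open>Both substitutions are contractive and they are inverse to each other up to seminorm
  zero, hence isometric. Applied term by term, \<open>subst f\<close> then preserves Cauchy
  sequences and both preserves and reflects null sequences, which gives a well-defined injective map
  on classes.\<close>

lemma univ_cstar_iso:
  assumes b: "gen_bounded G R" and b': "gen_bounded G' R'"
    and f: "\<And>g. g \<in> G \<Longrightarrow> f g \<in> free_car G'" and f': "\<And>g. g \<in> G' \<Longrightarrow> f' g \<in> free_car G"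
    and R: "R \<subseteq> free_car G" "\<And>r. r \<in> R \<Longrightarrow> cls G' R' (subst f r) = 0"
    and R': "R' \<subseteq> free_car G'" "\<And>r. r \<in> R' \<Longrightarrow> cls G R (subst f' r) = 0"
    and inv: "\<And>g. g \<in> G \<Longrightarrow> cls G R (subst f' (f g)) = cls G R (free_gen g)"
    and inv': "\<And>g. g \<in> G' \<Longrightarrow> cls G' R' (subst f (f' g)) = cls G' R' (free_gen g)"
  shows "\<exists>\<Phi>. star_iso (univ_cstar G R) (univ_cstar G' R') \<Phi> \<and>
    (\<forall>x\<in>free_car G. \<Phi> (univ_elem G R x) = univ_elem G' R' (subst f x))"
proof -
  let ?unorm = "univ_seminorm G R" and ?unorm' = "univ_seminorm G' R'"
  let ?c = "\<lambda>x. null_rel G R `` {x}" and ?c' = "\<lambda>x. null_rel G' R' `` {x}"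
  define \<Phi> where "\<Phi> X = (\<Union>x\<in>X. ?c' (\<lambda>n. subst f (x n)))" for X
  have car: "subst f x \<in> free_car G'" if "x \<in> free_car G" for x
    using subst_car[OF that] f by blast
  have car': "subst f' x \<in> free_car G" if "x \<in> free_car G'" for x
    using subst_car[OF that] f' by blast
  have le: "?unorm' (subst f x) \<le> ?unorm x" if "x \<in> free_car G" for x
    by (rule univ_seminorm_subst_le[OF b b' f R that])
  have le': "?unorm (subst f' x) \<le> ?unorm' x" if "x \<in> free_car G'" for x
    by (rule univ_seminorm_subst_le[OF b' b f' R' that])
  have iso: "?unorm' (subst f x) = ?unorm x" if x: "x \<in> free_car G" for x
  proof (rule antisym[OF le[OF x]])
    have "?unorm (subst f' (subst f x) - x) = 0"
      using ucong_subst_inverse[where f = f and f' = f', OF f f' inv x] ucong_iff[OF b] x car car' by blast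
    then have "?unorm x \<le> ?unorm (subst f' (subst f x))"
      using univ_triangle[OF b, of "x - subst f' (subst f x)" "subst f' (subst f x)"]
        univ_minus_commute[OF b, of x "subst f' (subst f x)"] x car car' by simp
    also have "\<dots> \<le> ?unorm' (subst f x)" using le' car x by blast
    finally show "?unorm x \<le> ?unorm' (subst f x)" .
  qed
  have cauchy: "(\<lambda>n. subst f (x n)) \<in> cauchy_seqs G' R'" if "x \<in> cauchy_seqs G R" for x
    using that by (simp add: cauchy_seqs_def car iso flip: subst_diff)
  have cauchy': "(\<lambda>n. subst f' (x n)) \<in> cauchy_seqs G R" if x: "x \<in> cauchy_seqs G' R'" for x
    unfolding cauchy_seqs_def
  proof (intro CollectI conjI allI impI)
    show "subst f' (x n) \<in> free_car G" for n
      using car' cauchy_seqs_car[OF b' x] .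
    fix e :: real assume "0 < e"
    then obtain M where "\<And>m n. m \<ge> M \<Longrightarrow> n \<ge> M \<Longrightarrow> ?unorm' (x m - x n) < e"
      using x unfolding cauchy_seqs_def mem_Collect_eq by meson
    moreover have "?unorm (subst f' (x m) - subst f' (x n)) \<le> ?unorm' (x m - x n)" for m n
      using le'[of "x m - x n"] cauchy_seqs_car[OF b' x] by (simp add: subst_diff)
    ultimately show "\<exists>M. \<forall>m\<ge>M. \<forall>n\<ge>M. ?unorm (subst f' (x m) - subst f' (x n)) < e"
      by (meson le_less_trans)
  qed
  have rel: "(\<lambda>n. subst f (x n), \<lambda>n. subst f (y n)) \<in> null_rel G' R' \<longleftrightarrow> (x, y) \<in> null_rel G R"
    if "x \<in> cauchy_seqs G R" "y \<in> cauchy_seqs G R" for x y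
    using that by (simp add: null_rel_def cauchy iso that[THEN cauchy_seqs_car[OF b]] flip: subst_diff)
  have \<Phi>: "\<Phi> (?c x) = ?c' (\<lambda>n. subst f (x n))" if x: "x \<in> cauchy_seqs G R" for x
  proof -
    have "?c' (\<lambda>n. subst f (y n)) = ?c' (\<lambda>n. subst f (x n))" if "(x, y) \<in> null_rel G R" for y
      using that null_rel_cauchy[OF b that] rel[of x y]
      by (intro equiv_class_eq[OF null_rel_equiv[OF b'], symmetric]) simp
    then show ?thesis
      unfolding \<Phi>_def by (intro UN_eq_const[OF null_class_self[OF b x]]) blast
  qed
  have ccar: "ccar (univ_cstar G R) = ?c ` cauchy_seqs G R"
      "ccar (univ_cstar G' R') = ?c' ` cauchy_seqs G' R'"
    by (auto simp: univ_cstar_def quotient_def)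
  have hom: "star_hom (univ_cstar G R) (univ_cstar G' R') \<Phi>"
    unfolding star_hom_def ccar
    by (auto simp: \<Phi> cauchy univ_cstar_add[OF b] univ_cstar_add[OF b'] univ_cstar_mult[OF b]
        univ_cstar_mult[OF b'] univ_cstar_scale[OF b] univ_cstar_scale[OF b'] univ_cstar_adj[OF b]
        univ_cstar_adj[OF b'] cauchy_seqs_add[OF b] cauchy_seqs_mult[OF b] cauchy_seqs_scale[OF b]
        cauchy_seqs_star[OF b] subst_add subst_mult subst_scale subst_star)
  have "inj_on \<Phi> (?c ` cauchy_seqs G R)"
  proof (rule inj_onI)
    fix X Y assume "X \<in> ?c ` cauchy_seqs G R" "Y \<in> ?c ` cauchy_seqs G R" and eq: "\<Phi> X = \<Phi> Y"
    then obtain x y where x: "x \<in> cauchy_seqs G R" "X = ?c x" and y: "y \<in> cauchy_seqs G R" "Y = ?c y"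
      by blast
    with eq have "(\<lambda>n. subst f (x n), \<lambda>n. subst f (y n)) \<in> null_rel G' R'"
      by (metis \<Phi> cauchy null_class_eq[OF b'])
    then show "X = Y"
      unfolding x(2) y(2) null_class_eq[OF b x(1) y(1)] rel[OF x(1) y(1)] .
  qed
  moreover have "\<Phi> ` ?c ` cauchy_seqs G R = ?c' ` cauchy_seqs G' R'"
  proof safe
    fix y assume y: "y \<in> cauchy_seqs G' R'"
    \<comment> \<open>A preimage of the class of \<open>y\<close> is \<open>y\<close> mapped term by
      term by \<open>subst f'\<close>: mapping back changes each term by seminorm zero only.\<close>
    have "ucong G' R' (subst f (subst f' (y n))) (y n)" for n
      by (rule ucong_subst_inverse[where f = f' and f' = f, OF f' f inv' cauchy_seqs_car[OF b' y]])
    then have "?unorm' (subst f (subst f' (y n)) - y n) = 0" for n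
      using ucongD[OF _ cstar_seminorm_univ[OF b']] by blast
    then have "(\<lambda>n. subst f (subst f' (y n)), y) \<in> null_rel G' R'"
      using y cauchy cauchy' by (simp add: null_rel_def)
    then have "?c' y = \<Phi> (?c (\<lambda>n. subst f' (y n)))"
      using y cauchy cauchy' by (simp add: \<Phi> null_class_eq[OF b', symmetric])
    then show "?c' y \<in> \<Phi> ` ?c ` cauchy_seqs G R"
      using cauchy'[OF y] by blast
  next
    fix x assume "x \<in> cauchy_seqs G R"
    then show "\<Phi> (?c x) \<in> ?c' ` cauchy_seqs G' R'" by (simp add: \<Phi> cauchy)
  qed
  ultimately have "star_iso (univ_cstar G R) (univ_cstar G' R') \<Phi>"
    using hom by (simp add: star_iso_def bij_betw_def ccar)
  moreover have "\<Phi> (univ_elem G R x) = univ_elem G' R' (subst f x)" if "x \<in> free_car G" for x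
    using \<Phi>[OF cauchy_seqs_const[OF b that]] by (simp add: univ_elem_def)
  ultimately show ?thesis by blast
qed

section \<open>Boolean algebras without top\<close>

context bool_alg
begin

text \<open>Homomorphisms to the two-element algebra. Without a top element nothing forces a value
  to be true, so the zero homomorphism is among them; values outside the carrier are
  arbitrary.\<close>

definition chars :: "('b \<Rightarrow> bool) set" where
  "chars = {h. \<not> h (bot X) \<and> (\<forall>A\<in>car X. \<forall>B\<in>car X. (h (meet X A B) \<longleftrightarrow> h A \<and> h B) \<and>
     (h (join X A B) \<longleftrightarrow> h A \<or> h B) \<and> (h (diff X A B) \<longleftrightarrow> h A \<and> \<not> h B))}"

lemma char_simps:
  assumes "h \<in> chars"
  shows "\<not> h (bot X)"
    "A \<in> car X \<Longrightarrow> B \<in> car X \<Longrightarrow> h (meet X A B) \<longleftrightarrow> h A \<and> h B"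
    "A \<in> car X \<Longrightarrow> B \<in> car X \<Longrightarrow> h (join X A B) \<longleftrightarrow> h A \<or> h B"
    "A \<in> car X \<Longrightarrow> B \<in> car X \<Longrightarrow> h (diff X A B) \<longleftrightarrow> h A \<and> \<not> h B"
  using assms by (simp_all add: chars_def)

lemma meet_idem: "A \<in> car X \<Longrightarrow> meet X A A = A"
  by (metis join_closed join_meet_absorb meet_closed meet_join_absorb)

lemma meet_bot: "A \<in> car X \<Longrightarrow> meet X (bot X) A = bot X" "A \<in> car X \<Longrightarrow> meet X A (bot X) = bot X"
  using bot_least bot_closed by (simp_all add: ble_def meet_comm)

lemma join_bot: "A \<in> car X \<Longrightarrow> join X (bot X) A = A" "A \<in> car X \<Longrightarrow> join X A (bot X) = A"
  using bot_closed by (metis join_comm join_meet_absorb meet_bot(2))+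

lemma ble_refl: "A \<in> car X \<Longrightarrow> ble X A A"
  by (simp add: ble_def meet_idem)

lemma ble_trans:
  "A \<in> car X \<Longrightarrow> B \<in> car X \<Longrightarrow> C \<in> car X \<Longrightarrow> ble X A B \<Longrightarrow> ble X B C \<Longrightarrow> ble X A C"
  by (metis ble_def meet_assoc)

lemma meet_le1: "A \<in> car X \<Longrightarrow> B \<in> car X \<Longrightarrow> ble X (meet X A B) A"
  unfolding ble_def by (metis meet_assoc meet_comm meet_idem)

lemma meet_le2: "A \<in> car X \<Longrightarrow> B \<in> car X \<Longrightarrow> ble X (meet X A B) B"
  unfolding ble_def by (metis meet_assoc meet_idem)

lemma meet_greatest:
  "A \<in> car X \<Longrightarrow> B \<in> car X \<Longrightarrow> C \<in> car X \<Longrightarrow> ble X C A \<Longrightarrow> ble X C B \<Longrightarrow> ble X C (meet X A B)"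
  unfolding ble_def by (metis meet_assoc)

lemma join_le1: "A \<in> car X \<Longrightarrow> B \<in> car X \<Longrightarrow> ble X A (join X A B)"
  unfolding ble_def by (rule meet_join_absorb)

lemma join_le2: "A \<in> car X \<Longrightarrow> B \<in> car X \<Longrightarrow> ble X B (join X A B)"
  unfolding ble_def by (metis meet_join_absorb join_comm)

lemma ble_bot: "A \<in> car X \<Longrightarrow> ble X A (bot X) \<Longrightarrow> A = bot X"
  by (simp add: ble_def meet_bot)

text \<open>Proper filters. The empty set counts as one, which is why
  \<open>ultrafilter_char\<close> asks for a member \<open>C\<close>.\<close>

definition filters :: "'b set set" where
  "filters = {F. F \<subseteq> car X \<and> bot X \<notin> F \<and> (\<forall>A\<in>F. \<forall>B\<in>F. meet X A B \<in> F) \<and>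
     (\<forall>A\<in>F. \<forall>B\<in>car X. ble X A B \<longrightarrow> B \<in> F)}"

text \<open>By maximality every \<open>A\<close> outside \<open>F\<close> is disjoint from some
  member of \<open>F\<close>. If \<open>A\<close> and \<open>B\<close> are both outside, the meet of
  two such members is disjoint from their join, so \<open>F\<close> is prime.\<close>

lemma ultrafilter_char:
  assumes F: "F \<in> filters" "C \<in> F" and max: "\<And>F'. F' \<in> filters \<Longrightarrow> F \<subseteq> F' \<Longrightarrow> F' = F"
  shows "(\<lambda>A. A \<in> F) \<in> chars"
proof -
  have car: "\<And>A. A \<in> F \<Longrightarrow> A \<in> car X" and bot: "bot X \<notin> F"
    and meet: "\<And>A B. A \<in> F \<Longrightarrow> B \<in> F \<Longrightarrow> meet X A B \<in> F"
    and up: "\<And>A B. A \<in> F \<Longrightarrow> B \<in> car X \<Longrightarrow> ble X A B \<Longrightarrow> B \<in> F"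
    using F by (auto simp: filters_def)
  have out: "\<exists>f\<in>F. meet X f A = bot X" if A: "A \<in> car X" "A \<notin> F" for A
  proof (rule ccontr)
    assume neg: "\<not> ?thesis"
    \<comment> \<open>The filter generated by \<open>F\<close> and \<open>A\<close>; it is proper
      exactly because no member of \<open>F\<close> is disjoint from \<open>A\<close>.\<close>
    define F' where "F' = {B\<in>car X. \<exists>f\<in>F. ble X (meet X f A) B}"
    have "F' \<in> filters"
      unfolding filters_def mem_Collect_eq
    proof (intro conjI ballI impI)
      show "F' \<subseteq> car X" by (auto simp: F'_def)
      show "bot X \<notin> F'"
      proof
        assume "bot X \<in> F'"
        then obtain f where "f \<in> F" "ble X (meet X f A) (bot X)" by (auto simp: F'_def)
        then show False
          using neg A(1) car ble_bot[of "meet X f A"] meet_closed by blast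
      qed
      fix B assume "B \<in> F'"
      then obtain f where f: "B \<in> car X" "f \<in> F" "ble X (meet X f A) B" by (auto simp: F'_def)
      {
        fix B' assume "B' \<in> F'"
        then obtain f' where f': "B' \<in> car X" "f' \<in> F" "ble X (meet X f' A) B'" by (auto simp: F'_def)
        have [simp]: "f \<in> car X" "f' \<in> car X" using f f' car by auto
        have "ble X (meet X (meet X f f') A) (meet X f A)" "ble X (meet X (meet X f f') A) (meet X f' A)"
          using A(1) by (intro meet_greatest meet_le2 ble_trans[OF _ _ _ meet_le1 meet_le1]
              ble_trans[OF _ _ _ meet_le1 meet_le2]; simp add: meet_closed)+
        then have "ble X (meet X (meet X f f') A) B" "ble X (meet X (meet X f f') A) B'"
          using A(1) f f' by (blast intro: ble_trans[OF _ _ _ _ f(3)] ble_trans[OF _ _ _ _ f'(3)]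
              meet_closed car)+
        then have "ble X (meet X (meet X f f') A) (meet X B B')"
          using A(1) f f' by (simp add: meet_greatest meet_closed)
        then show "meet X B B' \<in> F'"
          unfolding F'_def using f f' meet meet_closed by blast
      }
      fix B' assume "B' \<in> car X" "ble X B B'"
      then show "B' \<in> F'"
        using f A car ble_trans[of "meet X f A" B B'] meet_closed by (auto simp: F'_def)
    qed
    moreover have "F \<subseteq> F'"
      using A(1) car meet_le1 by (auto simp: F'_def)
    ultimately have "F' = F" by (rule max)
    moreover have "A \<in> F'"
      using A F(2) car[OF F(2)] meet_le2 by (auto simp: F'_def)
    ultimately show False using A by simp
  qed
  have meet_iff: "meet X A B \<in> F \<longleftrightarrow> A \<in> F \<and> B \<in> F" if "A \<in> car X" "B \<in> car X" for A B
    using that up[OF _ _ meet_le1] up[OF _ _ meet_le2] meet by blast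
  have join_iff: "join X A B \<in> F \<longleftrightarrow> A \<in> F \<or> B \<in> F" if AB: "A \<in> car X" "B \<in> car X" for A B
  proof
    show "A \<in> F \<or> B \<in> F" if "join X A B \<in> F"
    proof (rule ccontr)
      assume "\<not> ?thesis"
      then obtain f g where fg: "f \<in> F" "g \<in> F" "meet X f A = bot X" "meet X g B = bot X"
        using out AB by blast
      then have [simp]: "f \<in> car X" "g \<in> car X" using car by auto
      have "meet X (meet X f g) A = bot X" "meet X (meet X f g) B = bot X"
        using AB fg by (metis \<open>f \<in> car X\<close> \<open>g \<in> car X\<close> meet_assoc meet_bot(2) meet_comm)+
      then have "meet X (meet X f g) (join X A B) = bot X"
        using AB by (simp add: meet_join_distrib meet_closed join_bot bot_closed)
      then show False
        using meet[OF meet[OF fg(1,2)] that] bot by simp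
    qed
    show "join X A B \<in> F" if "A \<in> F \<or> B \<in> F"
      using that AB up[OF _ join_closed join_le1] up[OF _ join_closed join_le2] by blast
  qed
  have "diff X A B \<in> F \<longleftrightarrow> A \<in> F \<and> B \<notin> F" if AB: "A \<in> car X" "B \<in> car X" for A B
    using AB join_iff[of "diff X A B" "meet X A B"] meet_iff[of A B]
      meet_iff[of "diff X A B" "meet X A B"] bot
    by (auto simp: diff_cover diff_disjoint diff_closed meet_closed)
  then show ?thesis using meet_iff join_iff bot by (auto simp: chars_def)
qed

text \<open>Zorn's lemma above the principal filter of \<open>C\<close>, which is proper because
  \<open>C\<close> is nonempty.\<close>

lemma char_exists:
  assumes C: "C \<in> car X" "C \<noteq> bot X"
  obtains h where "h \<in> chars" "h C"
proof -
  define P where "P = {F \<in> filters. C \<in> F}"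
  have up: "{B \<in> car X. ble X C B} \<in> P"
    unfolding P_def filters_def
  proof (rule CollectI, rule conjI, rule CollectI, intro conjI ballI impI)
    show "bot X \<notin> {B \<in> car X. ble X C B}"
      using C ble_bot by blast
    fix A assume "A \<in> {B \<in> car X. ble X C B}"
    then have A: "A \<in> car X" "ble X C A" by auto
    show "meet X A B \<in> {B \<in> car X. ble X C B}" if "B \<in> {B \<in> car X. ble X C B}" for B
      using that A C meet_closed meet_greatest by blast
    show "B \<in> {B \<in> car X. ble X C B}" if "B \<in> car X" "ble X A B" for B
      using that A C ble_trans by blast
  qed (use C ble_refl in auto)
  have "\<exists>M\<in>P. \<forall>F\<in>P. M \<subseteq> F \<longrightarrow> F = M"
  proof (rule subset_Zorn_nonempty)
    fix \<C> assume \<C>: "\<C> \<noteq> {}" "subset.chain P \<C>"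
    then have chain: "\<And>F G. F \<in> \<C> \<Longrightarrow> G \<in> \<C> \<Longrightarrow> F \<subseteq> G \<or> G \<subseteq> F" and sub: "\<And>F. F \<in> \<C> \<Longrightarrow> F \<in> P"
      by (auto simp: subset_chain_def)
    have "meet X A B \<in> \<Union>\<C>" if "A \<in> \<Union>\<C>" "B \<in> \<Union>\<C>" for A B
    proof -
      obtain F where "F \<in> \<C>" "A \<in> F" "B \<in> F" using \<open>A \<in> \<Union>\<C>\<close> \<open>B \<in> \<Union>\<C>\<close> chain by blast
      then show ?thesis using sub[of F] by (auto simp: P_def filters_def)
    qed
    then show "\<Union>\<C> \<in> P"
      using sub \<C>(1) unfolding P_def filters_def by blast
  qed (use up in blast)
  \<comment> \<open>A filter above \<open>M\<close> contains \<open>C\<close> too, so maximality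
    within \<open>P\<close> is maximality among all filters.\<close>
  then obtain M where M: "M \<in> filters" "C \<in> M" "\<And>F. F \<in> filters \<Longrightarrow> M \<subseteq> F \<Longrightarrow> F = M"
    unfolding P_def by blast
  from ultrafilter_char[OF this] M(2) show thesis by (rule that)
qed

text \<open>
  By Stone duality, identities and inequalities of the algebra can be checked in the
  two-element algebra.
\<close>

lemma char_eqI:
  assumes AB: "A \<in> car X" "B \<in> car X" and eq: "\<And>h. h \<in> chars \<Longrightarrow> h A = h B"
  shows "A = B"
proof -
  have "diff X C D = bot X" if "C \<in> car X" "D \<in> car X" "\<And>h. h \<in> chars \<Longrightarrow> h C = h D" for C D
    using that char_exists[of "diff X C D"] by (metis char_simps(4) diff_closed)
  then have "diff X A B = bot X" "diff X B A = bot X" using AB eq by blast+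
  then show ?thesis
    using diff_cover[OF AB] diff_cover[OF AB(2,1)] meet_comm[OF AB] AB
    by (simp add: join_bot meet_closed)
qed

lemma ble_char:
  assumes "A \<in> car X" "B \<in> car X"
  shows "ble X A B \<longleftrightarrow> (\<forall>h\<in>chars. h A \<longrightarrow> h B)"
proof
  show "\<forall>h\<in>chars. h A \<longrightarrow> h B" if "ble X A B"
    using that assms by (metis ble_def char_simps(2))
  show "ble X A B" if "\<forall>h\<in>chars. h A \<longrightarrow> h B"
    unfolding ble_def using that assms
    by (intro char_eqI) (auto simp: meet_closed char_simps)
qed

lemma eq_bot_char: "A \<in> car X \<Longrightarrow> A = bot X \<longleftrightarrow> (\<forall>h\<in>chars. \<not> h A)"
  by (metis char_exists char_simps(1))


lemma ble_joinD:
  "A \<in> car X \<Longrightarrow> B \<in> car X \<Longrightarrow> C \<in> car X \<Longrightarrow> ble X A C \<Longrightarrow> ble X B C \<Longrightarrow> ble X (join X A B) C"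
  by (auto simp: ble_char join_closed char_simps)

section \<open>Ideals and quotients\<close>

lemma ideal_car: "bool_ideal X I \<Longrightarrow> A \<in> I \<Longrightarrow> A \<in> car X"
  by (auto simp: bool_ideal_def)

lemma ideal_join: "bool_ideal X I \<Longrightarrow> A \<in> I \<Longrightarrow> B \<in> I \<Longrightarrow> join X A B \<in> I"
  by (auto simp: bool_ideal_def)

lemma ideal_down: "bool_ideal X I \<Longrightarrow> A \<in> I \<Longrightarrow> B \<in> car X \<Longrightarrow> ble X B A \<Longrightarrow> B \<in> I"
  by (auto simp: bool_ideal_def)

lemma ideal_bot: "bool_ideal X I \<Longrightarrow> bot X \<in> I"
  unfolding bool_ideal_def using bot_closed bot_least by blast

lemma car_ideal: "bool_ideal X (car X)"
  using bot_closed by (auto simp: bool_ideal_def join_closed)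

text \<open>If \<open>A\<close> joined with \<open>A'\<close> equals \<open>B\<close> joined with
  \<open>B'\<close>, then what \<open>A\<close> has outside \<open>B\<close> lies in
  \<open>B'\<close>, and symmetrically. The form with differences is the one that can be computed
  with.\<close>

lemma quot_rel_iff:
  assumes I: "bool_ideal X I"
  shows "(A, B) \<in> quot_rel X I \<longleftrightarrow> A \<in> car X \<and> B \<in> car X \<and> diff X A B \<in> I \<and> diff X B A \<in> I"
proof
  assume "(A, B) \<in> quot_rel X I"
  then obtain A' B' where A': "A \<in> car X" "B \<in> car X" "A' \<in> I" "B' \<in> I" "join X A A' = join X B B'"
    by (auto simp: quot_rel_def)
  then have car: "A' \<in> car X" "B' \<in> car X" using ideal_car[OF I] by auto
  have "h A \<or> h A' \<longleftrightarrow> h B \<or> h B'" if "h \<in> chars" for h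
    using A' car char_simps(3)[OF that] by metis
  then have "ble X (diff X A B) B'" "ble X (diff X B A) A'"
    using A' car by (auto simp: ble_char diff_closed char_simps)
  then show "A \<in> car X \<and> B \<in> car X \<and> diff X A B \<in> I \<and> diff X B A \<in> I"
    using A' ideal_down[OF I] diff_closed by blast
next
  assume *: "A \<in> car X \<and> B \<in> car X \<and> diff X A B \<in> I \<and> diff X B A \<in> I"
  \<comment> \<open>The two differences themselves serve as the witnesses, crosswise.\<close>
  then have "join X A (diff X B A) = join X B (diff X A B)"
    by (intro char_eqI) (auto simp: join_closed diff_closed char_simps)
  with * show "(A, B) \<in> quot_rel X I" by (auto simp: quot_rel_def)
qed

lemma quot_rel_equiv:
  assumes I: "bool_ideal X I"
  shows "equiv (car X) (quot_rel X I)"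
proof (rule equivI)
  show "quot_rel X I \<subseteq> car X \<times> car X" by (auto simp: quot_rel_def)
  have "diff X A A = bot X" if "A \<in> car X" for A
    using that by (simp add: eq_bot_char diff_closed char_simps)
  then show "refl_on (car X) (quot_rel X I)"
    using ideal_bot[OF I] by (auto simp: refl_on_def quot_rel_iff[OF I])
  show "sym (quot_rel X I)" by (auto simp: sym_def quot_rel_iff[OF I])
  have le: "ble X (diff X A C) (join X (diff X A B) (diff X B C))"
    if "A \<in> car X" "B \<in> car X" "C \<in> car X" for A B C
    using that by (simp add: ble_char diff_closed join_closed char_simps)
  show "trans (quot_rel X I)"
    unfolding trans_def quot_rel_iff[OF I]
    by (meson I diff_closed ideal_down ideal_join le)
qed

lemma quot_eq_iff:
  assumes "bool_ideal X I" "A \<in> car X" "B \<in> car X"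
  shows "quot_map X I A = quot_map X I B \<longleftrightarrow> diff X A B \<in> I \<and> diff X B A \<in> I"
  unfolding quot_map_def using assms
  by (simp add: eq_equiv_class_iff[OF quot_rel_equiv] quot_rel_iff)

text \<open>The hypothesis on characters says that \<open>f\<close> is computed pointwise on the
  Stone space, which covers meet, join and difference at once.\<close>

lemma quot_op:
  assumes I: "bool_ideal X I"
    and cl: "\<And>A B. A \<in> car X \<Longrightarrow> B \<in> car X \<Longrightarrow> f A B \<in> car X"
    and h: "\<And>h A B A' B'. h \<in> chars \<Longrightarrow> A \<in> car X \<Longrightarrow> B \<in> car X \<Longrightarrow> A' \<in> car X \<Longrightarrow> B' \<in> car X \<Longrightarrow>
      h A = h A' \<Longrightarrow> h B = h B' \<Longrightarrow> h (f A B) = h (f A' B')"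
    and AB: "A \<in> car X" "B \<in> car X"
  shows "(\<Union>A\<in>quot_map X I A. \<Union>B\<in>quot_map X I B. quot_map X I (f A B)) = quot_map X I (f A B)"
proof -
  have eq: "quot_map X I (f A' B') = quot_map X I (f A B)"
    if "A' \<in> quot_map X I A" "B' \<in> quot_map X I B" for A' B'
  proof -
    \<comment> \<open>The union of the symmetric differences of both pairs of representatives:
      \<open>f A B\<close> and \<open>f A' B'\<close> can differ only inside it.\<close>
    let ?Z = "join X (join X (diff X A A') (diff X A' A)) (join X (diff X B B') (diff X B' B))"
    have A': "A' \<in> car X" "diff X A A' \<in> I" "diff X A' A \<in> I"
      and B': "B' \<in> car X" "diff X B B' \<in> I" "diff X B' B \<in> I"
      using that by (auto simp: quot_map_def quot_rel_iff[OF I])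
    then have Z: "?Z \<in> I" by (intro ideal_join[OF I])
    have "ble X (diff X (f A B) (f A' B')) ?Z" "ble X (diff X (f A' B') (f A B)) ?Z"
      using A'(1) B'(1) AB h[of _ A B A' B'] by (auto simp: ble_char diff_closed join_closed char_simps cl)
    then have "diff X (f A B) (f A' B') \<in> I" "diff X (f A' B') (f A B) \<in> I"
      using Z A'(1) B'(1) AB by (auto intro: ideal_down[OF I Z] diff_closed cl)
    then show ?thesis using A'(1) B'(1) AB by (simp add: quot_eq_iff[OF I] cl)
  qed
  have self: "A \<in> quot_map X I A" "B \<in> quot_map X I B"
    using equiv_class_self[OF quot_rel_equiv[OF I]] AB by (simp_all add: quot_map_def)
  show ?thesis
    by (rule UN_eq_const[OF self(1)], rule UN_eq_const[OF self(2)], rule eq)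
qed

lemma
  assumes I: "bool_ideal X I" and AB: "A \<in> car X" "B \<in> car X"
  shows quot_meet: "meet (quot_alg X I) (quot_map X I A) (quot_map X I B) = quot_map X I (meet X A B)"
    and quot_join: "join (quot_alg X I) (quot_map X I A) (quot_map X I B) = quot_map X I (join X A B)"
    and quot_diff: "diff (quot_alg X I) (quot_map X I A) (quot_map X I B) = quot_map X I (diff X A B)"
  using AB unfolding quot_alg_def boolalg.simps
  by (intro quot_op[OF I]; simp add: meet_closed join_closed diff_closed char_simps)+

lemma quot_car: "car (quot_alg X I) = quot_map X I ` car X"
  by (auto simp: quot_alg_def quotient_def quot_map_def)

lemma quot_bot: "bot (quot_alg X I) = quot_map X I (bot X)"
  by (simp add: quot_alg_def)

end

section \<open>The extended Boolean algebra\<close>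

lemma act_word_Nil [simp]: "act_word S [] A = A"
  and act_word_Cons [simp]: "act_word S (a # w) A = act_word S w (act S a A)"
  and act_word_append: "act_word S (v @ w) A = act_word S w (act_word S v A)"
  by (simp_all add: act_word_def)

declare in_lists_conv_set [simp del] in_listsD [rule del] in_listsI [rule del]

context relative_gbds
begin

abbreviation W :: "'l list set" where "W \<equiv> lists (labels S)"
abbreviation X :: "'b boolalg" where "X \<equiv> alg S"
abbreviation Xbar :: "('l list \<Rightarrow> 'b) boolalg" where "Xbar \<equiv> bar_alg S"

lemma act_simps:
  assumes "a \<in> labels S"
  shows "A \<in> car X \<Longrightarrow> act S a A \<in> car X"
    "A \<in> car X \<Longrightarrow> B \<in> car X \<Longrightarrow> act S a (meet X A B) = meet X (act S a A) (act S a B)"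
    "A \<in> car X \<Longrightarrow> B \<in> car X \<Longrightarrow> act S a (join X A B) = join X (act S a A) (act S a B)"
    "A \<in> car X \<Longrightarrow> B \<in> car X \<Longrightarrow> act S a (diff X A B) = diff X (act S a A) (act S a B)"
    "act S a (bot X) = bot X"
  using act_hom[OF assms] act_bot[OF assms] by (auto simp: bool_hom_def)

lemma act_word_closed: "w \<in> W \<Longrightarrow> A \<in> car X \<Longrightarrow> act_word S w A \<in> car X"
  by (induct w arbitrary: A) (auto simp: act_simps)

lemma act_word_hom:
  assumes "w \<in> W"
  shows "A \<in> car X \<Longrightarrow> B \<in> car X \<Longrightarrow> act_word S w (meet X A B) = meet X (act_word S w A) (act_word S w B)"
    "A \<in> car X \<Longrightarrow> B \<in> car X \<Longrightarrow> act_word S w (join X A B) = join X (act_word S w A) (act_word S w B)"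
    "A \<in> car X \<Longrightarrow> B \<in> car X \<Longrightarrow> act_word S w (diff X A B) = diff X (act_word S w A) (act_word S w B)"
    "act_word S w (bot X) = bot X"
  using assms by (induct w arbitrary: A B) (auto simp: act_simps)

lemma act_mono:
  "a \<in> labels S \<Longrightarrow> A \<in> car X \<Longrightarrow> B \<in> car X \<Longrightarrow> ble X A B \<Longrightarrow> ble X (act S a A) (act S a B)"
  unfolding ble_def by (metis act_simps(2))

lemma act_word_mono:
  "w \<in> W \<Longrightarrow> A \<in> car X \<Longrightarrow> B \<in> car X \<Longrightarrow> ble X A B \<Longrightarrow> ble X (act_word S w A) (act_word S w B)"
  unfolding ble_def by (metis act_word_hom(1))

lemma Idl_car: "a \<in> labels S \<Longrightarrow> A \<in> Idl S a \<Longrightarrow> A \<in> car X"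
  using ideal_car[OF Idl_ideal] .

lemma act_Idl: "a \<in> labels S \<Longrightarrow> A \<in> car X \<Longrightarrow> act S a A \<in> Idl S a"
  using Rw_subset_Idl[of a] ble_refl[of "act S a A"] by (auto simp: Rw_def act_simps)

text \<open>Regularity of \<open>A\<close> is a condition on everything below \<open>A\<close>, so
  regular elements are downward closed, and an ideal among them is an ideal of the whole
  algebra.\<close>

lemma Jdl_bool_ideal: "bool_ideal X (Jdl S)"
proof -
  have J: "Jdl S \<subseteq> regular S" "Jdl S \<noteq> {}"
    "\<And>A B. A \<in> Jdl S \<Longrightarrow> B \<in> Jdl S \<Longrightarrow> join X A B \<in> Jdl S"
    "\<And>A B. A \<in> Jdl S \<Longrightarrow> B \<in> regular S \<Longrightarrow> ble X B A \<Longrightarrow> B \<in> Jdl S"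
    using Jdl_ideal by (simp_all add: bool_ideal_def ble_def)
  have down: "B \<in> regular S" if A: "A \<in> regular S" and B: "B \<in> car X" "ble X B A" for A B
  proof -
    have "ble X C A" if "C \<in> car X" "ble X C B" for C
      using ble_trans[OF that(1) B(1) _ that(2) B(2)] A by (simp add: regular_def)
    then show ?thesis using A B(1) by (simp add: regular_def)
  qed
  have car: "regular S \<subseteq> car X" by (auto simp: regular_def)
  show ?thesis
    unfolding bool_ideal_def
  proof (intro conjI ballI impI)
    show "B \<in> Jdl S" if "A \<in> Jdl S" "B \<in> car X" "ble X B A" for A B
      using J(4)[OF that(1) down[OF _ that(2,3)] that(3)] J(1) that(1) by blast
  qed (use J car in auto)
qed

lemma Jdl_regular: "Jdl S \<subseteq> regular S"
  using Jdl_ideal by (simp add: bool_ideal_def)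

text \<open>\<open>regular\<close> speaks of nonempty elements only; for the empty one
  \<open>Delta\<close> is empty because actions preserve it.\<close>

lemma Delta_Jdl_finite: "A \<in> Jdl S \<Longrightarrow> finite (Delta S A)"
proof (cases "A = bot X")
  case True
  then have "Delta S A = {}" by (auto simp: Delta_def act_simps)
  then show ?thesis by simp
next
  case False
  assume "A \<in> Jdl S"
  then have "A \<in> regular S" using Jdl_regular by blast
  with False show ?thesis using ble_refl[of A] by (simp add: regular_def)
qed

lemma Rw_car: "A \<in> Rw S w \<Longrightarrow> A \<in> car X"
  by (simp add: Rw_def)

lemma Rw_ideal:
  assumes w: "w \<in> W"
  shows "bool_ideal X (Rw S w)"
proof -
  have "join X A A' \<in> Rw S w" if A: "A \<in> Rw S w" "A' \<in> Rw S w" for A A'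
  proof -
    obtain B B' where B: "B \<in> car X" "B' \<in> car X" "ble X A (act_word S w B)" "ble X A' (act_word S w B')"
      using A by (auto simp: Rw_def)
    then have "ble X (join X A A') (act_word S w (join X B B'))"
      using A w by (simp add: Rw_def act_word_hom ble_char join_closed act_word_closed char_simps) blast
    then show ?thesis using A B by (auto simp: Rw_def join_closed)
  qed
  moreover have "bot X \<in> Rw S w"
    using bot_closed bot_least w act_word_closed by (auto simp: Rw_def)
  moreover have "B \<in> Rw S w" if "A \<in> Rw S w" "B \<in> car X" "ble X B A" for A B
    using that ble_trans[of B A] act_word_closed[OF w] by (auto simp: Rw_def)
  ultimately show ?thesis
    by (auto simp: bool_ideal_def Rw_car)
qed

lemma Rw_closed:
  assumes "w \<in> W" "A \<in> Rw S w" "B \<in> Rw S w"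
  shows "meet X A B \<in> Rw S w" "join X A B \<in> Rw S w" "diff X A B \<in> Rw S w"
  using assms ideal_down[OF Rw_ideal, of w A] ideal_join[OF Rw_ideal]
  by (auto simp: Rw_car meet_closed diff_closed ble_char char_simps)

lemma Rw_append: "v \<in> W \<Longrightarrow> w \<in> W \<Longrightarrow> A \<in> Rw S (v @ w) \<Longrightarrow> A \<in> Rw S w"
  unfolding Rw_def act_word_append using act_word_closed by blast

lemma Rw_act: "v \<in> W \<Longrightarrow> w \<in> W \<Longrightarrow> A \<in> Rw S v \<Longrightarrow> act_word S w A \<in> Rw S (v @ w)"
  by (auto simp: Rw_def act_word_append intro!: act_word_closed act_word_mono)

section \<open>Families with finitely many exceptional pairs\<close>

definition exc :: "('l list \<Rightarrow> 'b) \<Rightarrow> ('l list \<times> 'l) set" where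
  "exc A = {(w, a). w \<in> W \<and> a \<in> labels S \<and> A (w @ [a]) \<noteq> act S a (A w)}"

lemma bar_car: "A \<in> car Xbar \<longleftrightarrow> A \<in> extensional W \<and> (\<forall>w\<in>W. A w \<in> Rw S w) \<and> finite (exc A)"
  by (auto simp: bar_alg_def prod_alg_def PiE_iff exc_def)

lemma bar_ops:
  "w \<in> W \<Longrightarrow> meet Xbar A B w = meet X (A w) (B w)"
  "w \<in> W \<Longrightarrow> join Xbar A B w = join X (A w) (B w)"
  "w \<in> W \<Longrightarrow> diff Xbar A B w = diff X (A w) (B w)"
  "w \<in> W \<Longrightarrow> bot Xbar w = bot X"
  by (simp_all add: bar_alg_def prod_alg_def)

lemma bar_ext:
  "meet Xbar A B \<in> extensional W" "join Xbar A B \<in> extensional W"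
  "diff Xbar A B \<in> extensional W" "bot Xbar \<in> extensional W"
  by (simp_all add: bar_alg_def prod_alg_def)

lemma bar_app: "A \<in> car Xbar \<Longrightarrow> w \<in> W \<Longrightarrow> A w \<in> car X"
  unfolding bar_car using Rw_car by blast

lemma bar_app_Nil: "A \<in> car Xbar \<Longrightarrow> A [] \<in> car X"
  by (simp add: bar_app)

lemma bar_eqI: "A \<in> car Xbar \<Longrightarrow> B \<in> car Xbar \<Longrightarrow> (\<And>w. w \<in> W \<Longrightarrow> A w = B w) \<Longrightarrow> A = B"
  by (rule extensionalityI[of A W B]) (simp_all add: bar_car)

text \<open>Since \<open>f\<close> commutes with the actions, a pair that is exceptional for neither
  argument is not exceptional for the result.\<close>

lemma exc_op:
  assumes "A \<in> car Xbar" "B \<in> car Xbar"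
    and C: "\<And>w. w \<in> W \<Longrightarrow> C w = f (A w) (B w)"
    and f: "\<And>a A B. a \<in> labels S \<Longrightarrow> A \<in> car X \<Longrightarrow> B \<in> car X \<Longrightarrow> act S a (f A B) = f (act S a A) (act S a B)"
  shows "finite (exc C)"
proof (rule finite_subset)
  show "exc C \<subseteq> exc A \<union> exc B"
    using assms bar_app by (auto simp: exc_def C f)
  show "finite (exc A \<union> exc B)" using assms by (simp add: bar_car)
qed

lemma bar_closed:
  assumes AB: "A \<in> car Xbar" "B \<in> car Xbar"
  shows "meet Xbar A B \<in> car Xbar" "join Xbar A B \<in> car Xbar" "diff Xbar A B \<in> car Xbar"
proof -
  have "finite (exc (meet Xbar A B))" "finite (exc (join Xbar A B))" "finite (exc (diff Xbar A B))"
    by (rule exc_op[OF AB], simp add: bar_ops, simp add: act_simps)+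
  then show "meet Xbar A B \<in> car Xbar" "join Xbar A B \<in> car Xbar" "diff Xbar A B \<in> car Xbar"
    using AB by (auto simp: bar_car bar_ext bar_ops Rw_closed)
qed

lemma bar_bot_closed: "bot Xbar \<in> car Xbar"
proof -
  have "exc (bot Xbar) = {}" by (auto simp: exc_def bar_ops act_simps)
  then show ?thesis
    using ideal_bot[OF Rw_ideal] by (auto simp: bar_car bar_ext bar_ops)
qed

lemma bar_ble:
  assumes "A \<in> car Xbar" "B \<in> car Xbar"
  shows "ble Xbar A B \<longleftrightarrow> (\<forall>w\<in>W. ble X (A w) (B w))"
proof
  assume "ble Xbar A B"
  then have "meet Xbar A B w = A w" for w by (simp add: ble_def)
  then show "\<forall>w\<in>W. ble X (A w) (B w)" by (simp add: ble_def flip: bar_ops(1))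
next
  assume "\<forall>w\<in>W. ble X (A w) (B w)"
  then show "ble Xbar A B"
    unfolding ble_def using assms by (intro bar_eqI) (simp_all add: bar_closed bar_ops)
qed

lemma bar_bool_alg: "bool_alg Xbar"
proof
  show "bot Xbar \<in> car Xbar" by (rule bar_bot_closed)
  fix A B C
  assume A: "A \<in> car Xbar"
  show "ble Xbar (bot Xbar) A"
    using A bar_bot_closed by (simp add: bar_ble bar_ops bot_least bar_app)
  assume B: "B \<in> car Xbar"
  show "meet Xbar A B \<in> car Xbar" "join Xbar A B \<in> car Xbar" "diff Xbar A B \<in> car Xbar"
    using A B by (rule bar_closed)+
  show "meet Xbar A B = meet Xbar B A" "join Xbar A B = join Xbar B A"
    "meet Xbar A (join Xbar A B) = A" "join Xbar A (meet Xbar A B) = A"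
    "meet Xbar (diff Xbar A B) (meet Xbar A B) = bot Xbar"
    "join Xbar (diff Xbar A B) (meet Xbar A B) = A"
    using A B bar_bot_closed
    by (intro bar_eqI; simp add: bar_closed bar_ops bar_app meet_comm join_comm meet_join_absorb
        join_meet_absorb diff_disjoint diff_cover)+
  assume C: "C \<in> car Xbar"
  show "meet Xbar (meet Xbar A B) C = meet Xbar A (meet Xbar B C)"
    "join Xbar (join Xbar A B) C = join Xbar A (join Xbar B C)"
    "meet Xbar A (join Xbar B C) = join Xbar (meet Xbar A B) (meet Xbar A C)"
    using A B C by (intro bar_eqI; simp add: bar_closed bar_ops bar_app meet_assoc join_assoc
        meet_join_distrib)+
qed

lemma bar_ideal_iff:
  "A \<in> bar_ideal S \<longleftrightarrow> A \<in> car Xbar \<and> (\<forall>w\<in>W. A w \<in> Jdl S) \<and> finite {w \<in> W. A w \<noteq> bot X}"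
  by (auto simp: bar_ideal_def)

lemma bar_ideal_bool_ideal: "bool_ideal Xbar (bar_ideal S)"
  unfolding bool_ideal_def
proof (intro conjI ballI impI)
  show "bar_ideal S \<subseteq> car Xbar" by (auto simp: bar_ideal_iff)
  have "finite {w \<in> W. bot Xbar w \<noteq> bot X}"
    by (rule finite_subset[of _ "{}"]) (auto simp: bar_ops)
  then have "bot Xbar \<in> bar_ideal S"
    unfolding bar_ideal_iff using ideal_bot[OF Jdl_bool_ideal]
    by (simp add: bar_bot_closed bar_ops(4))
  then show "bar_ideal S \<noteq> {}" by auto
  fix A assume A: "A \<in> bar_ideal S"
  show "join Xbar A B \<in> bar_ideal S" if B: "B \<in> bar_ideal S" for B
  proof -
    have "{w \<in> W. join Xbar A B w \<noteq> bot X} \<subseteq> {w \<in> W. A w \<noteq> bot X} \<union> {w \<in> W. B w \<noteq> bot X}"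
      by (auto simp: bar_ops join_bot bot_closed)
    then have "finite {w \<in> W. join Xbar A B w \<noteq> bot X}"
      by (rule finite_subset) (use A B in \<open>simp add: bar_ideal_iff\<close>)
    then show ?thesis
      using A B ideal_join[OF Jdl_bool_ideal] by (simp add: bar_ideal_iff bar_closed bar_ops)
  qed
  show "B \<in> bar_ideal S" if B: "B \<in> car Xbar" "ble Xbar B A" for B
  proof -
    have A': "\<And>w. w \<in> W \<Longrightarrow> A w \<in> Jdl S" "finite {w \<in> W. A w \<noteq> bot X}"
      using A by (simp_all add: bar_ideal_iff)
    have le: "\<And>w. w \<in> W \<Longrightarrow> ble X (B w) (A w)" using A B by (simp add: bar_ideal_iff bar_ble)
    then have "B w \<in> Jdl S" if "w \<in> W" for w
      using ideal_down[OF Jdl_bool_ideal A'(1)[OF that] bar_app[OF B(1) that]] that by simp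
    moreover have "B w = bot X" if w: "w \<in> W" "A w = bot X" for w
      using le[OF w(1)] ble_bot[OF bar_app[OF B(1) w(1)]] w by simp
    then have "{w \<in> W. B w \<noteq> bot X} \<subseteq> {w \<in> W. A w \<noteq> bot X}" by blast
    then have "finite {w \<in> W. B w \<noteq> bot X}" using A'(2) finite_subset by blast
    ultimately show ?thesis using B by (simp add: bar_ideal_iff)
  qed
qed

lemma bar_act_app: "w \<in> W \<Longrightarrow> bar_act S a A w = A (a # w)"
  by (simp add: bar_act_def)

lemma exc_bar_act: "a \<in> labels S \<Longrightarrow> exc (bar_act S a A) = {(w, b). (a # w, b) \<in> exc A}"
  by (auto simp: exc_def bar_act_app)

text \<open>The exceptional pairs of the shift are the preimage of those of \<open>A\<close> under
  the injective map that prepends \<open>a\<close> to the word.\<close>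

lemma bar_act_closed:
  assumes a: "a \<in> labels S" and A: "A \<in> car Xbar"
  shows "bar_act S a A \<in> car Xbar"
proof -
  have "exc (bar_act S a A) = (\<lambda>(w, b). (a # w, b)) -` exc A"
    by (auto simp: exc_bar_act[OF a])
  moreover have "finite \<dots>"
    using A by (intro finite_vimageI) (auto simp: bar_car inj_def)
  moreover have "A (a # w) \<in> Rw S w" if "w \<in> W" for w
    using Rw_append[of "[a]" w "A (a # w)"] a A that by (auto simp: bar_car)
  ultimately show ?thesis
    by (auto simp: bar_car bar_act_app) (simp add: bar_act_def)
qed

lemma bar_act_hom:
  assumes a: "a \<in> labels S"
  shows "bar_act S a (meet Xbar A B) = meet Xbar (bar_act S a A) (bar_act S a B)"
    "bar_act S a (join Xbar A B) = join Xbar (bar_act S a A) (bar_act S a B)"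
    "bar_act S a (diff Xbar A B) = diff Xbar (bar_act S a A) (bar_act S a B)"
    "bar_act S a (bot Xbar) = bot Xbar"
  using a by (auto simp: bar_act_def bar_alg_def prod_alg_def fun_eq_iff)

lemma bar_act_ideal:
  assumes a: "a \<in> labels S" and A: "A \<in> bar_ideal S"
  shows "bar_act S a A \<in> bar_ideal S"
proof -
  have "{w \<in> W. bar_act S a A w \<noteq> bot X} = Cons a -` {w \<in> W. A w \<noteq> bot X}"
    using a by (auto simp: bar_act_app)
  moreover have "finite \<dots>"
    using A by (intro finite_vimageI) (auto simp: bar_ideal_iff inj_def)
  ultimately show ?thesis
    using a A by (auto simp: bar_ideal_iff bar_act_closed bar_act_app)
qed

text \<open>A representative of \<open>iota_word S g A\<close>. Working with families instead of
  classes makes checks componentwise.\<close>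

definition iota_bar :: "'l list \<Rightarrow> 'b \<Rightarrow> 'l list \<Rightarrow> 'b" where
  "iota_bar g A = (\<lambda>w\<in>W. if prefix g w then act_word S (drop (length g) w) A else bot X)"

abbreviation emb :: "'b \<Rightarrow> 'l list \<Rightarrow> 'b" where "emb \<equiv> iota_bar []"

lemma iota_word_eq: "iota_word S g A = ext_q S (iota_bar g A)"
  by (simp add: iota_word_def iota_bar_def)

lemma emb_app: "w \<in> W \<Longrightarrow> emb A w = act_word S w A"
  by (simp add: iota_bar_def)

lemma iota_bar_closed:
  assumes g: "g \<in> W" and A: "A \<in> Rw S g"
  shows "iota_bar g A \<in> car Xbar"
proof -
  \<comment> \<open>The rule can fail only at the step that completes \<open>g\<close>. For
    \<open>g = []\<close> there is no such step, and the unspecified \<open>last []\<close> merely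
    enlarges the bound.\<close>
  have "exc (iota_bar g A) \<subseteq> {(butlast g, last g)}"
  proof clarify
    fix w a assume "(w, a) \<in> exc (iota_bar g A)"
    then have wa: "w \<in> W" "a \<in> labels S" "iota_bar g A (w @ [a]) \<noteq> act S a (iota_bar g A w)"
      by (auto simp: exc_def)
    have "\<not> prefix g w"
      using wa by (auto simp: iota_bar_def act_word_append prefix_def)
    moreover from this have "prefix g (w @ [a])"
      using wa by (auto simp: iota_bar_def act_simps split: if_splits)
    ultimately have "g = w @ [a]" by (metis prefix_snoc)
    then show "w = butlast g \<and> a = last g" by simp
  qed
  then have "finite (exc (iota_bar g A))" by (rule finite_subset) simp
  moreover have "iota_bar g A w \<in> Rw S w" if w: "w \<in> W" for w
  proof (cases "prefix g w")
    case True
    then obtain v where v: "w = g @ v" by (auto simp: prefix_def)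
    with w have "v \<in> W" by simp
    with Rw_act[OF g this A] show ?thesis using w by (simp add: iota_bar_def v)
  next
    case False
    then show ?thesis using w ideal_bot[OF Rw_ideal] by (simp add: iota_bar_def)
  qed
  ultimately show ?thesis by (auto simp: bar_car) (simp add: iota_bar_def)
qed

lemma Rw_Nil: "Rw S [] = car X"
  using ble_refl by (auto simp: Rw_def)

lemma emb_closed: "A \<in> car X \<Longrightarrow> emb A \<in> car Xbar"
  by (rule iota_bar_closed) (simp_all add: Rw_Nil)

lemma emb_hom:
  "A \<in> car X \<Longrightarrow> B \<in> car X \<Longrightarrow> emb (meet X A B) = meet Xbar (emb A) (emb B)"
  "A \<in> car X \<Longrightarrow> B \<in> car X \<Longrightarrow> emb (join X A B) = join Xbar (emb A) (emb B)"
  "A \<in> car X \<Longrightarrow> B \<in> car X \<Longrightarrow> emb (diff X A B) = diff Xbar (emb A) (emb B)"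
  "emb (bot X) = bot Xbar"
  by (rule bar_eqI; simp add: emb_closed bar_closed bar_bot_closed meet_closed join_closed diff_closed
      bot_closed bar_ops emb_app act_word_hom)+

lemma bar_act_emb: "a \<in> labels S \<Longrightarrow> bar_act S a (emb A) = emb (act S a A)"
  by (auto simp: bar_act_def iota_bar_def fun_eq_iff)

lemma bar_act_iota_bar:
  "a \<in> labels S \<Longrightarrow> bar_act S a (iota_bar (b # g) A) = (if a = b then iota_bar g A else bot Xbar)"
  by (auto simp: bar_act_def iota_bar_def fun_eq_iff bar_alg_def prod_alg_def)

section \<open>Domination, rank and branches of a family\<close>

lemma bar_determined:
  assumes "\<And>w a. w \<in> W \<Longrightarrow> a \<in> labels S \<Longrightarrow> (w, a) \<notin> exc A"
    and w: "w \<in> W"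
  shows "A w = act_word S w (A [])"
  using w
proof (induct w rule: rev_induct)
  case (snoc a w)
  then show ?case using assms(1)[of w a] by (simp add: exc_def act_word_append)
qed simp

text \<open>Bounds propagate along nonexceptional steps by monotonicity, so finitely many local
  bounds suffice, and their join is still in the ideal \<open>I\<close>.\<close>

lemma bar_dominated:
  assumes A: "A \<in> car Xbar" and I: "bool_ideal X I"
    and loc: "\<And>w. w \<in> W \<Longrightarrow> \<exists>D\<in>I. ble X (A w) (act_word S w D)"
  shows "\<exists>D\<in>I. ble Xbar A (emb D)"
proof -
  \<comment> \<open>The root and the words reached by exceptional pairs: at every other word
    \<open>A\<close> continues its value at the preceding word.\<close>
  define V where "V = insert [] ((\<lambda>(w, a). w @ [a]) ` exc A)"
  have Icar: "\<And>D. D \<in> I \<Longrightarrow> D \<in> car X" using ideal_car[OF I] .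
  have "\<exists>D\<in>I. \<forall>w\<in>V'. ble X (A w) (act_word S w D)" if "finite V'" "V' \<subseteq> W" for V'
    using that
  proof induct
    case empty
    show ?case by (rule bexI[OF _ ideal_bot[OF I]]) simp
  next
    case (insert v V')
    from insert have "\<exists>D\<in>I. \<forall>w\<in>V'. ble X (A w) (act_word S w D)" by simp
    moreover from insert have "\<exists>D\<in>I. ble X (A v) (act_word S v D)" by (intro loc) simp
    ultimately obtain D D' where D: "D \<in> I" "\<forall>w\<in>V'. ble X (A w) (act_word S w D)"
      "D' \<in> I" "ble X (A v) (act_word S v D')"
      by blast
    have mono: "ble X (act_word S w D) (act_word S w (join X D D'))"
      "ble X (act_word S w D') (act_word S w (join X D D'))" if "w \<in> W" for w
      using that Icar[OF D(1)] Icar[OF D(3)]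
      by (simp_all add: act_word_mono join_le1 join_le2 join_closed)
    have cl: "\<And>w. w \<in> W \<Longrightarrow> act_word S w D \<in> car X" "\<And>w. w \<in> W \<Longrightarrow> act_word S w D' \<in> car X"
      "\<And>w. w \<in> W \<Longrightarrow> act_word S w (join X D D') \<in> car X"
      using Icar[OF D(1)] Icar[OF D(3)] by (simp_all add: act_word_closed join_closed)
    have "ble X (A w) (act_word S w (join X D D'))" if "w \<in> insert v V'" for w
    proof -
      have w: "w \<in> W" using that insert(4) by blast
      have "ble X (A w) (act_word S w D) \<or> ble X (A w) (act_word S w D')"
        using that D(2,4) by blast
      then show ?thesis
        using ble_trans[OF bar_app[OF A w] cl(1)[OF w] cl(3)[OF w] _ mono(1)[OF w]]
          ble_trans[OF bar_app[OF A w] cl(2)[OF w] cl(3)[OF w] _ mono(2)[OF w]] by blast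
    qed
    then show ?case by (intro bexI[of _ "join X D D'"] ideal_join[OF I D(1,3)] ballI)
  qed
  moreover have "finite V" using A by (simp add: V_def bar_car)
  moreover have "V \<subseteq> W" by (auto simp: V_def exc_def)
  ultimately obtain D where D: "D \<in> I" "\<forall>w\<in>V. ble X (A w) (act_word S w D)" by blast
  have "ble X (A w) (act_word S w D)" if "w \<in> W" for w
    using that
  proof (induct w rule: rev_induct)
    case Nil
    then show ?case using D(2) by (simp add: V_def)
  next
    case (snoc a w)
    show ?case
    proof (cases "(w, a) \<in> exc A")
      case True
      then have "w @ [a] \<in> V" by (force simp: V_def)
      then show ?thesis using D(2) by blast
    next
      case False
      then have "A (w @ [a]) = act S a (A w)" using snoc by (simp add: exc_def)
      then show ?thesis
        using snoc Icar[OF D(1)] A by (simp add: act_word_append act_mono bar_app act_word_closed)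
    qed
  qed
  then have "ble Xbar A (emb D)"
    using Icar[OF D(1)] A by (simp add: bar_ble emb_closed emb_app)
  with D(1) show ?thesis by blast
qed

lemma bar_dominated_car: "A \<in> car Xbar \<Longrightarrow> \<exists>D\<in>car X. ble Xbar A (emb D)"
  by (rule bar_dominated[OF _ car_ideal]) (simp_all add: bar_car Rw_def)

text \<open>Membership in \<open>Iw S (a # w)\<close> is precisely a local bound by an element of
  \<open>Idl S a\<close>.\<close>

lemma bar_dominated_Idl:
  assumes "a \<in> labels S" "A \<in> car Xbar" "\<And>w. w \<in> W \<Longrightarrow> A w \<in> Iw S (a # w)"
  shows "\<exists>D\<in>Idl S a. ble Xbar A (emb D)"
proof (rule bar_dominated[OF assms(2) Idl_ideal[OF assms(1)]])
  show "\<exists>D\<in>Idl S a. ble X (A w) (act_word S w D)" if "w \<in> W" for w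
    using assms(3)[OF that] by simp
qed

text \<open>The recursion depth. The inequality is strict so that rank 0 means no exceptional pair
  at all; each shift lowers the bound by one.\<close>

definition rank_le :: "nat \<Rightarrow> ('l list \<Rightarrow> 'b) \<Rightarrow> bool" where
  "rank_le n A \<longleftrightarrow> (\<forall>w a. (w, a) \<in> exc A \<longrightarrow> length w < n)"

lemma rank_le_exists: "A \<in> car Xbar \<Longrightarrow> \<exists>n. rank_le n A"
proof -
  assume "A \<in> car Xbar"
  then have "finite ((\<lambda>(w, a). length w) ` exc A)" by (simp add: bar_car)
  then obtain n where n: "\<forall>m\<in>(\<lambda>(w, a). length w) ` exc A. m < n"
    unfolding finite_nat_set_iff_bounded by blast
  then have "length w < n" if "(w, a) \<in> exc A" for w a
    using that by force
  then show ?thesis unfolding rank_le_def by blast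
qed

lemma rank_le_mono: "rank_le m A \<Longrightarrow> m \<le> n \<Longrightarrow> rank_le n A"
  unfolding rank_le_def using less_le_trans by blast

lemma rank_le_0:
  assumes "A \<in> car Xbar" "rank_le 0 A"
  shows "A = emb (A [])"
proof (rule bar_eqI[OF assms(1) emb_closed[OF bar_app_Nil[OF assms(1)]]])
  fix w assume w: "w \<in> W"
  then have "A w = act_word S w (A [])"
    by (rule bar_determined[rotated]) (use assms(2) in \<open>auto simp: rank_le_def\<close>)
  with w show "A w = emb (A []) w" by (simp add: emb_app)
qed

lemma rank_le_Suc: "a \<in> labels S \<Longrightarrow> rank_le (Suc n) A \<Longrightarrow> rank_le n (bar_act S a A)"
  by (auto simp: rank_le_def exc_bar_act)

text \<open>The letters below which \<open>A\<close> departs from \<open>emb (A [])\<close>; the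
  correction terms of \<open>P\<close> sit there.\<close>

definition branches :: "('l list \<Rightarrow> 'b) \<Rightarrow> 'l set" where
  "branches A = {a \<in> labels S. bar_act S a A \<noteq> emb (act S a (A []))}"

lemma branches_finite:
  assumes A: "A \<in> car Xbar"
  shows "finite (branches A)"
proof (rule finite_subset)
  \<comment> \<open>\<open>hd (w @ [a])\<close> is the first letter of the word that an exceptional
    pair reaches, also when \<open>w\<close> is empty. A letter not obtained this way carries no
    exception below it.\<close>
  show "branches A \<subseteq> (\<lambda>(w, a). hd (w @ [a])) ` exc A"
  proof
    fix a assume "a \<in> branches A"
    then have a: "a \<in> labels S" "bar_act S a A \<noteq> emb (act S a (A []))" by (auto simp: branches_def)
    show "a \<in> (\<lambda>(w, a). hd (w @ [a])) ` exc A"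
    proof (rule ccontr)
      assume neg: "\<not> ?thesis"
      have "A [a] = act S a (A [])" "\<And>w b. (a # w, b) \<notin> exc A"
        using neg a(1) by (force simp: exc_def)+
      then have "exc (bar_act S a A) = {}" "bar_act S a A [] = act S a (A [])"
        using a(1) by (auto simp: exc_bar_act bar_act_app)
      then have "bar_act S a A = emb (act S a (A []))"
        using rank_le_0[OF bar_act_closed[OF a(1) A]] by (simp add: rank_le_def)
      with a(2) show False by simp
    qed
  qed
  show "finite ((\<lambda>(w, a). hd (w @ [a])) ` exc A)" using A by (simp add: bar_car)
qed

lemma branches_emb: "branches (emb A) = {}"
proof -
  have "emb A [] = A" by (simp add: emb_app)
  then show ?thesis unfolding branches_def using bar_act_emb by fastforce
qed

lemma ext_q_eq_iff:
  assumes "A \<in> car Xbar" "B \<in> car Xbar"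
  shows "ext_q S A = ext_q S B \<longleftrightarrow> diff Xbar A B \<in> bar_ideal S \<and> diff Xbar B A \<in> bar_ideal S"
  unfolding ext_q_def using bool_alg.quot_eq_iff[OF bar_bool_alg bar_ideal_bool_ideal assms] .

text \<open>Below a nonempty element of \<open>Jdl S\<close> there are nonempty images along words of every length.\<close>

lemma emb_ideal_bot:
  assumes A: "A \<in> car X" "emb A \<in> bar_ideal S"
  shows "A = bot X"
proof (rule ccontr)
  assume "A \<noteq> bot X"
  have J: "act_word S w A \<in> Jdl S" if "w \<in> W" for w
    using A that by (auto simp: bar_ideal_iff emb_app dest: bspec[of _ _ w])
  have "\<exists>w\<in>W. length w = n \<and> act_word S w A \<noteq> bot X" for n
  proof (induct n)
    case 0
    show ?case using \<open>A \<noteq> bot X\<close> by (auto intro!: bexI[of _ "[]"])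
  next
    case (Suc n)
    then obtain w where w: "w \<in> W" "length w = n" "act_word S w A \<noteq> bot X" by blast
    then have "Delta S (act_word S w A) \<noteq> {}"
      using J[OF w(1)] Jdl_regular ble_refl[OF act_word_closed[OF w(1) A(1)]]
      by (auto simp: regular_def)
    then obtain a where "a \<in> labels S" "act S a (act_word S w A) \<noteq> bot X"
      by (auto simp: Delta_def)
    then show ?case using w by (intro bexI[of _ "w @ [a]"]) (auto simp: act_word_append)
  qed
  then obtain f where f: "\<And>n. f n \<in> W" "\<And>n. length (f n) = n" "\<And>n. act_word S (f n) A \<noteq> bot X"
    by metis
  then have "range f \<subseteq> {w \<in> W. emb A w \<noteq> bot X}" by (auto simp: emb_app)
  then have "finite (range f)" using A(2) finite_subset by (auto simp: bar_ideal_iff)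
  moreover have "inj f" using f(2) by (metis injI)
  ultimately show False using finite_imageD by blast
qed

text \<open>If two elements have the same class, both their differences embed into
  \<open>bar_ideal S\<close> and are empty by \<open>emb_ideal_bot\<close>.\<close>

lemma inj_on_iota: "inj_on (iota S) (car X)"
proof (rule inj_onI)
  fix A B assume AB: "A \<in> car X" "B \<in> car X" "iota S A = iota S B"
  then have "emb (diff X A B) \<in> bar_ideal S" "emb (diff X B A) \<in> bar_ideal S"
    by (simp_all add: iota_def iota_word_eq ext_q_eq_iff emb_closed emb_hom)
  then have "diff X A B = bot X" "diff X B A = bot X"
    using AB emb_ideal_bot diff_closed by blast+
  then show "A = B"
    using AB by (intro char_eqI) (auto simp: eq_bot_char diff_closed char_simps)
qed

end

context relative_gbds
begin

declare meet_closed [simp] join_closed [simp] diff_closed [simp] bot_closed [simp]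
  act_simps(1) [simp] bar_closed [simp] bar_bot_closed [simp] bar_act_closed [simp]
  bar_app_Nil [simp] emb_closed [simp] act_Idl [simp]

lemma emb_Nil [simp]: "emb A [] = A"
  by (simp add: emb_app)

lemma bar_ops_Nil [simp]:
  "meet Xbar A B [] = meet X (A []) (B [])" "join Xbar A B [] = join X (A []) (B [])"
  "diff Xbar A B [] = diff X (A []) (B [])" "bot Xbar [] = bot X"
  by (simp_all add: bar_ops)

lemma bar_act_ble:
  "a \<in> labels S \<Longrightarrow> A \<in> car Xbar \<Longrightarrow> B \<in> car Xbar \<Longrightarrow> ble Xbar A B \<Longrightarrow>
   ble Xbar (bar_act S a A) (bar_act S a B)"
  by (simp add: ble_def flip: bar_act_hom)

lemma ble_emb_Nil: "A \<in> car Xbar \<Longrightarrow> D \<in> car X \<Longrightarrow> ble Xbar A (emb D) \<Longrightarrow> ble X (A []) D"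
  using bar_ble[of A "emb D"] by force

lemma ble_emb_act:
  "a \<in> labels S \<Longrightarrow> A \<in> car Xbar \<Longrightarrow> D \<in> car X \<Longrightarrow> ble Xbar A (emb D) \<Longrightarrow>
   ble Xbar (bar_act S a A) (emb (act S a D))"
  using bar_act_ble[of a A "emb D"] by (simp add: bar_act_emb)

text \<open>An arbitrary bound; \<open>PP_unfold\<close> shows that the choice does not affect the
  projections.\<close>

definition dom :: "('l list \<Rightarrow> 'b) \<Rightarrow> 'b" where
  "dom A = (SOME D. D \<in> car X \<and> ble Xbar A (emb D))"

lemma dom: "A \<in> car Xbar \<Longrightarrow> dom A \<in> car X" "A \<in> car Xbar \<Longrightarrow> ble Xbar A (emb (dom A))"
proof -
  assume "A \<in> car Xbar"
  then have "\<exists>D. D \<in> car X \<and> ble Xbar A (emb D)" using bar_dominated_car by blast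
  then show "dom A \<in> car X" "ble Xbar A (emb (dom A))"
    unfolding dom_def by (rule someI2_ex; blast)+
qed

lemma dom_common:
  assumes "A \<in> car Xbar" "B \<in> car Xbar"
  obtains D where "D \<in> car X" "ble Xbar A (emb D)" "ble Xbar B (emb D)"
proof
  interpret bar: bool_alg Xbar by (rule bar_bool_alg)
  let ?D = "join X (dom A) (dom B)"
  have "ble Xbar (emb (dom A)) (emb ?D)" "ble Xbar (emb (dom B)) (emb ?D)"
    using assms dom by (simp_all add: emb_hom bar.join_le1 bar.join_le2)
  then show "?D \<in> car X" "ble Xbar A (emb ?D)" "ble Xbar B (emb ?D)"
    using assms dom bar.ble_trans[of A "emb (dom A)" "emb ?D"] bar.ble_trans[of B "emb (dom B)" "emb ?D"]
    by simp_all
qed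

end

section \<open>Projections of families\<close>

text \<open>A representation of the relations in any \<open>star_ring\<close>. \<open>s_p\<close> is
  not one of the defining relations: in the universal algebra it is \<open>u_s_p\<close>, a
  consequence of definiteness.\<close>

locale gbds_rep = relative_gbds S for S :: "('b, 'l) bds" +
  fixes p :: "'b \<Rightarrow> 'a :: star_ring" and s :: "'l \<Rightarrow> 'b \<Rightarrow> 'a"
  assumes p_star: "A \<in> car X \<Longrightarrow> star (p A) = p A"
    and p_bot: "p (bot X) = 0"
    and p_meet: "A \<in> car X \<Longrightarrow> B \<in> car X \<Longrightarrow> p (meet X A B) = p A * p B"
    and p_join: "A \<in> car X \<Longrightarrow> B \<in> car X \<Longrightarrow> p (join X A B) = p A + p B - p (meet X A B)"
    and p_s: "A \<in> car X \<Longrightarrow> a \<in> labels S \<Longrightarrow> B \<in> Idl S a \<Longrightarrow> p A * s a B = s a B * p (act S a A)"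
    and s_s: "a \<in> labels S \<Longrightarrow> B \<in> Idl S a \<Longrightarrow> b \<in> labels S \<Longrightarrow> C \<in> Idl S b \<Longrightarrow>
      star (s a B) * s b C = (if a = b then p (meet X B C) else 0)"
    and s_p: "A \<in> car X \<Longrightarrow> a \<in> labels S \<Longrightarrow> B \<in> Idl S a \<Longrightarrow> s a B * p A = s a (meet X B A)"
    and p_sum: "A \<in> Jdl S \<Longrightarrow> p A = (\<Sum>a\<in>Delta S A. s a (act S a A) * star (s a (act S a A)))"
begin

lemma p_commute: "A \<in> car X \<Longrightarrow> B \<in> car X \<Longrightarrow> p A * p B = p B * p A"
  by (metis p_meet meet_comm)

lemma p_ble:
  assumes "A \<in> car X" "B \<in> car X" "ble X A B"
  shows "p A * p B = p A" "p B * p A = p A"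
  using assms p_meet[of A B] p_commute[of A B] by (simp_all add: ble_def)

lemma p_s_star:
  assumes "A \<in> car X" "a \<in> labels S" "B \<in> Idl S a"
  shows "star (s a B) * p A = p (act S a A) * star (s a B)"
  using arg_cong[OF p_s[OF assms], of star] assms by (simp add: star_mult p_star)

lemma s_p_star:
  assumes "A \<in> car X" "a \<in> labels S" "B \<in> Idl S a"
  shows "p A * star (s a B) = star (s a (meet X B A))"
  using arg_cong[OF s_p[OF assms], of star] assms by (simp add: star_mult p_star)

lemma s_meet_commute:
  assumes "a \<in> labels S" "B \<in> Idl S a" "C \<in> Idl S a"
  shows "s a B * p C = s a C * p B"
  using assms by (simp add: s_p Idl_car meet_comm[of B C])

text \<open>Transport back along the letter \<open>a\<close>. On elements absorbed by
  \<open>p C\<close> from both sides it is multiplicative.\<close>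

definition conj_s :: "'l \<Rightarrow> 'b \<Rightarrow> 'a \<Rightarrow> 'a" where
  "conj_s a C z = s a C * z * star (s a C)"

lemma conj_s_add: "conj_s a C (y + z) = conj_s a C y + conj_s a C z"
  and conj_s_diff: "conj_s a C (y - z) = conj_s a C y - conj_s a C z"
  and conj_s_0: "conj_s a C 0 = 0"
  and conj_s_star: "star (conj_s a C z) = conj_s a C (star z)"
  by (simp_all add: conj_s_def algebra_simps star_mult)

lemma conj_s_p:
  assumes "A \<in> car X" "a \<in> labels S" "C \<in> Idl S a"
  shows "p A * conj_s a C z = conj_s a C (p (act S a A) * z)"
    "conj_s a C z * p A = conj_s a C (z * p (act S a A))"
proof -
  have "p A * conj_s a C z = (p A * s a C) * z * star (s a C)"
    by (simp add: conj_s_def mult.assoc)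
  then show "p A * conj_s a C z = conj_s a C (p (act S a A) * z)"
    using assms by (simp add: conj_s_def p_s mult.assoc)
  have "conj_s a C z * p A = s a C * z * (star (s a C) * p A)"
    by (simp add: conj_s_def mult.assoc)
  then show "conj_s a C z * p A = conj_s a C (z * p (act S a A))"
    using assms by (simp add: conj_s_def p_s_star mult.assoc)
qed

lemma conj_s_mult:
  assumes "a \<in> labels S" "C \<in> Idl S a" "b \<in> labels S" "D \<in> Idl S b"
  shows "conj_s a C y * conj_s b D z = (if a = b then s a C * y * p (meet X C D) * z * star (s a D) else 0)"
proof -
  have "conj_s a C y * conj_s b D z = s a C * y * (star (s a C) * s b D) * z * star (s b D)"
    by (simp add: conj_s_def mult.assoc)
  then show ?thesis using assms by (simp add: s_s)
qed

text \<open>\<open>s a D * z = s a D * p D' * z = s a D' * p D * z = s a D' * z\<close>, where the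
  middle step holds because both sides restrict to the meet of \<open>D\<close> and
  \<open>D'\<close>; likewise on the right.\<close>

lemma conj_s_change:
  assumes a: "a \<in> labels S" and D: "D \<in> Idl S a" "D' \<in> Idl S a"
    and z: "p D * z = z" "z * p D = z" "p D' * z = z" "z * p D' = z"
  shows "conj_s a D z = conj_s a D' z"
proof -
  have "s a D * z = s a D' * z"
    using s_meet_commute[OF a D] z(1,3) by (metis mult.assoc)
  moreover have "z * star (s a D) = z * star (s a D')"
    using arg_cong[OF s_meet_commute[OF a D], of star] z(2,4) a D
    by (simp add: star_mult p_star Idl_car) (metis mult.assoc)
  ultimately show ?thesis unfolding conj_s_def by (metis mult.assoc)
qed

text \<open>
  \<open>P A\<close> below is to become the image of \<open>p\<^bsub>q(A)\<^esub>\<close>. Since \<open>A\<close> and \<open>emb (A [])\<close> differ in finitely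
  many branches only, that image is forced to be \<open>p\<^bsub>A []\<^esub>\<close> plus a finite correction, which applies
  the same recipe to the shifted families; \<open>PP n\<close> stops the recursion at depth \<open>n\<close>.
\<close>

primrec PP :: "nat \<Rightarrow> ('l list \<Rightarrow> 'b) \<Rightarrow> 'a" where
  "PP 0 A = p (A [])"
| "PP (Suc n) A = p (A []) + (\<Sum>a\<in>branches A.
     conj_s a (act S a (dom A)) (PP n (bar_act S a A) - p (act S a (A []))))"

lemma PP_emb: "C \<in> car X \<Longrightarrow> PP n (emb C) = p C"
  by (cases n) (simp_all add: branches_emb)

lemma branches_labels: "a \<in> branches A \<Longrightarrow> a \<in> labels S"
  by (simp add: branches_def)

text \<open>Moving \<open>p C\<close> past \<open>conj_s a\<close> turns it into
  \<open>p (act S a C)\<close>, and \<open>act S a C\<close> bounds the shifted family; so the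
  induction needs \<open>A\<close> and \<open>C\<close> arbitrary.\<close>

lemma PP_absorb:
  assumes "A \<in> car Xbar" "C \<in> car X" "ble Xbar A (emb C)"
  shows "p C * PP n A = PP n A" "PP n A * p C = PP n A"
proof -
  have "p C * PP n A = PP n A \<and> PP n A * p C = PP n A"
    using assms
  proof (induct n arbitrary: A C)
    case 0
    then show ?case using p_ble[of "A []" C] ble_emb_Nil by simp
  next
    case (Suc n)
    define t where "t a = conj_s a (act S a (dom A)) (PP n (bar_act S a A) - p (act S a (A [])))" for a
    have "p C * t a = t a \<and> t a * p C = t a" if "a \<in> branches A" for a
    proof -
      have a: "a \<in> labels S" using that by (rule branches_labels)
      have "p (act S a C) * PP n (bar_act S a A) = PP n (bar_act S a A) \<and>
          PP n (bar_act S a A) * p (act S a C) = PP n (bar_act S a A)"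
        using Suc a by (simp add: ble_emb_act)
      moreover have "ble X (act S a (A [])) (act S a C)"
        using Suc a by (simp add: act_mono ble_emb_Nil)
      ultimately show ?thesis
        using Suc(2,3) a p_ble[of "act S a (A [])" "act S a C"]
        by (simp add: t_def conj_s_p dom algebra_simps)
    qed
    moreover have "p C * p (A []) = p (A [])" "p (A []) * p C = p (A [])"
      using Suc p_ble[of "A []" C] ble_emb_Nil by simp_all
    ultimately show ?case
      by (simp add: distrib_left distrib_right sum_distrib_left sum_distrib_right flip: t_def)
  qed
  then show "p C * PP n A = PP n A" "PP n A * p C = PP n A" by simp_all
qed

lemma PP_star: "A \<in> car Xbar \<Longrightarrow> star (PP n A) = PP n A"
proof (induct n arbitrary: A)
  case (Suc n)
  then show ?case
    by (simp add: star_add star_sum star_diff conj_s_star p_star branches_labels)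
qed (simp add: p_star)

lemma PP_diff_absorb:
  assumes "a \<in> labels S" "A \<in> car Xbar" "D \<in> car X" "ble Xbar A (emb D)"
  shows "p (act S a D) * (PP n (bar_act S a A) - p (act S a (A []))) = PP n (bar_act S a A) - p (act S a (A []))"
    "(PP n (bar_act S a A) - p (act S a (A []))) * p (act S a D) = PP n (bar_act S a A) - p (act S a (A []))"
  using assms PP_absorb[of "bar_act S a A" "act S a D" n] p_ble[of "act S a (A [])" "act S a D"]
  by (simp_all add: ble_emb_act act_mono ble_emb_Nil algebra_simps)

text \<open>Letters outside \<open>branches A\<close> contribute \<open>0\<close>, and
  \<open>conj_s_change\<close> replaces \<open>dom A\<close> by any bound. With a common
  \<open>F\<close> and \<open>D\<close>, expansions of several families can be compared term by
  term.\<close>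

lemma PP_unfold:
  assumes A: "A \<in> car Xbar" and F: "finite F" "branches A \<subseteq> F" "F \<subseteq> labels S"
    and D: "D \<in> car X" "ble Xbar A (emb D)"
  shows "PP (Suc n) A = p (A []) +
    (\<Sum>a\<in>F. conj_s a (act S a D) (PP n (bar_act S a A) - p (act S a (A []))))"
proof -
  let ?z = "\<lambda>a. PP n (bar_act S a A) - p (act S a (A []))"
  have "conj_s a (act S a (dom A)) (?z a) = conj_s a (act S a D) (?z a)" if "a \<in> branches A" for a
    using A D branches_labels[OF that] by (intro conj_s_change) (simp_all add: PP_diff_absorb dom)
  then have "(\<Sum>a\<in>branches A. conj_s a (act S a (dom A)) (?z a)) =
      (\<Sum>a\<in>branches A. conj_s a (act S a D) (?z a))"
    by simp
  also have "\<dots> = (\<Sum>a\<in>F. conj_s a (act S a D) (?z a))"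
  proof (rule sum.mono_neutral_left[OF F(1,2)], rule ballI)
    fix a assume "a \<in> F - branches A"
    then have "a \<in> labels S" "bar_act S a A = emb (act S a (A []))"
      using F by (auto simp: branches_def)
    then show "conj_s a (act S a D) (?z a) = 0"
      using A by (simp add: PP_emb conj_s_0)
  qed
  finally show ?thesis by simp
qed

declare PP.simps(2) [simp del]

text \<open>Over a common set of letters and a common bound, terms of different letters are
  orthogonal by \<open>s_s\<close>; within one letter the induction hypothesis applies to the
  shifts.\<close>

lemma PP_meet:
  assumes "A \<in> car Xbar" "B \<in> car Xbar"
  shows "PP n (meet Xbar A B) = PP n A * PP n B"
  using assms
proof (induct n arbitrary: A B)
  case 0
  then show ?case by (simp add: p_meet)
next
  case (Suc n)
  interpret bar: bool_alg Xbar by (rule bar_bool_alg)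
  obtain D where D: "D \<in> car X" "ble Xbar A (emb D)" "ble Xbar B (emb D)"
    using dom_common[OF Suc(2,3)] .
  have DM: "ble Xbar (meet Xbar A B) (emb D)"
    using Suc D bar.ble_trans[OF _ _ _ bar.meet_le1] by simp
  define F where "F = branches A \<union> branches B \<union> branches (meet Xbar A B)"
  have F: "finite F" "F \<subseteq> labels S" "branches A \<subseteq> F" "branches B \<subseteq> F" "branches (meet Xbar A B) \<subseteq> F"
    using Suc by (auto simp: F_def branches_finite branches_labels)
  let ?V = "\<lambda>a. conj_s a (act S a D)"
  define x y x0 y0 where "x a = PP n (bar_act S a A)" and "y a = PP n (bar_act S a B)"
    and "x0 a = p (act S a (A []))" and "y0 a = p (act S a (B []))" for a
  have M: "PP n (bar_act S a (meet Xbar A B)) = x a * y a" "p (act S a (meet X (A []) (B []))) = x0 a * y0 a"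
    if "a \<in> F" for a
    using that F Suc by (auto simp: bar_act_hom x_def y_def x0_def y0_def act_simps p_meet)
  \<comment> \<open>The projection that \<open>s_s\<close> leaves in the middle is absorbed by
    \<open>x a - x0 a\<close>.\<close>
  have prod: "?V a (x a - x0 a) * ?V b (y b - y0 b) = (if a = b then ?V a ((x a - x0 a) * (y a - y0 a)) else 0)"
    if "a \<in> F" "b \<in> F" for a b
  proof -
    have "a \<in> labels S" "b \<in> labels S" using that F by auto
    moreover from this have "(x a - x0 a) * p (act S a D) = x a - x0 a"
      using Suc D by (simp add: x_def x0_def PP_diff_absorb)
    moreover from calculation have "act S a D \<in> Idl S a" "act S b D \<in> Idl S b"
      using D(1) by simp_all
    ultimately have "?V a (x a - x0 a) * ?V b (y b - y0 b) =
        (if a = b then s a (act S a D) * ((x a - x0 a) * p (act S a D)) * (y a - y0 a) *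
          star (s a (act S a D)) else 0)"
      using D(1) by (auto simp: conj_s_mult meet_idem mult.assoc)
    also have "(x a - x0 a) * p (act S a D) = x a - x0 a" by fact
    finally show ?thesis by (simp add: conj_s_def mult.assoc)
  qed
  have "PP (Suc n) A * PP (Suc n) B =
      (p (A []) + (\<Sum>a\<in>F. ?V a (x a - x0 a))) * (p (B []) + (\<Sum>b\<in>F. ?V b (y b - y0 b)))"
    using PP_unfold[OF Suc(2) F(1,3,2) D(1,2), of n] PP_unfold[OF Suc(3) F(1,4,2) D(1,3), of n]
    by (simp add: x_def y_def x0_def y0_def)
  also have "\<dots> = p (A []) * p (B []) + (\<Sum>a\<in>F. p (A []) * ?V a (y a - y0 a)) +
      (\<Sum>a\<in>F. ?V a (x a - x0 a) * p (B [])) +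
      (\<Sum>a\<in>F. \<Sum>b\<in>F. ?V a (x a - x0 a) * ?V b (y b - y0 b))"
    unfolding sum_product[symmetric] sum_distrib_left[symmetric] sum_distrib_right[symmetric]
    by (simp add: distrib_left distrib_right add.assoc)
  also have "(\<Sum>a\<in>F. \<Sum>b\<in>F. ?V a (x a - x0 a) * ?V b (y b - y0 b)) =
      (\<Sum>a\<in>F. ?V a ((x a - x0 a) * (y a - y0 a)))"
    using F(1) prod by (intro sum.cong refl) (simp add: sum.delta cong: sum.cong)
  also have "(\<Sum>a\<in>F. p (A []) * ?V a (y a - y0 a)) = (\<Sum>a\<in>F. ?V a (x0 a * (y a - y0 a)))"
    using F Suc D by (intro sum.cong refl) (auto simp: conj_s_p x0_def)
  also have "(\<Sum>a\<in>F. ?V a (x a - x0 a) * p (B [])) = (\<Sum>a\<in>F. ?V a ((x a - x0 a) * y0 a))"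
    using F Suc D by (intro sum.cong refl) (auto simp: conj_s_p y0_def)
  \<comment> \<open>For each letter, \<open>x0 * (y - y0) + (x - x0) * y0 + (x - x0) * (y - y0) = x
    * y - x0 * y0\<close>.\<close>
  also have "p (A []) * p (B []) + (\<Sum>a\<in>F. ?V a (x0 a * (y a - y0 a))) +
      (\<Sum>a\<in>F. ?V a ((x a - x0 a) * y0 a)) + (\<Sum>a\<in>F. ?V a ((x a - x0 a) * (y a - y0 a))) =
      p (A []) * p (B []) + (\<Sum>a\<in>F. ?V a (x a * y a - x0 a * y0 a))"
    by (simp add: conj_s_add[symmetric] sum.distrib[symmetric] add.assoc algebra_simps)
  also have "\<dots> = PP (Suc n) (meet Xbar A B)"
    using PP_unfold[OF _ F(1,5,2) D(1) DM, of n] Suc(2,3) M by (simp add: p_meet)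
  finally show ?case by simp
qed

text \<open>Over a common \<open>F\<close> and \<open>D\<close> each correction term is additive, so
  inclusion-exclusion passes from the shifts to the families.\<close>

lemma PP_join:
  assumes "A \<in> car Xbar" "B \<in> car Xbar"
  shows "PP n (join Xbar A B) = PP n A + PP n B - PP n (meet Xbar A B)"
  using assms
proof (induct n arbitrary: A B)
  case 0
  then show ?case by (simp add: p_join)
next
  case (Suc n)
  interpret bar: bool_alg Xbar by (rule bar_bool_alg)
  obtain D where D: "D \<in> car X" "ble Xbar A (emb D)" "ble Xbar B (emb D)"
    using dom_common[OF Suc(2,3)] .
  have DM: "ble Xbar (meet Xbar A B) (emb D)" "ble Xbar (join Xbar A B) (emb D)"
    using Suc D bar.ble_trans[OF _ _ _ bar.meet_le1] bar.ble_joinD by simp_all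
  define F where "F = branches A \<union> branches B \<union> branches (meet Xbar A B) \<union> branches (join Xbar A B)"
  have F: "finite F" "F \<subseteq> labels S"
    using Suc by (auto simp: F_def branches_finite branches_labels)
  let ?z = "\<lambda>A a. conj_s a (act S a D) (PP n (bar_act S a A) - p (act S a (A [])))"
  have "?z (join Xbar A B) a = ?z A a + ?z B a - ?z (meet Xbar A B) a" if "a \<in> F" for a
  proof -
    have a: "a \<in> labels S" using that F by blast
    have "PP n (bar_act S a (join Xbar A B)) - p (act S a (join X (A []) (B []))) =
        (PP n (bar_act S a A) - p (act S a (A []))) + (PP n (bar_act S a B) - p (act S a (B []))) -
        (PP n (bar_act S a (meet Xbar A B)) - p (act S a (meet X (A []) (B []))))"
      using Suc a by (simp add: bar_act_hom act_simps p_join)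
    then show ?thesis by (simp add: conj_s_add conj_s_diff)
  qed
  then have "(\<Sum>a\<in>F. ?z (join Xbar A B) a) =
      (\<Sum>a\<in>F. ?z A a) + (\<Sum>a\<in>F. ?z B a) - (\<Sum>a\<in>F. ?z (meet Xbar A B) a)"
    by (simp add: sum.distrib sum_subtractf)
  moreover have "PP (Suc n) C = p (C []) + (\<Sum>a\<in>F. ?z C a)"
    if "C \<in> {A, B, meet Xbar A B, join Xbar A B}" for C
    using that Suc(2,3) F D DM by (intro PP_unfold) (auto simp: F_def)
  ultimately show ?case using Suc(2,3) by (simp add: p_join)
qed

text \<open>Each shift lowers the rank, and at rank 0 the family is \<open>emb (A [])\<close>, on
  which every depth gives \<open>p (A [])\<close>.\<close>

lemma PP_rank: "A \<in> car Xbar \<Longrightarrow> rank_le n A \<Longrightarrow> n \<le> m \<Longrightarrow> PP m A = PP n A"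
proof (induct n arbitrary: A m)
  case 0
  then show ?case using PP_emb[of "A []"] rank_le_0[of A] by simp
next
  case (Suc n)
  then obtain k where k: "m = Suc k" "n \<le> k" by (cases m) auto
  have "PP k (bar_act S a A) = PP n (bar_act S a A)" if "a \<in> branches A" for a
    using branches_labels[OF that] Suc(2,3) k(2) by (intro Suc(1)) (simp_all add: rank_le_Suc)
  then show ?case by (simp add: k(1) PP.simps(2))
qed

definition P :: "('l list \<Rightarrow> 'b) \<Rightarrow> 'a" where
  "P A = PP (SOME n. rank_le n A) A"

lemma P_eq_PP:
  assumes "A \<in> car Xbar" "rank_le n A"
  shows "P A = PP n A"
proof -
  have "rank_le (SOME n. rank_le n A) A" using assms(2) by (rule someI)
  then show ?thesis
    unfolding P_def using assms PP_rank[of A _ "max n (SOME n. rank_le n A)"] by (metis max.cobounded1 max.cobounded2)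
qed

text \<open>A common depth lets identities of \<open>PP\<close> carry over to \<open>P\<close>. It
  is claimed for all larger depths too, because \<open>P_unfold\<close> compares depth
  \<open>Suc n\<close> with depth \<open>n\<close>.\<close>

lemma P_eventually_PP:
  assumes "finite \<A>" "\<A> \<subseteq> car Xbar"
  obtains n where "\<And>A m. A \<in> \<A> \<Longrightarrow> n \<le> m \<Longrightarrow> P A = PP m A"
proof -
  have "\<exists>n. \<forall>A\<in>\<A>. \<forall>m\<ge>n. P A = PP m A"
    using assms
  proof induct
    case (insert A \<A>)
    then obtain n where n: "\<forall>A\<in>\<A>. \<forall>m\<ge>n. P A = PP m A" by auto
    obtain k where k: "rank_le k A" using insert(4) rank_le_exists by blast
    have "P A = PP m A" if "k \<le> m" for m
      using insert(4) rank_le_mono[OF k that] by (simp add: P_eq_PP)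
    with n have "\<forall>B\<in>insert A \<A>. \<forall>m\<ge>max n k. P B = PP m B" by auto
    then show ?case by blast
  qed simp
  then show thesis using that by blast
qed

lemma P_meet:
  assumes "A \<in> car Xbar" "B \<in> car Xbar"
  shows "P (meet Xbar A B) = P A * P B"
proof -
  obtain n where "\<And>C m. C \<in> {A, B, meet Xbar A B} \<Longrightarrow> n \<le> m \<Longrightarrow> P C = PP m C"
    using P_eventually_PP[of "{A, B, meet Xbar A B}"] assms by auto
  then have "P A = PP n A" "P B = PP n B" "P (meet Xbar A B) = PP n (meet Xbar A B)"
    by blast+
  then show ?thesis using PP_meet[OF assms, of n] by simp
qed

lemma P_join:
  assumes "A \<in> car Xbar" "B \<in> car Xbar"
  shows "P (join Xbar A B) = P A + P B - P (meet Xbar A B)"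
proof -
  obtain n where "\<And>C m. C \<in> {A, B, meet Xbar A B, join Xbar A B} \<Longrightarrow> n \<le> m \<Longrightarrow> P C = PP m C"
    using P_eventually_PP[of "{A, B, meet Xbar A B, join Xbar A B}"] assms by auto
  then have "P A = PP n A" "P B = PP n B" "P (meet Xbar A B) = PP n (meet Xbar A B)"
    "P (join Xbar A B) = PP n (join Xbar A B)"
    by blast+
  then show ?thesis using PP_join[OF assms, of n] by simp
qed

lemma P_star: "A \<in> car Xbar \<Longrightarrow> star (P A) = P A"
  by (simp add: P_def PP_star)

lemma P_emb: "A \<in> car X \<Longrightarrow> P (emb A) = p A"
  by (simp add: P_def PP_emb)

lemma P_absorb:
  assumes "A \<in> car Xbar" "C \<in> car X" "ble Xbar A (emb C)"
  shows "p C * P A = P A" "P A * p C = P A"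
  using PP_absorb[OF assms] by (simp_all add: P_def)

lemma P_unfold:
  assumes A: "A \<in> car Xbar" and F: "finite F" "branches A \<subseteq> F" "F \<subseteq> labels S"
    and D: "D \<in> car X" "ble Xbar A (emb D)"
  shows "P A = p (A []) + (\<Sum>a\<in>F. conj_s a (act S a D) (P (bar_act S a A) - p (act S a (A []))))"
proof -
  have "insert A ((\<lambda>a. bar_act S a A) ` F) \<subseteq> car Xbar" using A F by auto
  then obtain n where n: "\<And>C m. C \<in> insert A ((\<lambda>a. bar_act S a A) ` F) \<Longrightarrow> n \<le> m \<Longrightarrow> P C = PP m C"
    using P_eventually_PP[of "insert A ((\<lambda>a. bar_act S a A) ` F)"] F(1) by auto
  then have "P A = PP (Suc n) A" "\<And>a. a \<in> F \<Longrightarrow> P (bar_act S a A) = PP n (bar_act S a A)" by auto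
  then show ?thesis using PP_unfold[OF assms, of n] by simp
qed

lemma P_p_commute:
  assumes "A \<in> car Xbar" "C \<in> car X"
  shows "P A * p C = p C * P A"
  using assms P_meet[of A "emb C"] P_meet[of "emb C" A]
    bool_alg.meet_comm[OF bar_bool_alg, of "emb C" A] by (simp add: P_emb)

lemma P_diff_absorb:
  assumes "a \<in> labels S" "A \<in> car Xbar" "D \<in> car X" "ble Xbar A (emb D)"
  shows "p (act S a D) * (P (bar_act S a A) - p (act S a (A []))) = P (bar_act S a A) - p (act S a (A []))"
    "(P (bar_act S a A) - p (act S a (A []))) * p (act S a D) = P (bar_act S a A) - p (act S a (A []))"
  using assms P_absorb[of "bar_act S a A" "act S a D"] p_ble[of "act S a (A [])" "act S a D"]
  by (simp_all add: ble_emb_act act_mono ble_emb_Nil algebra_simps)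

text \<open>By \<open>s_s\<close> only the term of the letter \<open>a\<close> survives
  multiplication by \<open>s a C\<close>. There \<open>z a\<close> commutes with \<open>p C\<close>,
  which allows \<open>s a (act S a D)\<close> to be exchanged for \<open>s a C\<close>.\<close>

lemma P_s:
  assumes A: "A \<in> car Xbar" and a: "a \<in> labels S" and C: "C \<in> Idl S a"
  shows "P A * s a C = s a C * P (bar_act S a A)"
proof -
  \<comment> \<open>\<open>a\<close> is inserted so that the surviving summand is present even if
    \<open>a\<close> is not a branch.\<close>
  define F D where "F = insert a (branches A)" and "D = dom A"
  define z where "z b = P (bar_act S b A) - p (act S b (A []))" for b
  have F: "finite F" "branches A \<subseteq> F" "F \<subseteq> labels S" "a \<in> F"
    using A a branches_finite[OF A] branches_labels by (auto simp: F_def)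
  have D: "D \<in> car X" "ble Xbar A (emb D)" using dom[OF A] by (simp_all add: D_def)
  have Ccar: "C \<in> car X" using a C by (rule Idl_car)
  have E: "act S b D \<in> Idl S b" if "b \<in> labels S" for b
    using that D(1) by simp
  have zD: "p (act S a D) * z a = z a" "z a * p (act S a D) = z a"
    unfolding z_def by (rule P_diff_absorb[OF a A D])+
  have zC: "z a * p C = p C * z a"
    using A a Ccar P_p_commute[of "bar_act S a A" C] p_commute[of C "act S a (A [])"]
    by (simp add: z_def left_diff_distrib right_diff_distrib)
  have diagonal: "s a (act S a D) * z a * p (meet X (act S a D) C) = s a C * z a"
  proof -
    have "s a (act S a D) * z a * p (meet X (act S a D) C) = s a (act S a D) * ((z a * p (act S a D)) * p C)"
      using E[OF a] a Ccar by (simp add: p_meet Idl_car mult.assoc)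
    also have "\<dots> = (s a (act S a D) * p C) * z a"
      by (simp add: zD zC mult.assoc)
    also have "\<dots> = s a C * (p (act S a D) * z a)"
      by (simp add: s_meet_commute[OF a E[OF a] C] mult.assoc)
    finally show ?thesis by (simp add: zD)
  qed
  have summand: "conj_s b (act S b D) (z b) * s a C = (if b = a then s a C * z a else 0)" if "b \<in> F" for b
  proof -
    have b: "b \<in> labels S" using that F by blast
    have "conj_s b (act S b D) (z b) * s a C = s b (act S b D) * z b * (star (s b (act S b D)) * s a C)"
      by (simp add: conj_s_def mult.assoc)
    then show ?thesis
      unfolding s_s[OF b E[OF b] a C] using diagonal by simp
  qed
  have "P A * s a C = p (A []) * s a C + (\<Sum>b\<in>F. conj_s b (act S b D) (z b) * s a C)"
    unfolding P_unfold[OF A F(1-3) D] z_def by (simp add: distrib_right sum_distrib_right)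
  also have "(\<Sum>b\<in>F. conj_s b (act S b D) (z b) * s a C) = (\<Sum>b\<in>F. if b = a then s a C * z a else 0)"
    using summand by (rule sum.cong[OF refl])
  also have "\<dots> = s a C * z a"
    using F(1,4) by simp
  also have "p (A []) * s a C = s a C * p (act S a (A []))"
    using A a C by (simp add: p_s)
  finally show ?thesis by (simp add: z_def right_diff_distrib)
qed

text \<open>Relation (iv) for \<open>A []\<close>, rewritten with the bound \<open>D\<close>, is
  exactly the sum that \<open>P_unfold\<close> subtracts.\<close>

lemma P_Jdl:
  assumes A: "A \<in> car Xbar" "A [] \<in> Jdl S"
    and F: "finite F" "branches A \<union> Delta S (A []) \<subseteq> F" "F \<subseteq> labels S"
    and D: "D \<in> car X" "ble Xbar A (emb D)"
  shows "P A = (\<Sum>a\<in>F. conj_s a (act S a D) (P (bar_act S a A)))"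
proof -
  have "p (A []) = (\<Sum>a\<in>Delta S (A []). s a (act S a (A [])) * star (s a (act S a (A []))))"
    using A(2) by (rule p_sum)
  also have "\<dots> = (\<Sum>a\<in>Delta S (A []). conj_s a (act S a D) (p (act S a (A []))))"
  proof (rule sum.cong[OF refl])
    fix a assume "a \<in> Delta S (A [])"
    then have a: "a \<in> labels S" by (simp add: Delta_def)
    let ?A = "act S a (A [])" and ?D = "act S a D"
    have le: "meet X ?D ?A = ?A"
      using A D a act_mono[of a "A []" D] ble_emb_Nil[of A D] by (simp add: ble_def meet_comm)
    have "s a ?A * star (s a ?A) = (s a ?D * p ?A) * (p ?A * star (s a ?D))"
      using A D a by (simp add: s_p s_p_star le)
    also have "\<dots> = conj_s a ?D (p ?A)"
      using A a p_meet[of ?A ?A] by (simp add: conj_s_def meet_idem) (metis mult.assoc)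
    finally show "s a ?A * star (s a ?A) = conj_s a ?D (p ?A)" .
  qed
  also have "\<dots> = (\<Sum>a\<in>F. conj_s a (act S a D) (p (act S a (A []))))"
  proof (rule sum.mono_neutral_left[OF F(1)], use F(2) in blast, rule ballI)
    fix a assume "a \<in> F - Delta S (A [])"
    then have "act S a (A []) = bot X" using F(3) by (auto simp: Delta_def)
    then show "conj_s a (act S a D) (p (act S a (A []))) = 0" by (simp add: p_bot conj_s_0)
  qed
  finally show ?thesis
    using P_unfold[OF A(1) F(1) _ F(3) D] F(2) by (simp add: conj_s_diff sum_subtractf)
qed

lemma P_bot: "P (bot Xbar) = 0"
  using P_emb[of "bot X"] by (simp add: emb_hom p_bot)

text \<open>\<open>P_Jdl\<close> reduces \<open>P A\<close> to the shifts of \<open>A\<close>, which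
  stay in the ideal and whose supports consist of shorter words; a finite support is exhausted after
  finitely many shifts.\<close>

lemma P_ideal:
  assumes "A \<in> bar_ideal S"
  shows "P A = 0"
proof -
  have "P A = 0" if "A \<in> bar_ideal S" "\<And>w. w \<in> W \<Longrightarrow> n \<le> length w \<Longrightarrow> A w = bot X" for n A
    using that
  proof (induct n arbitrary: A)
    case 0
    then have "A = bot Xbar" by (intro bar_eqI) (simp_all add: bar_ideal_iff bar_ops)
    then show ?case by (simp add: P_bot)
  next
    case (Suc n)
    have A: "A \<in> car Xbar" "A [] \<in> Jdl S" using Suc(2) by (simp_all add: bar_ideal_iff)
    let ?F = "branches A \<union> Delta S (A [])"
    have F: "finite ?F" "?F \<subseteq> labels S"
      using A by (auto simp: branches_finite Delta_Jdl_finite branches_labels)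
        (simp add: Delta_def)
    have "P (bar_act S a A) = 0" if "a \<in> ?F" for a
    proof (rule Suc(1))
      have a: "a \<in> labels S" using that F(2) by blast
      show "bar_act S a A \<in> bar_ideal S" by (rule bar_act_ideal[OF a Suc(2)])
      show "bar_act S a A w = bot X" if "w \<in> W" "n \<le> length w" for w
        using Suc(3)[of "a # w"] that a by (simp add: bar_act_app)
    qed
    then show ?case
      using P_Jdl[OF A F(1) _ F(2) dom[OF A(1)]] by (simp add: conj_s_0)
  qed
  moreover have "\<exists>n. \<forall>w\<in>W. n \<le> length w \<longrightarrow> A w = bot X"
  proof -
    have "finite (length ` {w \<in> W. A w \<noteq> bot X})" using assms by (simp add: bar_ideal_iff)
    then obtain n where "\<forall>m\<in>length ` {w \<in> W. A w \<noteq> bot X}. m < n"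
      unfolding finite_nat_set_iff_bounded by blast
    then have "length w < n" if "w \<in> W" "A w \<noteq> bot X" for w using that by blast
    then show ?thesis by (meson not_le)
  qed
  ultimately show ?thesis using assms by blast
qed

text \<open>If \<open>diff Xbar C D\<close> is in the ideal, then \<open>P C\<close> is the
  projection of the meet, and equivalent families share their meet.\<close>

lemma P_ext_q:
  assumes "A \<in> car Xbar" "B \<in> car Xbar" "ext_q S A = ext_q S B"
  shows "P A = P B"
proof -
  interpret bar: bool_alg Xbar by (rule bar_bool_alg)
  have "P C = P (meet Xbar C D)" if "C \<in> car Xbar" "D \<in> car Xbar" "diff Xbar C D \<in> bar_ideal S" for C D
  proof -
    have "P C = P (diff Xbar C D) + P (meet Xbar C D) - P (bot Xbar)"
      using that P_join[of "diff Xbar C D" "meet Xbar C D"] by (simp add: bar.diff_cover bar.diff_disjoint)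
    then show ?thesis using that by (simp add: P_ideal P_bot)
  qed
  then show ?thesis
    using assms bar.meet_comm[of A B] by (metis ext_q_eq_iff)
qed

end

section \<open>Operations, actions and ideals of the extended system\<close>

context relative_gbds
begin

lemma ext_simps:
  "alg (ext S) = quot_alg Xbar (bar_ideal S)" "labels (ext S) = labels S"
  by (simp_all add: ext_def)

lemma ext_car: "car (alg (ext S)) = ext_q S ` car Xbar"
  by (simp add: ext_simps bool_alg.quot_car[OF bar_bool_alg] ext_q_def[abs_def])

lemma ext_ops:
  assumes "A \<in> car Xbar" "B \<in> car Xbar"
  shows "meet (alg (ext S)) (ext_q S A) (ext_q S B) = ext_q S (meet Xbar A B)"
    "join (alg (ext S)) (ext_q S A) (ext_q S B) = ext_q S (join Xbar A B)"
    "diff (alg (ext S)) (ext_q S A) (ext_q S B) = ext_q S (diff Xbar A B)"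
  using assms unfolding ext_simps ext_q_def
  by (simp_all add: bool_alg.quot_meet[OF bar_bool_alg bar_ideal_bool_ideal]
      bool_alg.quot_join[OF bar_bool_alg bar_ideal_bool_ideal]
      bool_alg.quot_diff[OF bar_bool_alg bar_ideal_bool_ideal])

lemma ext_bot: "bot (alg (ext S)) = ext_q S (bot Xbar)"
  by (simp add: ext_simps ext_q_def bool_alg.quot_bot[OF bar_bool_alg])

lemma ext_act:
  assumes a: "a \<in> labels S" and A: "A \<in> car Xbar"
  shows "act (ext S) a (ext_q S A) = ext_q S (bar_act S a A)"
proof -
  have rel: "B \<in> car Xbar \<and> ext_q S A = ext_q S B" if "B \<in> ext_q S A" for B
  proof -
    have "(A, B) \<in> quot_rel Xbar (bar_ideal S)"
      using that by (simp add: ext_q_def quot_map_def)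
    then show ?thesis
      using A by (simp add: ext_q_eq_iff bool_alg.quot_rel_iff[OF bar_bool_alg bar_ideal_bool_ideal])
  qed
  have "ext_q S (bar_act S a B) = ext_q S (bar_act S a A)" if "B \<in> ext_q S A" for B
  proof -
    have B: "B \<in> car Xbar" "diff Xbar A B \<in> bar_ideal S" "diff Xbar B A \<in> bar_ideal S"
      using rel[OF that] ext_q_eq_iff[OF A, of B] by blast+
    then show ?thesis
      using A a bar_act_ideal[OF a B(2)] bar_act_ideal[OF a B(3)]
      by (simp add: ext_q_eq_iff bar_act_hom)
  qed
  moreover have "A \<in> ext_q S A"
    using A equiv_class_self[OF bool_alg.quot_rel_equiv[OF bar_bool_alg bar_ideal_bool_ideal]]
    by (simp add: ext_q_def quot_map_def)
  ultimately have "(\<Union>B\<in>ext_q S A. ext_q S (bar_act S a B)) = ext_q S (bar_act S a A)"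
    by (intro UN_eq_const)
  then show ?thesis by (simp add: ext_def)
qed

lemma ext_Idl: "Idl (ext S) a = ext_q S ` {A \<in> car Xbar. \<forall>w\<in>W. A w \<in> Iw S (a # w)}"
  by (simp add: ext_def)

lemma ext_Jdl: "Jdl (ext S) = ext_q S ` {A \<in> car Xbar. A [] \<in> Jdl S}"
  by (simp add: ext_def)

lemma ext_q_closed [simp]: "A \<in> car Xbar \<Longrightarrow> ext_q S A \<in> car (alg (ext S))"
  by (simp add: ext_car)

lemma ext_Idl_car: "Q \<in> Idl (ext S) a \<Longrightarrow> Q \<in> car (alg (ext S))"
  by (auto simp: ext_Idl)

lemma iota_eq: "iota S A = ext_q S (emb A)"
  by (simp add: iota_def iota_word_eq)

lemma Iw_down:
  assumes "a \<in> labels S" "w \<in> W" "A \<in> Iw S (a # w)" "B \<in> car X" "ble X B A"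
  shows "B \<in> Iw S (a # w)"
proof -
  obtain D where D: "A \<in> car X" "D \<in> Idl S a" "ble X A (act_word S w D)"
    using assms(3) unfolding Iw.simps by blast
  then have "ble X B (act_word S w D)"
    using assms(2,4,5) Idl_car[OF assms(1) D(2)] ble_trans[of B A "act_word S w D"]
    by (simp add: act_word_closed)
  then show ?thesis unfolding Iw.simps using D(2) assms(4) by blast
qed

lemma ext_Idl_meet:
  assumes a: "a \<in> labels S" and Q: "Q \<in> Idl (ext S) a" and A: "A \<in> car Xbar"
  shows "meet (alg (ext S)) Q (ext_q S A) \<in> Idl (ext S) a"
proof -
  obtain B where B: "B \<in> car Xbar" "\<forall>w\<in>W. B w \<in> Iw S (a # w)" "Q = ext_q S B"
    using Q unfolding ext_Idl by blast
  have "meet Xbar B A w \<in> Iw S (a # w)" if "w \<in> W" for w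
    using B(1,2) A that Iw_down[OF a that, of "B w" "meet Xbar B A w"]
    by (simp add: bar_ops bar_app meet_le1 del: Iw.simps)
  then show ?thesis
    using B A unfolding ext_Idl by (simp add: ext_ops del: Iw.simps)
qed

lemma ext_Idl_of_dominated:
  assumes a: "a \<in> labels S" and A: "A \<in> car Xbar" and D: "D \<in> Idl S a" "ble Xbar A (emb D)"
  shows "ext_q S A \<in> Idl (ext S) a"
proof -
  have "A w \<in> Iw S (a # w)" if "w \<in> W" for w
  proof -
    have "ble X (A w) (act_word S w D)"
      using that A D(2) Idl_car[OF a D(1)] bar_ble[of A "emb D"] by (simp add: emb_app)
    then show ?thesis unfolding Iw.simps using bar_app[OF A that] D(1) by blast
  qed
  then show ?thesis using A unfolding ext_Idl by blast
qed

lemma iota_Idl: "a \<in> labels S \<Longrightarrow> B \<in> Idl S a \<Longrightarrow> iota S B \<in> Idl (ext S) a"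
  unfolding iota_eq
  using Idl_car by (intro ext_Idl_of_dominated[where D = B] bool_alg.ble_refl[OF bar_bool_alg] emb_closed) blast+

lemma ext_IdlE:
  assumes "a \<in> labels S" "Q \<in> Idl (ext S) a"
  obtains A D where "A \<in> car Xbar" "Q = ext_q S A" "D \<in> Idl S a" "ble Xbar A (emb D)"
proof -
  obtain A where A: "A \<in> car Xbar" "\<forall>w\<in>W. A w \<in> Iw S (a # w)" "Q = ext_q S A"
    using assms(2) unfolding ext_Idl by blast
  with bar_dominated_Idl[OF assms(1) A(1)] that show thesis by blast
qed

lemma ext_carE:
  assumes "Q \<in> car (alg (ext S))"
  obtains A where "A \<in> car Xbar" "Q = ext_q S A"
  using assms by (auto simp: ext_car)

lemma bar_act_branch:
  "a \<in> labels S \<Longrightarrow> a \<notin> branches A \<union> Delta S (A []) \<Longrightarrow> bar_act S a A = bot Xbar"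
  by (auto simp: branches_def Delta_def emb_hom)

text \<open>Equality may fail, as a nonempty shift can have empty class. Sums are therefore taken
  over the larger set, whose additional terms vanish.\<close>

lemma ext_Delta_subset:
  assumes "A \<in> car Xbar"
  shows "Delta (ext S) (ext_q S A) \<subseteq> branches A \<union> Delta S (A [])"
proof
  fix a assume "a \<in> Delta (ext S) (ext_q S A)"
  then have a: "a \<in> labels S" "act (ext S) a (ext_q S A) \<noteq> bot (alg (ext S))"
    by (simp_all add: Delta_def ext_simps(2))
  show "a \<in> branches A \<union> Delta S (A [])"
  proof (rule ccontr)
    assume "a \<notin> branches A \<union> Delta S (A [])"
    from bar_act_branch[OF a(1) this] a assms show False by (simp add: ext_act ext_bot)
  qed
qed

lemma branches_Delta_finite:
  assumes "A \<in> car Xbar" "A [] \<in> Jdl S"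
  shows "finite (branches A \<union> Delta S (A []))" "branches A \<union> Delta S (A []) \<subseteq> labels S"
  using branches_finite[OF assms(1)] Delta_Jdl_finite[OF assms(2)]
  by (simp, auto simp: branches_def Delta_def)

end

section \<open>The extended relations in a representation of the original ones\<close>

context gbds_rep
begin

definition Pext :: "('l list \<Rightarrow> 'b) set \<Rightarrow> 'a" where
  "Pext Q = P (SOME A. A \<in> car Xbar \<and> ext_q S A = Q)"

lemma Pext_q [simp]:
  assumes "A \<in> car Xbar"
  shows "Pext (ext_q S A) = P A"
proof -
  have "\<exists>B. B \<in> car Xbar \<and> ext_q S B = ext_q S A" using assms by blast
  from someI_ex[OF this] show ?thesis
    unfolding Pext_def using assms by (intro P_ext_q) simp_all
qed

text \<open>The bound \<open>D\<close> is selected by absorption rather than by \<open>ble\<close>,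
  because absorption refers to the class \<open>Q\<close> alone and not to a representative.\<close>

definition Sext :: "'l \<Rightarrow> ('l list \<Rightarrow> 'b) set \<Rightarrow> 'a" where
  "Sext a Q = s a (SOME D. D \<in> Idl S a \<and> p D * Pext Q = Pext Q) * Pext Q"

text \<open>Both the chosen element and \<open>D\<close> absorb \<open>P A\<close>, and
  \<open>s_meet_commute\<close> exchanges them.\<close>

lemma Sext_eq:
  assumes a: "a \<in> labels S" and A: "A \<in> car Xbar" and D: "D \<in> Idl S a" "ble Xbar A (emb D)"
  shows "Sext a (ext_q S A) = s a D * P A"
proof -
  let ?D = "SOME D. D \<in> Idl S a \<and> p D * Pext (ext_q S A) = Pext (ext_q S A)"
  have D': "D \<in> Idl S a \<and> p D * P A = P A"
    using P_absorb[OF A Idl_car[OF a D(1)] D(2)] D(1) by simp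
  then have "\<exists>D. D \<in> Idl S a \<and> p D * Pext (ext_q S A) = Pext (ext_q S A)"
    using A by auto
  from someI_ex[OF this] have E: "?D \<in> Idl S a" "p ?D * P A = P A" using A by simp_all
  have "s a ?D * P A = (s a ?D * p D) * P A" using D' by (simp add: mult.assoc)
  also have "\<dots> = s a D * (p ?D * P A)"
    using s_meet_commute[OF a E(1) D(1)] by (simp add: mult.assoc)
  finally show ?thesis using A E(2) by (simp add: Sext_def)
qed

lemma Sext_conj:
  assumes a: "a \<in> labels S" and A: "A \<in> car Xbar" and D: "D \<in> Idl S a" "ble Xbar A (emb D)"
  shows "Sext a (ext_q S A) * star (Sext a (ext_q S A)) = conj_s a D (P A)"
proof -
  interpret bar: bool_alg Xbar by (rule bar_bool_alg)
  have "P A * P A = P A" using P_meet[OF A A] A by (simp add: bar.meet_idem)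
  then show ?thesis
    unfolding Sext_eq[OF assms] conj_s_def
    using A by (simp add: star_mult P_star) (metis mult.assoc)
qed

lemma ext_Pext:
  assumes "Q \<in> car (alg (ext S))"
  shows "star (Pext Q) = Pext Q" "Pext Q * Pext Q = Pext Q"
  using assms bool_alg.meet_idem[OF bar_bool_alg] P_meet
  by (auto elim!: ext_carE simp: P_star simp flip: P_meet)

lemma ext_Pext_bot: "Pext (bot (alg (ext S))) = 0"
  by (simp add: ext_bot P_bot)

lemma ext_Pext_ops:
  assumes "Q \<in> car (alg (ext S))" "Q' \<in> car (alg (ext S))"
  shows "Pext (meet (alg (ext S)) Q Q') = Pext Q * Pext Q'"
    "Pext (join (alg (ext S)) Q Q') = Pext Q + Pext Q' - Pext (meet (alg (ext S)) Q Q')"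
  using assms by (auto elim!: ext_carE simp: ext_ops P_meet P_join)

lemma ext_Pext_Sext:
  assumes "Q \<in> car (alg (ext S))" "a \<in> labels S" "Q' \<in> Idl (ext S) a"
  shows "Pext Q * Sext a Q' = Sext a Q' * Pext (act (ext S) a Q)"
proof -
  interpret bar: bool_alg Xbar by (rule bar_bool_alg)
  obtain A where A: "A \<in> car Xbar" "Q = ext_q S A" using assms(1) by (rule ext_carE)
  obtain B D where B: "B \<in> car Xbar" "Q' = ext_q S B" "D \<in> Idl S a" "ble Xbar B (emb D)"
    using assms(2,3) by (rule ext_IdlE)
  have "P (bar_act S a A) * P B = P B * P (bar_act S a A)"
    using A B assms(2) bar.meet_comm[of B "bar_act S a A"] by (simp flip: P_meet)
  then have "(P A * s a D) * P B = (s a D * P B) * P (bar_act S a A)"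
    unfolding P_s[OF A(1) assms(2) B(3)] by (simp add: mult.assoc)
  then show ?thesis
    using A(1) Sext_eq[OF assms(2) B(1,3,4)] by (simp add: A(2) B(2) ext_act assms(2) mult.assoc)
qed

lemma ext_Sext_Sext:
  assumes "a \<in> labels S" "Q \<in> Idl (ext S) a" "b \<in> labels S" "Q' \<in> Idl (ext S) b"
  shows "star (Sext a Q) * Sext b Q' = (if a = b then Pext (meet (alg (ext S)) Q Q') else 0)"
proof -
  obtain A D where A: "A \<in> car Xbar" "Q = ext_q S A" "D \<in> Idl S a" "ble Xbar A (emb D)"
    using assms(1,2) by (rule ext_IdlE)
  obtain B E where B: "B \<in> car Xbar" "Q' = ext_q S B" "E \<in> Idl S b" "ble Xbar B (emb E)"
    using assms(3,4) by (rule ext_IdlE)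
  have DE: "D \<in> car X" "E \<in> car X" using A B assms Idl_car by blast+
  have "star (Sext a Q) * Sext b Q' = P A * (star (s a D) * s b E) * P B"
    using Sext_eq[OF assms(1) A(1,3,4)] Sext_eq[OF assms(3) B(1,3,4)] A(1)
    by (simp add: A(2) B(2) star_mult P_star mult.assoc)
  also have "\<dots> = (if a = b then (P A * p D) * (p E * P B) else 0)"
    unfolding s_s[OF assms(1) A(3) assms(3) B(3)] using DE by (simp add: p_meet mult.assoc)
  also have "(P A * p D) * (p E * P B) = P (meet Xbar A B)"
    using P_absorb[OF A(1) DE(1) A(4)] P_absorb[OF B(1) DE(2) B(4)] A(1) B(1) by (simp add: P_meet)
  finally show ?thesis using A(1) B(1) by (simp add: A(2) B(2) ext_ops)
qed

lemma ext_Sext_Pext: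
  assumes "a \<in> labels S" "Q \<in> Idl (ext S) a"
  shows "Sext a Q * Pext Q = Sext a Q"
proof -
  obtain A D where A: "A \<in> car Xbar" "Q = ext_q S A" "D \<in> Idl S a" "ble Xbar A (emb D)"
    using assms by (rule ext_IdlE)
  then show ?thesis
    using Sext_eq[OF assms(1) A(1,3,4)] ext_Pext(2)[of Q] by (simp add: mult.assoc)
qed

lemma ext_Sext_partial_isometry:
  assumes "a \<in> labels S" "Q \<in> Idl (ext S) a"
  shows "Sext a Q * star (Sext a Q) * Sext a Q = Sext a Q"
proof -
  obtain A where A: "A \<in> car Xbar" "Q = ext_q S A"
    using ext_Idl_car[OF assms(2)] by (rule ext_carE)
  have "meet (alg (ext S)) Q Q = Q"
    using A bool_alg.meet_idem[OF bar_bool_alg] by (simp add: ext_ops)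
  then show ?thesis
    using assms by (simp add: mult.assoc ext_Sext_Sext ext_Sext_Pext)
qed

text \<open>\<open>P_Jdl\<close> gives the sum over a larger set of letters. For a letter outside
  \<open>Delta (ext S) Q\<close> the shift has empty class, so \<open>P\<close> vanishes on
  it.\<close>

lemma ext_Pext_sum:
  assumes "Q \<in> Jdl (ext S)"
  shows "Pext Q = (\<Sum>a\<in>Delta (ext S) Q. Sext a (act (ext S) a Q) * star (Sext a (act (ext S) a Q)))"
proof -
  obtain A where A: "A \<in> car Xbar" "A [] \<in> Jdl S" "Q = ext_q S A"
    using assms by (auto simp: ext_Jdl)
  define F where "F = branches A \<union> Delta S (A [])"
  have F: "finite F" "F \<subseteq> labels S" "Delta (ext S) Q \<subseteq> F"
    using branches_Delta_finite[OF A(1,2)] ext_Delta_subset[OF A(1)] by (simp_all add: F_def A(3))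
  have summand: "Sext a (act (ext S) a Q) * star (Sext a (act (ext S) a Q)) =
      conj_s a (act S a (dom A)) (P (bar_act S a A))" if "a \<in> F" for a
  proof -
    have a: "a \<in> labels S" using that F by blast
    show ?thesis
      using Sext_conj[OF a, of "bar_act S a A" "act S a (dom A)"] a A(1) dom[OF A(1)]
      by (simp add: A(3) ext_act ble_emb_act)
  qed
  have "Pext Q = (\<Sum>a\<in>F. conj_s a (act S a (dom A)) (P (bar_act S a A)))"
    using P_Jdl[OF A(1,2) F(1) _ F(2) dom[OF A(1)]] A(1) by (simp add: A(3) F_def)
  also have "\<dots> = (\<Sum>a\<in>Delta (ext S) Q. conj_s a (act S a (dom A)) (P (bar_act S a A)))"
  proof (rule sum.mono_neutral_right[OF F(1,3)], rule ballI)
    fix a assume "a \<in> F - Delta (ext S) Q"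
    then have a: "a \<in> labels S" "a \<notin> Delta (ext S) Q" using F by auto
    then have "ext_q S (bar_act S a A) = ext_q S (bot Xbar)"
      using A(1) by (simp add: Delta_def ext_simps(2) A(3) ext_act ext_bot)
    then have "P (bar_act S a A) = 0"
      using P_ext_q[of "bar_act S a A" "bot Xbar"] a A(1) by (simp add: P_bot)
    then show "conj_s a (act S a (dom A)) (P (bar_act S a A)) = 0" by (simp add: conj_s_0)
  qed
  also have "\<dots> = (\<Sum>a\<in>Delta (ext S) Q. Sext a (act (ext S) a Q) * star (Sext a (act (ext S) a Q)))"
    using summand F(3) by (intro sum.cong refl) auto
  finally show ?thesis .
qed

end

section \<open>The isomorphism\<close>

text \<open>Serves both directions of the isomorphism: if the images of the generators satisfy the
  relations in the target ring, the substitution kills every relator. The closure hypotheses keep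
  all terms in \<open>free_car\<close>, where \<open>cls\<close> is additive and
  multiplicative.\<close>

lemma relators_vanish:
  fixes f :: "('b, 'l) gen \<Rightarrow> 'g free"
  assumes f: "\<And>g. g \<in> gens T \<Longrightarrow> f g \<in> free_car H"
    and p: "\<And>A. A \<in> car (alg T) \<Longrightarrow> cls H Q (f (PGen A)) = p A"
    and s: "\<And>a B. a \<in> labels T \<Longrightarrow> B \<in> Idl T a \<Longrightarrow> cls H Q (f (SGen a B)) = s a B"
    and closed: "bot (alg T) \<in> car (alg T)"
      "\<And>A B. A \<in> car (alg T) \<Longrightarrow> B \<in> car (alg T) \<Longrightarrow> meet (alg T) A B \<in> car (alg T)"
      "\<And>A B. A \<in> car (alg T) \<Longrightarrow> B \<in> car (alg T) \<Longrightarrow> join (alg T) A B \<in> car (alg T)"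
      "\<And>a A. a \<in> labels T \<Longrightarrow> A \<in> car (alg T) \<Longrightarrow> act T a A \<in> car (alg T)"
      "\<And>a A. a \<in> labels T \<Longrightarrow> A \<in> Idl T a \<Longrightarrow> A \<in> car (alg T)"
      "\<And>A. A \<in> Jdl T \<Longrightarrow> A \<in> car (alg T)"
      "\<And>a A. A \<in> Jdl T \<Longrightarrow> a \<in> Delta T A \<Longrightarrow> act T a A \<in> Idl T a"
    and rel: "\<And>A. A \<in> car (alg T) \<Longrightarrow> star (p A) = p A" "\<And>A. A \<in> car (alg T) \<Longrightarrow> p A * p A = p A"
      "\<And>a B. a \<in> labels T \<Longrightarrow> B \<in> Idl T a \<Longrightarrow> s a B * star (s a B) * s a B = s a B"
      "p (bot (alg T)) = 0"
      "\<And>A B. A \<in> car (alg T) \<Longrightarrow> B \<in> car (alg T) \<Longrightarrow> p (meet (alg T) A B) = p A * p B"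
      "\<And>A B. A \<in> car (alg T) \<Longrightarrow> B \<in> car (alg T) \<Longrightarrow>
        p (join (alg T) A B) = p A + p B - p (meet (alg T) A B)"
      "\<And>A a B. A \<in> car (alg T) \<Longrightarrow> a \<in> labels T \<Longrightarrow> B \<in> Idl T a \<Longrightarrow> p A * s a B = s a B * p (act T a A)"
      "\<And>a B b C. a \<in> labels T \<Longrightarrow> B \<in> Idl T a \<Longrightarrow> b \<in> labels T \<Longrightarrow> C \<in> Idl T b \<Longrightarrow>
        star (s a B) * s b C = (if a = b then p (meet (alg T) B C) else 0)"
      "\<And>A. A \<in> Jdl T \<Longrightarrow> p A = (\<Sum>a\<in>Delta T A. s a (act T a A) * star (s a (act T a A)))"
    and r: "r \<in> relators T"
  shows "r \<in> free_car (gens T) \<and> cls H Q (subst f r) = 0"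
proof -
  have gp: "\<And>A. A \<in> car (alg T) \<Longrightarrow> PGen A \<in> gens T"
    and gs: "\<And>a B. a \<in> labels T \<Longrightarrow> B \<in> Idl T a \<Longrightarrow> SGen a B \<in> gens T"
    by (auto simp: gens_def)
  have D: "a \<in> labels T" if "a \<in> Delta T A" for a A
    using that by (simp add: Delta_def)
  note simps = subst_diff subst_add subst_mult subst_star subst_sum cls_diff cls_add cls_mult cls_star
    f gp gs p s closed rel D
  show ?thesis
    using r
  proof cases
    case (proj_adj A)
    then show ?thesis by (simp add: simps)
  next
    case (proj_idem A)
    then show ?thesis by (simp add: simps)
  next
    case (part_isom a B)
    then show ?thesis by (simp add: simps)
  next
    case p_bot
    then show ?thesis by (simp add: simps)
  next
    case (p_meet A B)
    then show ?thesis by (simp add: simps)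
  next
    case (p_join A B)
    then show ?thesis by (simp add: simps)
  next
    case (p_s A a B)
    then show ?thesis by (simp add: simps)
  next
    case (s_s a B a' B')
    then show ?thesis by (cases "a = a'") (simp_all add: simps)
  next
    case (p_sum A)
    have "cls H Q (subst f (\<Sum>a\<in>Delta T A. sf a (act T a A) * free_star (sf a (act T a A)))) =
        (\<Sum>a\<in>Delta T A. s a (act T a A) * star (s a (act T a A)))"
      using p_sum(2) by (simp add: subst_sum subst_mult subst_star cls_sum cls_mult cls_star f gs s closed D)
    moreover have "(\<Sum>a\<in>Delta T A. sf a (act T a A) * free_star (sf a (act T a A))) \<in> free_car (gens T)"
      using p_sum(2) by (intro free_car_sum) (simp add: gs closed D)
    moreover from this have "subst f (\<Sum>a\<in>Delta T A. sf a (act T a A) * free_star (sf a (act T a A))) \<in> free_car H"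
      using f by (rule subst_car)
    moreover have "pf A \<in> free_car (gens T)" "cls H Q (f (PGen A)) = p A" "f (PGen A) \<in> free_car H"
      using p_sum(2) closed(6) gp p f by blast+
    ultimately show ?thesis
      using p_sum(2) rel(9)[of A] by (simp add: p_sum(1) subst_diff cls_diff)
  qed
qed

text \<open>
  These closure properties are all that the universal algebra needs. They are easier to check for
  \<open>ext S\<close> than \<^const>\<open>relative_gbds\<close>, which would also involve the regular elements of the quotient.
\<close>

locale bds_closed =
  fixes T :: "('b, 'l) bds"
  assumes bot_car: "bot (alg T) \<in> car (alg T)"
    and meet_car: "A \<in> car (alg T) \<Longrightarrow> B \<in> car (alg T) \<Longrightarrow> meet (alg T) A B \<in> car (alg T)"
    and join_car: "A \<in> car (alg T) \<Longrightarrow> B \<in> car (alg T) \<Longrightarrow> join (alg T) A B \<in> car (alg T)"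
    and act_car: "a \<in> labels T \<Longrightarrow> A \<in> car (alg T) \<Longrightarrow> act T a A \<in> car (alg T)"
    and Idl_subset: "a \<in> labels T \<Longrightarrow> A \<in> Idl T a \<Longrightarrow> A \<in> car (alg T)"
    and Idl_meet: "a \<in> labels T \<Longrightarrow> A \<in> Idl T a \<Longrightarrow> B \<in> car (alg T) \<Longrightarrow> meet (alg T) A B \<in> Idl T a"
    and Jdl_car: "A \<in> Jdl T \<Longrightarrow> A \<in> car (alg T)"
    and Jdl_act: "A \<in> Jdl T \<Longrightarrow> a \<in> Delta T A \<Longrightarrow> act T a A \<in> Idl T a"
begin

abbreviation c :: "('b, 'l) gen free \<Rightarrow> ('b, 'l) gen univ_ring" where
  "c \<equiv> cls (gens T) (relators T)"

abbreviation u_p :: "'b \<Rightarrow> ('b, 'l) gen univ_ring" where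
  "u_p A \<equiv> c (pf A)"

abbreviation u_s :: "'l \<Rightarrow> 'b \<Rightarrow> ('b, 'l) gen univ_ring" where
  "u_s a B \<equiv> c (sf a B)"

lemma PGen_gens [simp]: "A \<in> car (alg T) \<Longrightarrow> PGen A \<in> gens T"
  by (simp add: gens_def)

lemma SGen_gens [simp]: "a \<in> labels T \<Longrightarrow> B \<in> Idl T a \<Longrightarrow> SGen a B \<in> gens T"
  by (simp add: gens_def)

lemma Delta_labels: "a \<in> Delta T A \<Longrightarrow> a \<in> labels T"
  by (simp add: Delta_def)

lemma u_p_star: "A \<in> car (alg T) \<Longrightarrow> star (u_p A) = u_p A"
  using cls_relator[where G = "gens T", OF relators.proj_adj[of A T]] by (simp add: cls_diff cls_star)

lemma u_p_idem: "A \<in> car (alg T) \<Longrightarrow> u_p A * u_p A = u_p A"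
  using cls_relator[where G = "gens T", OF relators.proj_idem[of A T]] by (simp add: cls_diff cls_mult)

lemma u_s_partial_isometry:
  "a \<in> labels T \<Longrightarrow> B \<in> Idl T a \<Longrightarrow> u_s a B * star (u_s a B) * u_s a B = u_s a B"
  using cls_relator[where G = "gens T", OF relators.part_isom[of a T B]] by (simp add: cls_diff cls_mult cls_star)

lemma u_p_bot: "u_p (bot (alg T)) = 0"
  using cls_relator[where G = "gens T", OF relators.p_bot[of T]] by simp

lemma u_p_meet: "A \<in> car (alg T) \<Longrightarrow> B \<in> car (alg T) \<Longrightarrow> u_p (meet (alg T) A B) = u_p A * u_p B"
  using cls_relator[where G = "gens T", OF relators.p_meet[of A T B]] by (simp add: cls_diff cls_mult meet_car)

lemma u_p_join:
  "A \<in> car (alg T) \<Longrightarrow> B \<in> car (alg T) \<Longrightarrow>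
   u_p (join (alg T) A B) = u_p A + u_p B - u_p (meet (alg T) A B)"
  using cls_relator[where G = "gens T", OF relators.p_join[of A T B]]
  by (simp add: cls_diff cls_add meet_car join_car)

lemma u_p_s:
  "A \<in> car (alg T) \<Longrightarrow> a \<in> labels T \<Longrightarrow> B \<in> Idl T a \<Longrightarrow> u_p A * u_s a B = u_s a B * u_p (act T a A)"
  using cls_relator[where G = "gens T", OF relators.p_s[of A T a B]] by (simp add: cls_diff cls_mult act_car)

lemma u_s_s:
  assumes "a \<in> labels T" "B \<in> Idl T a" "b \<in> labels T" "C \<in> Idl T b"
  shows "star (u_s a B) * u_s b C = (if a = b then u_p (meet (alg T) B C) else 0)"
  using cls_relator[where G = "gens T", OF relators.s_s[OF assms]] assms Idl_subset
  by (cases "a = b") (simp_all add: cls_diff cls_mult cls_star meet_car)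

lemma u_p_sum:
  assumes A: "A \<in> Jdl T"
  shows "u_p A = (\<Sum>a\<in>Delta T A. u_s a (act T a A) * star (u_s a (act T a A)))"
proof -
  have gen: "SGen a (act T a A) \<in> gens T" if "a \<in> Delta T A" for a
    using that A Delta_labels Jdl_act by simp
  then have sum: "(\<Sum>a\<in>Delta T A. sf a (act T a A) * free_star (sf a (act T a A))) \<in> free_car (gens T)"
    by (intro free_car_sum) simp
  have "u_p A = c (\<Sum>a\<in>Delta T A. sf a (act T a A) * free_star (sf a (act T a A)))"
    using cls_relator[where G = "gens T", OF relators.p_sum[OF A]] sum A by (simp add: cls_diff Jdl_car)
  then show ?thesis using gen by (simp add: cls_sum cls_mult cls_star)
qed

text \<open>This one needs the C*-identity: it is not an algebraic consequence of the relators.\<close>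

lemma u_s_p:
  assumes A: "A \<in> car (alg T)" and a: "a \<in> labels T" "B \<in> Idl T a"
  shows "u_s a B * u_p A = u_s a (meet (alg T) B A)"
proof -
  let ?M = "meet (alg T) B A"
  have car: "B \<in> car (alg T)" "?M \<in> Idl T a" "?M \<in> car (alg T)"
    using assms Idl_meet Idl_subset by blast+
  \<comment> \<open>Each of the four terms of the expansion equals \<open>u_p ?M\<close>, with signs
    plus, minus, minus, plus.\<close>
  have "star (u_s a B * u_p A - u_s a ?M) * (u_s a B * u_p A - u_s a ?M) =
      u_p A * (star (u_s a B) * u_s a B) * u_p A - u_p A * (star (u_s a B) * u_s a ?M)
      - (star (u_s a ?M) * u_s a B) * u_p A + star (u_s a ?M) * u_s a ?M"
    using A by (simp add: star_diff star_mult u_p_star algebra_simps)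
  also have "\<dots> = 0"
    using A a car by (simp add: u_s_s u_p_meet mult.assoc)
  finally show ?thesis using star_definite by force
qed

text \<open>A projection satisfies \<open>star p * p = p\<close>, so by the C*-identity its seminorm
  is at most 1; for \<open>sf a B\<close> the element \<open>star s * s\<close> is such a
  projection.\<close>

lemma gens_bounded: "gen_bounded (gens T) (relators T)"
proof -
  have "N (free_gen g) \<le> 1" if g: "g \<in> gens T" and N: "cstar_seminorm (gens T) (relators T) N" for g N
  proof -
    have eqN: "N x = N y" if "x \<in> free_car (gens T)" "y \<in> free_car (gens T)" "c x = c y" for x y
    proof -
      have "N (x - y) = 0" using that cls_eq_iff ucongD[OF _ N] by blast
      moreover have "N x \<le> N (x - y) + N y" "N y \<le> N (y - x) + N x"
        using that cstar_seminorm_triangle[OF N, of "x - y" y] cstar_seminorm_triangle[OF N, of "y - x" x]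
        by simp_all
      ultimately show ?thesis
        using that cstar_seminorm_minus_commute[OF N, of x y] by simp
    qed
    \<comment> \<open>The maximum covers both uses: the square is bounded by \<open>N x\<close> for
      projections and by 1 for partial isometries.\<close>
    have le1: "N x \<le> 1" if "0 \<le> N x" "(N x)\<^sup>2 \<le> max 1 (N x)" for x
    proof (rule ccontr)
      assume "\<not> N x \<le> 1"
      then have "N x * 1 < N x * N x" by (intro mult_strict_left_mono) simp_all
      with that \<open>\<not> N x \<le> 1\<close> show False by (simp add: power2_eq_square)
    qed
    have p: "N (pf A) \<le> 1" if A: "A \<in> car (alg T)" for A
    proof (rule le1)
      show "0 \<le> N (pf A)" using A by (intro cstar_seminorm_nonneg[OF N]) simp
      have "(N (pf A))\<^sup>2 = N (free_star (pf A) * pf A)"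
        using A cstar_seminorm_cstar[OF N, of "pf A"] by simp
      also have "\<dots> = N (pf A)"
        using A by (intro eqN) (simp_all add: cls_mult cls_star u_p_star u_p_idem)
      finally show "(N (pf A))\<^sup>2 \<le> max 1 (N (pf A))" by simp
    qed
    from g consider A where "A \<in> car (alg T)" "g = PGen A"
      | a B where "a \<in> labels T" "B \<in> Idl T a" "g = SGen a B"
      by (auto simp: gens_def)
    then show ?thesis
    proof cases
      case 1
      then show ?thesis using p by simp
    next
      case 2
      have M: "meet (alg T) B B \<in> car (alg T)" using 2 Idl_subset meet_car by blast
      have "(N (sf a B))\<^sup>2 = N (free_star (sf a B) * sf a B)"
        using 2 cstar_seminorm_cstar[OF N, of "sf a B"] by simp
      also have "\<dots> = N (pf (meet (alg T) B B))"
        using 2 M by (intro eqN) (simp_all add: cls_mult cls_star u_s_s)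
      finally have "(N (sf a B))\<^sup>2 \<le> 1" using p[OF M] by simp
      moreover have "0 \<le> N (sf a B)" using 2 by (intro cstar_seminorm_nonneg[OF N]) simp
      ultimately show ?thesis using le1[of "sf a B"] 2(3) by simp
    qed
  qed
  then show ?thesis by (auto simp: gen_bounded_def)
qed

end

context relative_gbds
begin

lemma bds_closed: "bds_closed S"
proof
  show "meet X A B \<in> Idl S a" if "a \<in> labels S" "A \<in> Idl S a" "B \<in> car X" for a A B
    using that Idl_car[OF that(1,2)] by (intro ideal_down[OF Idl_ideal[OF that(1)] that(2)])
      (simp_all add: meet_le1)
  show "A \<in> car X" if "A \<in> Jdl S" for A
    using that Jdl_regular by (auto simp: regular_def)
  then show "act S a A \<in> Idl S a" if "A \<in> Jdl S" "a \<in> Delta S A" for a A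
    using that by (simp add: Delta_def)
qed (simp_all add: Idl_car)

lemma ext_bds_closed: "bds_closed (ext S)"
proof
  show "bot (alg (ext S)) \<in> car (alg (ext S))" by (simp add: ext_bot)
  fix Q Q' assume Q: "Q \<in> car (alg (ext S))"
  then obtain A where A: "A \<in> car Xbar" "Q = ext_q S A" by (rule ext_carE)
  {
    fix Q' assume "Q' \<in> car (alg (ext S))"
    then obtain B where "B \<in> car Xbar" "Q' = ext_q S B" by (rule ext_carE)
    then show "meet (alg (ext S)) Q Q' \<in> car (alg (ext S))" "join (alg (ext S)) Q Q' \<in> car (alg (ext S))"
      using A by (simp_all add: ext_ops)
  }
  show "act (ext S) a Q \<in> car (alg (ext S))" if "a \<in> labels (ext S)" for a
    using that A by (simp add: ext_simps(2) ext_act)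
  show "meet (alg (ext S)) Q' Q \<in> Idl (ext S) a" if "a \<in> labels (ext S)" "Q' \<in> Idl (ext S) a" for a Q'
    using that A ext_Idl_meet by (simp add: ext_simps(2))
next
  show "Q \<in> car (alg (ext S))" if "Q \<in> Idl (ext S) a" for Q a
    using that by (rule ext_Idl_car)
  show "Q \<in> car (alg (ext S))" if "Q \<in> Jdl (ext S)" for Q
    using that by (auto simp: ext_Jdl)
  show "act (ext S) a Q \<in> Idl (ext S) a" if Q: "Q \<in> Jdl (ext S)" "a \<in> Delta (ext S) Q" for a Q
  proof -
    obtain A where A: "A \<in> car Xbar" "Q = ext_q S A" using Q(1) by (auto simp: ext_Jdl)
    have a: "a \<in> labels S" using Q(2) by (simp add: Delta_def ext_simps(2))
    then show ?thesis
      using ext_Idl_of_dominated[OF a, of "bar_act S a A" "act S a (dom A)"] A dom[OF A(1)]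
      by (simp add: ext_act ble_emb_act)
  qed
qed

sublocale base: bds_closed S
  by (rule bds_closed)

sublocale ex: bds_closed "ext S"
  by (rule ext_bds_closed)

lemma gbds_rep_base: "gbds_rep S base.u_p base.u_s"
  by unfold_locales
    (simp_all add: base.u_p_star base.u_p_bot base.u_p_meet base.u_p_join base.u_p_s base.u_s_s
      base.u_s_p base.u_p_sum)

end

section \<open>The projections of the extended algebra satisfy the same recursion\<close>

context relative_gbds
begin

interpretation gbds_rep S base.u_p base.u_s
  by (rule gbds_rep_base)

abbreviation ep :: "('l list \<Rightarrow> 'b) \<Rightarrow> (('l list \<Rightarrow> 'b) set, 'l) gen univ_ring" where
  "ep A \<equiv> ex.u_p (ext_q S A)"

abbreviation es :: "'l \<Rightarrow> ('l list \<Rightarrow> 'b) \<Rightarrow> (('l list \<Rightarrow> 'b) set, 'l) gen univ_ring" where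
  "es a A \<equiv> ex.u_s a (ext_q S A)"

lemma ep_bot: "ep (bot Xbar) = 0"
  using ex.u_p_bot by (simp add: ext_bot)

lemma ep_join:
  "A \<in> car Xbar \<Longrightarrow> B \<in> car Xbar \<Longrightarrow> ep (join Xbar A B) = ep A + ep B - ep (meet Xbar A B)"
  using ex.u_p_join[of "ext_q S A" "ext_q S B"] by (simp add: ext_ops)

lemma ep_diff:
  assumes "A \<in> car Xbar" "B \<in> car Xbar"
  shows "ep (diff Xbar A B) = ep A - ep (meet Xbar A B)"
proof -
  interpret bar: bool_alg Xbar by (rule bar_bool_alg)
  show ?thesis
    using assms ep_join[of "diff Xbar A B" "meet Xbar A B"]
    by (simp add: bar.diff_cover bar.diff_disjoint ep_bot)
qed

lemma es_restrict:
  assumes "a \<in> labels S" "C \<in> Idl S a" "A \<in> car Xbar" "ble Xbar A (emb C)"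
  shows "es a A = es a (emb C) * ep A"
proof -
  have "ext_q S (emb C) \<in> Idl (ext S) a" using iota_Idl[OF assms(1,2)] by (simp add: iota_eq)
  moreover have "meet Xbar (emb C) A = A"
    using assms bool_alg.meet_comm[OF bar_bool_alg, of "emb C" A] Idl_car by (simp add: ble_def)
  ultimately show ?thesis
    using assms ex.u_s_p[of "ext_q S A" a "ext_q S (emb C)"] Idl_car
    by (simp add: ext_simps(2) ext_ops)
qed

lemma es_conj:
  assumes "a \<in> labels S" "C \<in> Idl S a" "A \<in> car Xbar" "ble Xbar A (emb C)"
  shows "es a A * star (es a A) = es a (emb C) * ep A * star (es a (emb C))"
proof -
  have "ep A * (ep A * x) = ep A * x" for x
    using assms(3) by (simp add: ex.u_p_idem flip: mult.assoc)
  then show ?thesis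
    unfolding es_restrict[OF assms] using assms(3) by (simp add: star_mult ex.u_p_star mult.assoc)
qed

text \<open>Relation (iv) sums over the letters where the class of the shift is nonempty. Elsewhere
  \<open>es_conj\<close> writes the term as a conjugate of the zero projection, so any finite larger
  set will do.\<close>

lemma ep_sum:
  assumes A: "A \<in> car Xbar" "A [] \<in> Jdl S"
    and F: "finite F" "branches A \<union> Delta S (A []) \<subseteq> F" "F \<subseteq> labels S"
  shows "ep A = (\<Sum>a\<in>F. es a (bar_act S a A) * star (es a (bar_act S a A)))"
proof -
  have "ext_q S A \<in> Jdl (ext S)" using A by (auto simp: ext_Jdl)
  then have "ep A = (\<Sum>a\<in>Delta (ext S) (ext_q S A).
      ex.u_s a (act (ext S) a (ext_q S A)) * star (ex.u_s a (act (ext S) a (ext_q S A))))"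
    by (rule ex.u_p_sum)
  also have "\<dots> = (\<Sum>a\<in>Delta (ext S) (ext_q S A). es a (bar_act S a A) * star (es a (bar_act S a A)))"
    using A(1) by (intro sum.cong refl) (simp add: Delta_def ext_simps(2) ext_act)
  also have "\<dots> = (\<Sum>a\<in>F. es a (bar_act S a A) * star (es a (bar_act S a A)))"
  proof (rule sum.mono_neutral_left[OF F(1)])
    show "Delta (ext S) (ext_q S A) \<subseteq> F" using ext_Delta_subset[OF A(1)] F(2) by blast
    show "\<forall>a\<in>F - Delta (ext S) (ext_q S A). es a (bar_act S a A) * star (es a (bar_act S a A)) = 0"
    proof
      fix a assume "a \<in> F - Delta (ext S) (ext_q S A)"
      then have a: "a \<in> labels S" "a \<notin> Delta (ext S) (ext_q S A)" using F(3) by auto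
      then have "ext_q S (bar_act S a A) = ext_q S (bot Xbar)"
        using A(1) by (simp add: Delta_def ext_simps(2) ext_act ext_bot)
      then have "ep (bar_act S a A) = 0" using ep_bot by simp
      moreover have "es a (bar_act S a A) * star (es a (bar_act S a A)) =
          es a (emb (act S a (dom A))) * ep (bar_act S a A) * star (es a (emb (act S a (dom A))))"
        using a A(1) dom[OF A(1)] by (intro es_conj) (simp_all add: ble_emb_act)
      ultimately show "es a (bar_act S a A) * star (es a (bar_act S a A)) = 0" by simp
    qed
  qed
  finally show ?thesis .
qed

text \<open>The recursion of \<open>PP\<close> read in the extended algebra, with the same branches
  and the same bound \<open>dom A\<close>; this exact match drives
  \<open>univ_hom_PP\<close>.\<close>

lemma ep_unfold:
  assumes A: "A \<in> car Xbar"
  shows "ep A = ep (emb (A [])) + (\<Sum>a\<in>branches A. es a (emb (act S a (dom A))) *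
    (ep (bar_act S a A) - ep (emb (act S a (A [])))) * star (es a (emb (act S a (dom A)))))"
proof -
  interpret bar: bool_alg Xbar by (rule bar_bool_alg)
  define E D where "E = emb (A [])" and "D = dom A"
  have E: "E \<in> car Xbar" "bar_act S a E = emb (act S a (A []))" if "a \<in> labels S" for a
    using A that by (simp_all add: E_def bar_act_emb)
  have Ecar: "E \<in> car Xbar" using A by (simp add: E_def)
  have D: "D \<in> car X" "ble Xbar A (emb D)" using dom[OF A] by (simp_all add: D_def)
  have ED: "ble Xbar E (emb D)"
    using A D ble_emb_Nil[of A D] by (simp add: E_def bar_ble emb_app act_word_mono)
  \<comment> \<open>Stated for a pair with equal roots, so that it covers \<open>A\<close> minus
    \<open>E\<close> as well as \<open>E\<close> minus \<open>A\<close>; both differences have their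
    branches among those of \<open>A\<close>.\<close>
  have part: "ep (diff Xbar B C) = (\<Sum>a\<in>branches A. es a (emb (act S a D)) *
      (ep (bar_act S a B) - ep (meet Xbar (bar_act S a B) (bar_act S a C))) * star (es a (emb (act S a D))))"
    if BC: "B \<in> car Xbar" "C \<in> car Xbar" "ble Xbar B (emb D)" "B [] = C []"
      and eq: "\<And>a. a \<in> labels S \<Longrightarrow> a \<notin> branches A \<Longrightarrow> bar_act S a B = bar_act S a C" for B C
  proof -
    let ?U = "diff Xbar B C"
    have bot: "diff X (B []) (C []) = bot X"
      using BC by (simp add: eq_bot_char char_simps)
    have "bar_act S a ?U = emb (bot X)" if "a \<in> labels S" "a \<notin> branches A" for a
      using eq[OF that] BC that(1) bar_act_closed[OF that(1) BC(2)]
      by (simp add: bar_act_hom emb_hom bar.eq_bot_char bar.char_simps)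
    then have "branches ?U \<subseteq> branches A"
      using bot by (auto simp: branches_def act_simps)
    moreover have "Delta S (?U []) = {}" by (simp add: bot Delta_def act_simps)
    moreover have "?U [] \<in> Jdl S" by (simp add: bot ideal_bot[OF Jdl_bool_ideal])
    ultimately have "ep ?U = (\<Sum>a\<in>branches A. es a (bar_act S a ?U) * star (es a (bar_act S a ?U)))"
      using BC A by (intro ep_sum) (auto simp: branches_finite branches_labels)
    also have "\<dots> = (\<Sum>a\<in>branches A. es a (emb (act S a D)) * ep (bar_act S a ?U) * star (es a (emb (act S a D))))"
    proof (rule sum.cong[OF refl])
      fix a assume "a \<in> branches A"
      then have a: "a \<in> labels S" by (rule branches_labels)
      have "ble Xbar ?U (emb D)"
        using BC D(1) by (auto simp: bar.ble_char bar.char_simps)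
      then show "es a (bar_act S a ?U) * star (es a (bar_act S a ?U)) =
          es a (emb (act S a D)) * ep (bar_act S a ?U) * star (es a (emb (act S a D)))"
        using a BC D by (intro es_conj) (simp_all add: ble_emb_act)
    qed
    finally show ?thesis
      using BC by (simp add: bar_act_hom ep_diff branches_labels)
  qed
  have agree: "bar_act S a A = bar_act S a E" if "a \<in> labels S" "a \<notin> branches A" for a
    using that by (simp add: E branches_def)
  have AE: "A [] = E []" by (simp add: E_def)
  have partA: "ep (diff Xbar A E) = (\<Sum>a\<in>branches A. es a (emb (act S a D)) *
      (ep (bar_act S a A) - ep (meet Xbar (bar_act S a A) (bar_act S a E))) * star (es a (emb (act S a D))))"
    by (rule part[OF A Ecar D(2) AE]) (rule agree)
  have partE: "ep (diff Xbar E A) = (\<Sum>a\<in>branches A. es a (emb (act S a D)) *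
      (ep (bar_act S a E) - ep (meet Xbar (bar_act S a E) (bar_act S a A))) * star (es a (emb (act S a D))))"
    by (rule part[OF Ecar A ED AE[symmetric]]) (rule agree[symmetric])
  have "ep (diff Xbar A E) - ep (diff Xbar E A) = (\<Sum>a\<in>branches A. es a (emb (act S a D)) *
      (ep (bar_act S a A) - ep (bar_act S a E)) * star (es a (emb (act S a D))))"
    unfolding partA partE sum_subtractf[symmetric]
  proof (rule sum.cong[OF refl])
    fix a assume "a \<in> branches A"
    then have "a \<in> labels S" by (rule branches_labels)
    then have comm: "meet Xbar (bar_act S a E) (bar_act S a A) = meet Xbar (bar_act S a A) (bar_act S a E)"
      using A Ecar by (intro bar.meet_comm) simp_all
    show "es a (emb (act S a D)) * (ep (bar_act S a A) - ep (meet Xbar (bar_act S a A) (bar_act S a E))) *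
          star (es a (emb (act S a D))) -
        es a (emb (act S a D)) * (ep (bar_act S a E) - ep (meet Xbar (bar_act S a E) (bar_act S a A))) *
          star (es a (emb (act S a D))) =
        es a (emb (act S a D)) * (ep (bar_act S a A) - ep (bar_act S a E)) * star (es a (emb (act S a D)))"
      unfolding comm by (simp add: left_diff_distrib right_diff_distrib)
  qed
  \<comment> \<open>Each difference is a projection minus that of the common meet, which
    cancels.\<close>
  moreover have "ep A = ep E + (ep (diff Xbar A E) - ep (diff Xbar E A))"
    using A Ecar bar.meet_comm[of A E] by (simp add: ep_diff)
  ultimately have "ep A = ep E + (\<Sum>a\<in>branches A. es a (emb (act S a D)) *
      (ep (bar_act S a A) - ep (bar_act S a E)) * star (es a (emb (act S a D))))"
    by simp
  then show ?thesis
    by (simp add: E branches_labels flip: D_def E_def)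
qed

definition gen_map :: "('b, 'l) gen \<Rightarrow> (('l list \<Rightarrow> 'b) set, 'l) gen free" where
  "gen_map g = (case g of PGen A \<Rightarrow> pf (iota S A) | SGen a B \<Rightarrow> sf a (iota S B))"

lemma gen_map_simps [simp]:
  "gen_map (PGen A) = pf (iota S A)" "gen_map (SGen a B) = sf a (iota S B)"
  by (simp_all add: gen_map_def)

lemma gens_cases [consumes 1, case_names PGen SGen]:
  assumes "g \<in> gens T"
  obtains A where "A \<in> car (alg T)" "g = PGen A"
    | a B where "a \<in> labels T" "B \<in> Idl T a" "g = SGen a B"
  using assms by (auto simp: gens_def)

lemma iota_closed: "A \<in> car X \<Longrightarrow> iota S A \<in> car (alg (ext S))"
  by (simp add: iota_eq)

lemma gen_map_closed: "g \<in> gens S \<Longrightarrow> gen_map g \<in> free_car (gens (ext S))"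
  by (erule gens_cases) (simp_all add: iota_closed iota_Idl ext_simps(2))

text \<open>Injectivity of \<open>iota\<close> enters here: an image that is nonempty in the base
  keeps a nonempty class, so relation (iv) has the same index set on both sides.\<close>

lemma iota_Delta:
  assumes "A \<in> car X"
  shows "Delta (ext S) (iota S A) = Delta S A"
proof -
  have "ext_q S (emb (act S a A)) = ext_q S (bot Xbar) \<longleftrightarrow> act S a A = bot X" if "a \<in> labels S" for a
    using inj_on_iota assms that by (auto simp: inj_on_def iota_eq simp flip: emb_hom(4))
  then have "a \<in> labels S \<and> act (ext S) a (iota S A) \<noteq> bot (alg (ext S)) \<longleftrightarrow>
      a \<in> labels S \<and> act S a A \<noteq> bot X" for a
    using assms by (cases "a \<in> labels S") (simp_all add: iota_eq ext_act bar_act_emb ext_bot)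
  then show ?thesis by (simp add: Delta_def ext_simps(2))
qed

lemma gen_map_relators:
  assumes "r \<in> relators S"
  shows "r \<in> free_car (gens S)" "ex.c (subst gen_map r) = 0"
proof -
  let ?p = "\<lambda>A. ex.u_p (iota S A)" and ?s = "\<lambda>a A. ex.u_s a (iota S A)"
  have act: "act (ext S) a (iota S A) = iota S (act S a A)" if "a \<in> labels S" "A \<in> car X" for a A
    using that by (simp add: iota_eq ext_act bar_act_emb)
  have meet: "meet (alg (ext S)) (iota S A) (iota S B) = iota S (meet X A B)"
    if "A \<in> car X" "B \<in> car X" for A B
    using that by (simp add: iota_eq ext_ops emb_hom)
  have "r \<in> free_car (gens S) \<and> ex.c (subst gen_map r) = 0"
  proof (rule relators_vanish[where T = S and p = ?p and s = ?s, OF gen_map_closed])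
    show "?p (meet X A B) = ?p A * ?p B" if "A \<in> car X" "B \<in> car X" for A B
      using that ex.u_p_meet[of "iota S A" "iota S B"] by (simp add: meet iota_closed)
    show "?p (join X A B) = ?p A + ?p B - ?p (meet X A B)" if "A \<in> car X" "B \<in> car X" for A B
      using that ep_join[of "emb A" "emb B"] by (simp add: iota_eq emb_hom)
    show "?p A * ?s a B = ?s a B * ?p (act S a A)" if "A \<in> car X" "a \<in> labels S" "B \<in> Idl S a" for A a B
      using that ex.u_p_s[of "iota S A" a "iota S B"]
      by (simp add: act iota_closed iota_Idl ext_simps(2))
    show "star (?s a B) * ?s b C = (if a = b then ?p (meet X B C) else 0)"
      if "a \<in> labels S" "B \<in> Idl S a" "b \<in> labels S" "C \<in> Idl S b" for a B b C
      using that ex.u_s_s[of a "iota S B" b "iota S C"] meet[of B C] Idl_car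
      by (simp add: iota_Idl ext_simps(2))
    show "?p A = (\<Sum>a\<in>Delta S A. ?s a (act S a A) * star (?s a (act S a A)))" if A: "A \<in> Jdl S" for A
    proof -
      have "A \<in> car X" using A by (rule base.Jdl_car)
      then have "iota S A \<in> Jdl (ext S)"
        using A by (auto simp: ext_Jdl iota_eq intro!: imageI)
      from ex.u_p_sum[OF this] \<open>A \<in> car X\<close> show ?thesis
        by (simp add: iota_Delta act base.Delta_labels)
    qed
    show "?p (bot X) = 0" by (simp add: iota_eq emb_hom ep_bot)
  qed (use assms base.Idl_subset base.Jdl_car base.Jdl_act in \<open>simp_all add: ex.u_p_star ex.u_p_idem
      ex.u_s_partial_isometry iota_closed iota_Idl ext_simps(2)\<close>)
  then show "r \<in> free_car (gens S)" "ex.c (subst gen_map r) = 0" by simp_all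
qed

text \<open>The map induced by \<open>gen_map\<close> on algebraic elements, through a chosen
  preimage; \<open>gen_map_relators\<close> makes the choice immaterial on
  \<open>univ_range\<close>. It can be evaluated at \<open>P A\<close> without passing to the
  completion.\<close>

definition univ_hom :: "('b, 'l) gen univ_ring \<Rightarrow> (('l list \<Rightarrow> 'b) set, 'l) gen univ_ring" where
  "univ_hom z = ex.c (subst gen_map (SOME x. x \<in> free_car (gens S) \<and> base.c x = z))"

abbreviation univ_range :: "('b, 'l) gen univ_ring set" where
  "univ_range \<equiv> base.c ` free_car (gens S)"

lemma univ_hom_c:
  assumes x: "x \<in> free_car (gens S)"
  shows "univ_hom (base.c x) = ex.c (subst gen_map x)"
proof -
  have "\<exists>y. y \<in> free_car (gens S) \<and> base.c y = base.c x" using x by blast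
  note y = someI_ex[OF this]
  show ?thesis
    unfolding univ_hom_def
    by (rule cls_subst_cong[OF gen_map_closed gen_map_relators _ x]) (use y in blast)+
qed

lemma univ_range_closed:
  assumes "y \<in> univ_range" "z \<in> univ_range"
  shows "y + z \<in> univ_range" "y - z \<in> univ_range" "y * z \<in> univ_range" "star z \<in> univ_range"
proof -
  obtain x x' where x: "x \<in> free_car (gens S)" "y = base.c x" "x' \<in> free_car (gens S)" "z = base.c x'"
    using assms by blast
  then have "y + z = base.c (x + x')" "y - z = base.c (x - x')" "y * z = base.c (x * x')"
    "star z = base.c (free_star x')"
    by (simp_all add: cls_add cls_diff cls_mult cls_star)
  then show "y + z \<in> univ_range" "y - z \<in> univ_range" "y * z \<in> univ_range" "star z \<in> univ_range" using x by auto
qed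

lemma univ_hom_ops:
  assumes "y \<in> univ_range" "z \<in> univ_range"
  shows "univ_hom (y + z) = univ_hom y + univ_hom z" "univ_hom (y - z) = univ_hom y - univ_hom z"
    "univ_hom (y * z) = univ_hom y * univ_hom z" "univ_hom (star z) = star (univ_hom z)"
proof -
  obtain x x' where x: "x \<in> free_car (gens S)" "y = base.c x" "x' \<in> free_car (gens S)" "z = base.c x'"
    using assms by blast
  have car: "subst gen_map v \<in> free_car (gens (ext S))" if "v \<in> free_car (gens S)" for v
    using that gen_map_closed by (rule subst_car)
  have h: "univ_hom y = ex.c (subst gen_map x)" "univ_hom z = ex.c (subst gen_map x')"
    using x by (simp_all add: univ_hom_c)
  have ops: "y + z = base.c (x + x')" "y - z = base.c (x - x')" "y * z = base.c (x * x')"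
    "star z = base.c (free_star x')"
    using x by (simp_all add: cls_add cls_diff cls_mult cls_star)
  have hops: "univ_hom (base.c (x + x')) = ex.c (subst gen_map (x + x'))"
    "univ_hom (base.c (x - x')) = ex.c (subst gen_map (x - x'))"
    "univ_hom (base.c (x * x')) = ex.c (subst gen_map (x * x'))"
    "univ_hom (base.c (free_star x')) = ex.c (subst gen_map (free_star x'))"
    using x(1,3) by (intro univ_hom_c; simp)+
  show "univ_hom (y + z) = univ_hom y + univ_hom z" "univ_hom (y - z) = univ_hom y - univ_hom z"
    "univ_hom (y * z) = univ_hom y * univ_hom z" "univ_hom (star z) = star (univ_hom z)"
    unfolding ops hops h using car[OF x(1)] car[OF x(3)]
    by (simp_all add: subst_add subst_diff subst_mult subst_star cls_add cls_diff cls_mult cls_star)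
qed

lemma univ_range_0: "0 \<in> univ_range" by (rule image_eqI[of _ _ 0]) simp_all

lemma univ_hom_0: "univ_hom 0 = 0"
  using univ_hom_c[of 0] by simp

lemma univ_range_sum: "(\<And>i. i \<in> I \<Longrightarrow> f i \<in> univ_range) \<Longrightarrow> sum f I \<in> univ_range \<and> univ_hom (sum f I) = (\<Sum>i\<in>I. univ_hom (f i))"
  by (induct I rule: infinite_finite_induct) (simp_all add: univ_range_0 univ_hom_0 univ_range_closed univ_hom_ops)

lemma univ_range_p: "A \<in> car X \<Longrightarrow> base.u_p A \<in> univ_range"
  by simp

lemma univ_range_s: "a \<in> labels S \<Longrightarrow> B \<in> Idl S a \<Longrightarrow> base.u_s a B \<in> univ_range"
  by simp

lemma univ_hom_p: "A \<in> car X \<Longrightarrow> univ_hom (base.u_p A) = ep (emb A)"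
  by (simp add: univ_hom_c iota_eq)

lemma univ_hom_s: "a \<in> labels S \<Longrightarrow> B \<in> Idl S a \<Longrightarrow> univ_hom (base.u_s a B) = es a (emb B)"
  by (simp add: univ_hom_c iota_eq)

text \<open>\<open>PP\<close> is built from generators by finitely many ring operations. Hence it
  lifts to the free algebra, which is what allows \<open>gen_inv\<close> to be a
  substitution.\<close>

lemma PP_univ_range: "A \<in> car Xbar \<Longrightarrow> PP n A \<in> univ_range"
proof (induct n arbitrary: A)
  case 0
  then show ?case by simp
next
  case (Suc n)
  have "conj_s a (act S a (dom A)) (PP n (bar_act S a A) - base.u_p (act S a (A []))) \<in> univ_range"
    if "a \<in> branches A" for a
    unfolding conj_s_def using branches_labels[OF that] Suc dom
    by (intro univ_range_closed univ_range_p univ_range_s Suc(1)) simp_all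
  then show ?case using Suc(2) by (simp add: PP.simps(2) univ_range_closed univ_range_p univ_range_sum)
qed

text \<open>The recursions \<open>PP.simps\<close> and \<open>ep_unfold\<close> correspond term by
  term. The rank hypothesis is needed for the start, where the family must be
  \<open>emb (A [])\<close>.\<close>

lemma univ_hom_PP:
  "A \<in> car Xbar \<Longrightarrow> rank_le n A \<Longrightarrow> univ_hom (PP n A) = ep A"
proof (induct n arbitrary: A)
  case 0
  then show ?case using rank_le_0[of A] by (simp add: univ_hom_p)
next
  case (Suc n)
  let ?z = "\<lambda>a. PP n (bar_act S a A) - base.u_p (act S a (A []))"
  let ?t = "\<lambda>a. conj_s a (act S a (dom A)) (?z a)"
  have t: "?t a \<in> univ_range \<and> univ_hom (?t a) = es a (emb (act S a (dom A))) *
      (ep (bar_act S a A) - ep (emb (act S a (A [])))) * star (es a (emb (act S a (dom A))))"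
    if "a \<in> branches A" for a
  proof -
    have a: "a \<in> labels S" using that by (rule branches_labels)
    have C: "act S a (dom A) \<in> Idl S a" using a dom[OF Suc(2)] by simp
    have z: "PP n (bar_act S a A) \<in> univ_range" "base.u_p (act S a (A [])) \<in> univ_range"
      "base.u_s a (act S a (dom A)) \<in> univ_range"
      using a Suc(2) C by (intro PP_univ_range univ_range_p univ_range_s; simp)+
    have "univ_hom (PP n (bar_act S a A)) = ep (bar_act S a A)"
      using a Suc by (simp add: rank_le_Suc)
    then show ?thesis
      unfolding conj_s_def using a Suc(2) z C
      by (simp add: univ_range_closed univ_hom_ops univ_hom_p univ_hom_s)
  qed
  have "univ_hom (PP (Suc n) A) = univ_hom (base.u_p (A [])) + (\<Sum>a\<in>branches A. univ_hom (?t a))"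
    using t Suc(2) univ_range_sum[of "branches A" ?t] by (simp add: PP.simps(2) univ_hom_ops univ_range_p)
  also have "\<dots> = ep A"
    using ep_unfold[OF Suc(2)] t Suc(2) by (simp add: univ_hom_p)
  finally show ?case .
qed

lemma P_univ_range: "A \<in> car Xbar \<Longrightarrow> P A \<in> univ_range"
  by (simp add: P_def PP_univ_range)

lemma univ_hom_P: "A \<in> car Xbar \<Longrightarrow> univ_hom (P A) = ep A"
  using rank_le_exists[of A] P_eq_PP[of A] univ_hom_PP[of A] by auto

text \<open>A substitution takes values in the free algebra, while \<open>Pext Q\<close> and
  \<open>Sext a Q\<close> are ring elements; any lift serves, as relators are tested only modulo the
  congruence.\<close>

definition gen_inv :: "(('l list \<Rightarrow> 'b) set, 'l) gen \<Rightarrow> ('b, 'l) gen free" where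
  "gen_inv g = (SOME x. x \<in> free_car (gens S) \<and>
     base.c x = (case g of PGen Q \<Rightarrow> Pext Q | SGen a Q \<Rightarrow> Sext a Q))"

lemma gen_inv:
  assumes "g \<in> gens (ext S)"
  shows "gen_inv g \<in> free_car (gens S)"
    "base.c (gen_inv g) = (case g of PGen Q \<Rightarrow> Pext Q | SGen a Q \<Rightarrow> Sext a Q)"
proof -
  have "(case g of PGen Q \<Rightarrow> Pext Q | SGen a Q \<Rightarrow> Sext a Q) \<in> univ_range"
    using assms
  proof (cases rule: gens_cases)
    case (PGen Q)
    then obtain A where "A \<in> car Xbar" "Q = ext_q S A" by (blast elim: ext_carE)
    with PGen show ?thesis using P_univ_range by simp
  next
    case (SGen a Q)
    then have a: "a \<in> labels S" by (simp add: ext_simps(2))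
    obtain A D where "A \<in> car Xbar" "Q = ext_q S A" "D \<in> Idl S a" "ble Xbar A (emb D)"
      using a SGen(2) by (rule ext_IdlE)
    with a SGen(3) show ?thesis
      using univ_range_closed(3)[OF univ_range_s[OF a] P_univ_range] by (simp add: Sext_eq)
  qed
  then have "\<exists>x. x \<in> free_car (gens S) \<and> base.c x = (case g of PGen Q \<Rightarrow> Pext Q | SGen a Q \<Rightarrow> Sext a Q)"
    by force
  from someI_ex[OF this] show "gen_inv g \<in> free_car (gens S)"
    "base.c (gen_inv g) = (case g of PGen Q \<Rightarrow> Pext Q | SGen a Q \<Rightarrow> Sext a Q)"
    unfolding gen_inv_def by blast+
qed

lemma gen_inv_relators:
  assumes "r \<in> relators (ext S)"
  shows "r \<in> free_car (gens (ext S))" "base.c (subst gen_inv r) = 0"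
proof -
  have "r \<in> free_car (gens (ext S)) \<and> base.c (subst gen_inv r) = 0"
    by (rule relators_vanish[where T = "ext S" and p = Pext and s = Sext])
      (use assms ex.Idl_subset in \<open>simp_all add: gen_inv ex.bot_car ex.meet_car ex.join_car ex.act_car
        ex.Jdl_car ex.Jdl_act ext_Pext ext_Pext_bot ext_Pext_ops ext_Pext_Sext ext_Sext_Sext
        ext_Sext_partial_isometry ext_Pext_sum ext_simps(2)\<close>)
  then show "r \<in> free_car (gens (ext S))" "base.c (subst gen_inv r) = 0" by simp_all
qed

lemma gen_inv_gen_map:
  assumes "g \<in> gens S"
  shows "base.c (subst gen_inv (gen_map g)) = base.c (free_gen g)"
  using assms
proof (cases rule: gens_cases)
  case (PGen A)
  then show ?thesis by (simp add: gen_inv iota_closed) (simp add: iota_eq P_emb)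
next
  case (SGen a B)
  have B: "B \<in> car X" using SGen Idl_car by blast
  have "Sext a (iota S B) = base.u_s a B * P (emb B)"
    unfolding iota_eq
    using SGen B by (intro Sext_eq) (simp_all add: bool_alg.ble_refl[OF bar_bool_alg])
  also have "\<dots> = base.u_s a B"
    using SGen B by (simp add: P_emb s_p meet_idem)
  finally show ?thesis
    using SGen by (simp add: gen_inv iota_Idl ext_simps(2))
qed

text \<open>\<open>univ_hom\<close> sends \<open>P A\<close> to \<open>ep A\<close>, hence
  \<open>s a D * P A\<close> to \<open>es a (emb D) * ep A\<close>, which \<open>es_restrict\<close>
  identifies as \<open>es a A\<close>.\<close>

lemma gen_map_gen_inv:
  assumes "g \<in> gens (ext S)"
  shows "ex.c (subst gen_map (gen_inv g)) = ex.c (free_gen g)"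
proof -
  have "ex.c (subst gen_map (gen_inv g)) = univ_hom (case g of PGen Q \<Rightarrow> Pext Q | SGen a Q \<Rightarrow> Sext a Q)"
    using gen_inv[OF assms] univ_hom_c by metis
  also have "\<dots> = ex.c (free_gen g)"
    using assms
  proof (cases rule: gens_cases)
    case (PGen Q)
    then obtain A where "A \<in> car Xbar" "Q = ext_q S A" by (blast elim: ext_carE)
    with PGen show ?thesis by (simp add: univ_hom_P)
  next
    case (SGen a Q)
    then have a: "a \<in> labels S" by (simp add: ext_simps(2))
    obtain A D where A: "A \<in> car Xbar" "Q = ext_q S A" "D \<in> Idl S a" "ble Xbar A (emb D)"
      using a SGen(2) by (rule ext_IdlE)
    have "univ_hom (Sext a Q) = es a (emb D) * ep A"
      unfolding A(2) Sext_eq[OF a A(1,3,4)] using a A by (simp add: univ_hom_ops univ_range_s P_univ_range univ_hom_s univ_hom_P)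
    also have "\<dots> = es a A" using es_restrict[OF a A(3,1,4)] by simp
    finally show ?thesis using SGen A by simp
  qed
  finally show ?thesis .
qed

lemma iso_exists:
  "\<exists>\<Phi>. star_iso (Cstar S) (Cstar (ext S)) \<Phi> \<and>
     (\<forall>x\<in>free_car (gens S). \<Phi> (univ_elem (gens S) (relators S) x) =
        univ_elem (gens (ext S)) (relators (ext S)) (subst gen_map x))"
  unfolding Cstar_def
  by (rule univ_cstar_iso[where f = gen_map and f' = gen_inv])
    (use gen_map_relators gen_inv_relators in \<open>auto simp: base.gens_bounded ex.gens_bounded
      gen_map_closed gen_inv gen_inv_gen_map gen_map_gen_inv\<close>)

section \<open>Range projections of words\<close>

fun chain :: "'l \<Rightarrow> 'b \<Rightarrow> 'l list \<Rightarrow> 'b \<Rightarrow> ('b, 'l) gen free" where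
  "chain a B [] A = sf a A"
| "chain a B (b # w) A = sf a B * chain b (act S b B) w A"

text \<open>This family has empty root, and its only nonempty shift is the one by \<open>a\<close>,
  which is \<open>iota_bar g A\<close>; so the sum of \<open>ep_sum\<close> has a single
  term.\<close>

lemma ep_iota_bar:
  assumes a: "a \<in> labels S" and g: "g \<in> W" and A: "A \<in> Rw S (a # g)"
  shows "ep (iota_bar (a # g) A) = es a (iota_bar g A) * star (es a (iota_bar g A))"
proof -
  let ?I = "iota_bar (a # g) A"
  have "?I \<in> car Xbar" using a g A by (intro iota_bar_closed) simp_all
  moreover have "?I [] = bot X" by (simp add: iota_bar_def)
  ultimately have I: "?I \<in> car Xbar" "?I [] = bot X" .
  have "branches ?I \<union> Delta S (?I []) \<subseteq> {a}"
    by (auto simp: I(2) branches_def Delta_def act_simps bar_act_iota_bar emb_hom)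
  then have "ep ?I = (\<Sum>b\<in>{a}. es b (bar_act S b ?I) * star (es b (bar_act S b ?I)))"
    using I a by (intro ep_sum) (simp_all add: ideal_bot[OF Jdl_bool_ideal])
  then show ?thesis using a by (simp add: bar_act_iota_bar)
qed

lemma iota_bar_ble:
  assumes "g \<in> W" "A \<in> Rw S g" "B \<in> car X" "ble X A (act_word S g B)"
  shows "ble Xbar (iota_bar g A) (emb B)"
proof -
  have "ble X (iota_bar g A w) (act_word S w B)" if w: "w \<in> W" for w
  proof (cases "prefix g w")
    case True
    then obtain v where "w = g @ v" by (auto simp: prefix_def)
    with assms w show ?thesis
      by (simp add: iota_bar_def act_word_append act_word_mono act_word_closed Rw_car)
  next
    case False
    then show ?thesis using assms(3) w by (simp add: iota_bar_def bot_least act_word_closed)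
  qed
  then show ?thesis
    using assms by (simp add: bar_ble iota_bar_closed emb_app)
qed

lemma chain_closed:
  assumes "a \<in> labels S" "w \<in> W" "B \<in> Idl S a" "A \<in> Rw S (a # w)"
  shows "chain a B w A \<in> free_car (gens S)"
  using assms
proof (induct w arbitrary: a B)
  case Nil
  then have "A \<in> Idl S a" using Rw_subset_Idl by blast
  with Nil show ?case by simp
next
  case (Cons b w)
  then have "A \<in> Rw S (b # w)" using Rw_append[of "[a]" "b # w" A] by simp
  with Cons show ?case by (simp add: Idl_car)
qed

lemma cs_chain_eq:
  assumes "a \<in> labels S" "w \<in> W" "B \<in> Idl S a" "A \<in> Rw S (a # w)"
  shows "cs_chain S a B w A = univ_elem (gens S) (relators S) (chain a B w A)"
  using assms
proof (induct w arbitrary: a B)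
  case Nil
  then show ?case by (simp add: cs_def)
next
  case (Cons b w)
  then have "A \<in> Rw S (b # w)" using Rw_append[of "[a]" "b # w" A] by simp
  with Cons show ?case
    by (simp add: cs_def Cstar_def univ_elem_mult[OF base.gens_bounded] chain_closed Idl_car)
qed

text \<open>Prepending a letter conjugates the range projection of the remaining word by
  \<open>es a (emb B)\<close>. The bound on \<open>A\<close> puts that word's family below
  \<open>emb B\<close>, so \<open>es_conj\<close> and \<open>ep_iota_bar\<close> recognise the
  family of the longer word.\<close>

lemma chain_range_projection:
  assumes "a \<in> labels S" "w \<in> W" "B \<in> Idl S a" "A \<in> Rw S (a # w)" "ble X A (act_word S w B)"
  shows "univ_hom (base.c (chain a B w A)) * star (univ_hom (base.c (chain a B w A))) =
    ep (iota_bar (a # w) A)"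
  using assms
proof (induct w arbitrary: a B)
  case Nil
  then have "A \<in> Idl S a" using Rw_subset_Idl by blast
  with Nil show ?case by (simp add: univ_hom_s ep_iota_bar)
next
  case (Cons b w)
  have A: "A \<in> Rw S (b # w)" using Cons Rw_append[of "[a]" "b # w" A] by simp
  have B: "B \<in> car X" "act S b B \<in> Idl S b" using Cons Idl_car by auto
  let ?z = "base.c (chain b (act S b B) w A)"
  have chain: "chain b (act S b B) w A \<in> free_car (gens S)"
    using Cons A B by (intro chain_closed) simp_all
  have IH: "univ_hom ?z * star (univ_hom ?z) = ep (iota_bar (b # w) A)"
    using Cons A B by (intro Cons(1)) simp_all
  have "base.c (chain a B (b # w) A) = base.u_s a B * ?z"
    using Cons chain by (simp add: cls_mult)
  then have "univ_hom (base.c (chain a B (b # w) A)) = es a (emb B) * univ_hom ?z"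
    using Cons chain by (simp add: univ_hom_ops univ_hom_s)
  then have "univ_hom (base.c (chain a B (b # w) A)) * star (univ_hom (base.c (chain a B (b # w) A))) =
      es a (emb B) * (univ_hom ?z * star (univ_hom ?z)) * star (es a (emb B))"
    by (simp add: star_mult mult.assoc)
  also have "\<dots> = es a (iota_bar (b # w) A) * star (es a (iota_bar (b # w) A))"
    unfolding IH using Cons A B
    by (intro es_conj[symmetric] iota_bar_closed iota_bar_ble) simp_all
  also have "\<dots> = ep (iota_bar (a # b # w) A)"
    using Cons by (intro ep_iota_bar[symmetric]) simp_all
  finally show ?case .
qed

lemma word_range_projection:
  assumes g: "g \<in> W" and C: "C \<in> Rw S g"
  obtains x where "x \<in> free_car (gens S)" "cs_word S g C = univ_elem (gens S) (relators S) x"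
    "univ_hom (base.c x) * star (univ_hom (base.c x)) = ep (iota_bar g C)"
proof (cases g)
  case Nil
  have "C \<in> car X" using C by (rule Rw_car)
  moreover from this have "ep (emb C) * star (ep (emb C)) = ep (emb C)"
    using ex.u_p_star[of "ext_q S (emb C)"] ex.u_p_idem[of "ext_q S (emb C)"] by simp
  ultimately show thesis
    using Nil by (intro that[of "pf C"]) (simp_all add: cp_def univ_hom_p)
next
  case (Cons a w)
  let ?B = "SOME B. B \<in> Idl S a \<and> ble X C (act_word S w B)"
  have aw: "a \<in> labels S" "w \<in> W" using g Cons by auto
  \<comment> \<open>Membership in \<open>Rw S (a # w)\<close> bounds \<open>C\<close> by the image
    of some \<open>B\<close> under the whole word; \<open>act S a B\<close> lies in
    \<open>Idl S a\<close> and shows that the choice \<open>?B\<close> is admissible.\<close>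
  obtain B where "B \<in> car X" "ble X C (act_word S w (act S a B))"
    using C Cons by (auto simp: Rw_def)
  then have "\<exists>B. B \<in> Idl S a \<and> ble X C (act_word S w B)"
    using aw by (intro exI[of _ "act S a B"]) simp
  from someI_ex[OF this] have B: "?B \<in> Idl S a" "ble X C (act_word S w ?B)" by simp_all
  show thesis
  proof (rule that)
    show "chain a ?B w C \<in> free_car (gens S)"
      using aw B C Cons by (intro chain_closed) simp_all
    show "cs_word S g C = univ_elem (gens S) (relators S) (chain a ?B w C)"
      using aw B(1) C Cons by (simp add: cs_chain_eq)
    show "univ_hom (base.c (chain a ?B w C)) * star (univ_hom (base.c (chain a ?B w C))) = ep (iota_bar g C)"
      using aw B C Cons by (simp add: chain_range_projection)
  qed
qed

lemma ext_iso:
  "\<exists>\<Phi>. star_iso (Cstar S) (Cstar (ext S)) \<Phi> \<and>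
     (\<forall>A\<in>car X. \<Phi> (cp S A) = cp (ext S) (iota S A)) \<and>
     (\<forall>a\<in>labels S. \<forall>B\<in>Idl S a. \<Phi> (cs S a B) = cs (ext S) a (iota S B)) \<and>
     (\<forall>g\<in>W. \<forall>C\<in>Rw S g.
        \<Phi> (cmult (Cstar S) (cs_word S g C) (cadj (Cstar S) (cs_word S g C))) =
          cp (ext S) (iota_word S g C))"
proof -
  obtain \<Phi> where iso: "star_iso (Cstar S) (Cstar (ext S)) \<Phi>"
    and \<Phi>: "\<And>x. x \<in> free_car (gens S) \<Longrightarrow> \<Phi> (univ_elem (gens S) (relators S) x) =
      univ_elem (gens (ext S)) (relators (ext S)) (subst gen_map x)"
    using iso_exists by blast
  have "\<Phi> (cmult (Cstar S) (cs_word S g C) (cadj (Cstar S) (cs_word S g C))) = cp (ext S) (iota_word S g C)"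
    if g: "g \<in> W" "C \<in> Rw S g" for g C
  proof -
    obtain x where x: "x \<in> free_car (gens S)" "cs_word S g C = univ_elem (gens S) (relators S) x"
      "univ_hom (base.c x) * star (univ_hom (base.c x)) = ep (iota_bar g C)"
      using g by (rule word_range_projection)
    have car: "subst gen_map x \<in> free_car (gens (ext S))"
      using x(1) gen_map_closed by (rule subst_car)
    have "cmult (Cstar S) (cs_word S g C) (cadj (Cstar S) (cs_word S g C)) =
        univ_elem (gens S) (relators S) (x * free_star x)"
      using x(1) by (simp add: x(2) Cstar_def univ_elem_mult[OF base.gens_bounded]
          univ_elem_adj[OF base.gens_bounded])
    then have "\<Phi> (cmult (Cstar S) (cs_word S g C) (cadj (Cstar S) (cs_word S g C))) =
        univ_elem (gens (ext S)) (relators (ext S)) (subst gen_map (x * free_star x))"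
      using x(1) by (simp add: \<Phi>)
    also have "\<dots> = cp (ext S) (iota_word S g C)"
      unfolding cp_def iota_word_eq
    proof (subst univ_elem_eq_iff[OF ex.gens_bounded])
      show "subst gen_map (x * free_star x) \<in> free_car (gens (ext S))"
        using car by (simp add: subst_mult subst_star)
      show "pf (ext_q S (iota_bar g C)) \<in> free_car (gens (ext S))"
        using g by (simp add: iota_bar_closed)
      show "ex.c (subst gen_map (x * free_star x)) = ep (iota_bar g C)"
        using x(1,3) car by (simp add: subst_mult subst_star cls_mult cls_star univ_hom_c)
    qed
    finally show ?thesis .
  qed
  then show ?thesis
    using iso \<Phi> by (intro exI[of _ \<Phi>]) (simp add: cp_def cs_def)
qed

end

theorem theorem4p1:
  fixes S :: "('b, 'l) bds"
  assumes "relative_gbds S"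
  shows "inj_on (iota S) (car (alg S)) \<and>
    (\<exists>\<phi>. star_iso (Cstar S) (Cstar (ext S)) \<phi> \<and>
       (\<forall>A\<in>car (alg S). \<phi> (cp S A) = cp (ext S) (iota S A)) \<and>
       (\<forall>a\<in>labels S. \<forall>B\<in>Idl S a. \<phi> (cs S a B) = cs (ext S) a (iota S B)) \<and>
       (\<forall>g\<in>lists (labels S). \<forall>C\<in>Rw S g.
          \<phi> (cmult (Cstar S) (cs_word S g C) (cadj (Cstar S) (cs_word S g C))) =
            cp (ext S) (iota_word S g C)))"
  using relative_gbds.inj_on_iota[OF assms] relative_gbds.ext_iso[OF assms] by (rule conjI)

end
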